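(* Let $\varepsilon>0$. There exists $C_3<\infty$ and, for every $\lambda\in(0,1)$, positive constants $L_0(\lambda,\varepsilon)$, $C_4(\lambda)$ such that for every $L\ge L_0(\lambda,\varepsilon)$, $$(1-\varepsilon)\log L\;\le\;T_{\mathrm{mix}}\;\le\;(\log L)^{C_3},$$ and $T_{\mathrm{rel}}\le C_4(\lambda)$ for every $L\ge 2$. The constant $C_3$ depends only on the exponent $\rho$ in the definition of $K(\cdot)$.
   Context: Fix $\rho\in(0,1)$ and let $K(j)=\mathcal{C}_K\, j^{-(1+\rho)}$ for integers $j\ge 1$, where $\mathcal{C}_K>0$ is such that $\sum_{j\ge1}K(j)=1$. For an integer $L\ge2$ let $\Omega_L=\{\eta\in\{0,1\}^{\{0,1,\dots,L\}}:\eta_0=\eta_L=1\}$. For $\eta\in\Omega_L$ let $0=x_0<x_1<\dots<x_{n(\eta)+1}=L$ be the ordered list of sites $x$ with $\eta_x=1$ (particles), so $n(\eta)$ is the number of particles strictly between $0$ and $L$. For $\lambda>0$, $\pi_L^\lambda$ is the probability measure on $\Omega_L$ given by $\pi_L^\lambda(\eta)=\frac{\lambda^{n(\eta)}}{Z_L(\lambda)}\prod_{j=0}^{n(\eta)}K(x_{j+1}-x_j)$, with $Z_L(\lambda)$ the normalizing constant. Heat-bath dynamics: the continuous-time Markov chain on $\Omega_L$ with generator $\mathcal{L}f=\sum_{x=1}^{L-1}[\mathcal{Q}_xf-f]$, where $(\mathcal{Q}_xf)(\eta)=\pi_L^\lambda(f\mid \eta_y,\,y\neq x)$; i.e. each site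 $x\in\{1,\dots,L-1\}$ has an independent rate-1 Poisson clock and, when it rings, $\eta_x$ is resampled from $\pi_L^\lambda$ conditioned on the current configuration at all other sites. Let $\mu_t^\sigma$ be the law at time $t$ started from $\sigma\in\Omega_L$, and let $\|\cdot\|$ denote total variation distance, $\|\mu-\nu\|=\frac12\sum_{x}|\mu(x)-\nu(x)|$. The mixing time is $T_{\mathrm{mix}}=\inf\{t\ge0:\sup_{\sigma\in\Omega_L}\|\mu_t^\sigma-\pi_L^\lambda\|\le(2e)^{-1}\}$. The relaxation time is $T_{\mathrm{rel}}=1/\mathrm{gap}$, where $\mathrm{gap}=\inf_f \mathcal{E}_L(f;f)/\pi_L^\lambda(f;f)$, the infimum being over non-constant $f:\Omega_L\to\mathbb{R}$, with $\mathcal{E}_L(f;f)=-\pi_L^\lambda(f\mathcal{L}f)$ the Dirichlet form and $\pi_L^\lambda(f;f)$ the variance of $f$ under $\pi_L^\lambda$. Both times depend on $L,\lambda,\rho$. The exponent $\rho$ is fixed throughout, and constants may depend on it. *)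

theory Defs
  imports "HOL-Analysis.Analysis"
begin

definition K :: "real \<Rightarrow> nat \<Rightarrow> real" where
  "K \<rho> j = inverse (\<Sum>i. real (Suc i) powr - (1 + \<rho>)) * real j powr - (1 + \<rho>)"

lemma K_sums_1:
  assumes "\<rho> > 0"
  shows "(\<lambda>i. K \<rho> (Suc i)) sums 1"
proof -
  let ?f = "\<lambda>i. real (Suc i) powr - (1 + \<rho>)"
  have "summable (\<lambda>i. real i powr - (1 + \<rho>))"
    using assms by (subst summable_real_powr_iff) simp
  then have s: "summable ?f"
    by (subst summable_Suc_iff)
  have "suminf ?f > 0"
    using s by (rule suminf_pos) simp
  then show ?thesis
    using sums_mult[OF summable_sums[OF s], of "inverse (suminf ?f)"]
    by (simp add: K_def)
qed

definition Omega :: "nat \<Rightarrow> (nat \<Rightarrow> nat) set" where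
  "Omega L = {\<eta> \<in> {0..L} \<rightarrow>\<^sub>E {0, 1}. \<eta> 0 = 1 \<and> \<eta> L = 1}"

definition num_particles :: "nat \<Rightarrow> (nat \<Rightarrow> nat) \<Rightarrow> nat" where
  "num_particles L \<eta> = card {x \<in> {0<..<L}. \<eta> x = 1}"

definition particle :: "nat \<Rightarrow> (nat \<Rightarrow> nat) \<Rightarrow> nat \<Rightarrow> nat" where
  "particle L \<eta> j = sorted_list_of_set {x \<in> {0..L}. \<eta> x = 1} ! j"

definition weight :: "real \<Rightarrow> real \<Rightarrow> nat \<Rightarrow> (nat \<Rightarrow> nat) \<Rightarrow> real" where
  "weight \<rho> lam L \<eta> = lam ^ num_particles L \<eta> *
     (\<Prod>j = 0..num_particles L \<eta>. K \<rho> (particle L \<eta> (j + 1) - particle L \<eta> j))"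

definition partition_fun :: "real \<Rightarrow> real \<Rightarrow> nat \<Rightarrow> real" where
  "partition_fun \<rho> lam L = (\<Sum>\<eta>\<in>Omega L. weight \<rho> lam L \<eta>)"

definition equil :: "real \<Rightarrow> real \<Rightarrow> nat \<Rightarrow> (nat \<Rightarrow> nat) \<Rightarrow> real" where
  "equil \<rho> lam L \<eta> = weight \<rho> lam L \<eta> / partition_fun \<rho> lam L"

definition expect :: "real \<Rightarrow> real \<Rightarrow> nat \<Rightarrow> ((nat \<Rightarrow> nat) \<Rightarrow> real) \<Rightarrow> real" where
  "expect \<rho> lam L f = (\<Sum>\<eta>\<in>Omega L. equil \<rho> lam L \<eta> * f \<eta>)"

definition variance :: "real \<Rightarrow> real \<Rightarrow> nat \<Rightarrow> ((nat \<Rightarrow> nat) \<Rightarrow> real) \<Rightarrow> real" where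
  "variance \<rho> lam L f = expect \<rho> lam L (\<lambda>\<eta>. (f \<eta> - expect \<rho> lam L f)\<^sup>2)"

definition same_off :: "nat \<Rightarrow> nat \<Rightarrow> (nat \<Rightarrow> nat) \<Rightarrow> (nat \<Rightarrow> nat) set" where
  "same_off L x \<eta> = {\<xi> \<in> Omega L. \<forall>y\<in>{0..L} - {x}. \<xi> y = \<eta> y}"

text \<open>Conditional expectation given the configuration at all sites other than \<open>x\<close>.\<close>

definition Q :: "real \<Rightarrow> real \<Rightarrow> nat \<Rightarrow> nat \<Rightarrow> ((nat \<Rightarrow> nat) \<Rightarrow> real) \<Rightarrow> (nat \<Rightarrow> nat) \<Rightarrow> real" where
  "Q \<rho> lam L x f \<eta> =
     (\<Sum>\<xi>\<in>same_off L x \<eta>. equil \<rho> lam L \<xi> * f \<xi>) / (\<Sum>\<xi>\<in>same_off L x \<eta>. equil \<rho> lam L \<xi>)"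

definition gen :: "real \<Rightarrow> real \<Rightarrow> nat \<Rightarrow> ((nat \<Rightarrow> nat) \<Rightarrow> real) \<Rightarrow> (nat \<Rightarrow> nat) \<Rightarrow> real" where
  "gen \<rho> lam L f \<eta> = (\<Sum>x\<in>{1..<L}. Q \<rho> lam L x f \<eta> - f \<eta>)"

text \<open>
  The state space is finite, so the Markov semigroup with generator \<open>G = gen \<rho> lam L\<close> is the
  operator exponential of \<open>t G\<close>, and the law at time \<open>t\<close> started from \<open>\<sigma>\<close> gives \<open>\<eta>\<close> the mass
  obtained by applying it to the indicator of \<open>\<eta>\<close> and evaluating at \<open>\<sigma>\<close>.
\<close>

definition semigroup :: "real \<Rightarrow> real \<Rightarrow> nat \<Rightarrow> real \<Rightarrow> ((nat \<Rightarrow> nat) \<Rightarrow> real) \<Rightarrow> (nat \<Rightarrow> nat) \<Rightarrow> real" where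
  "semigroup \<rho> lam L t f \<sigma> = (\<Sum>k. t ^ k / fact k * (gen \<rho> lam L ^^ k) f \<sigma>)"

definition law :: "real \<Rightarrow> real \<Rightarrow> nat \<Rightarrow> real \<Rightarrow> (nat \<Rightarrow> nat) \<Rightarrow> (nat \<Rightarrow> nat) \<Rightarrow> real" where
  "law \<rho> lam L t \<sigma> \<eta> = semigroup \<rho> lam L t (indicator {\<eta>}) \<sigma>"

definition tv_dist :: "nat \<Rightarrow> ((nat \<Rightarrow> nat) \<Rightarrow> real) \<Rightarrow> ((nat \<Rightarrow> nat) \<Rightarrow> real) \<Rightarrow> real" where
  "tv_dist L \<mu> \<nu> = (\<Sum>\<eta>\<in>Omega L. \<bar>\<mu> \<eta> - \<nu> \<eta>\<bar>) / 2"

text \<open>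
  The times and the gap are extended reals, so that an infimum over the empty set and the
  inverse of a zero gap are \<open>\<infinity>\<close>; on \<^typ>\<open>real\<close> these would be junk values.
\<close>

definition T_mix :: "real \<Rightarrow> real \<Rightarrow> nat \<Rightarrow> ereal" where
  "T_mix \<rho> lam L =
     (INF t\<in>{t. 0 \<le> t \<and>
        (SUP \<sigma>\<in>Omega L. tv_dist L (law \<rho> lam L t \<sigma>) (equil \<rho> lam L)) \<le> 1 / (2 * exp 1)}. ereal t)"

definition dirichlet :: "real \<Rightarrow> real \<Rightarrow> nat \<Rightarrow> ((nat \<Rightarrow> nat) \<Rightarrow> real) \<Rightarrow> real" where
  "dirichlet \<rho> lam L f = - expect \<rho> lam L (\<lambda>\<eta>. f \<eta> * gen \<rho> lam L f \<eta>)"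

definition gap :: "real \<Rightarrow> real \<Rightarrow> nat \<Rightarrow> ereal" where
  "gap \<rho> lam L =
     (INF f\<in>{f. \<not> f constant_on Omega L}. ereal (dirichlet \<rho> lam L f / variance \<rho> lam L f))"

definition T_rel :: "real \<Rightarrow> real \<Rightarrow> nat \<Rightarrow> ereal" where
  "T_rel \<rho> lam L = 1 / gap \<rho> lam L"

end

theory Submission
  imports Defs
begin

text \<open>
  Relaxation time. Deleting a particle happens at rate at least \<open>1 / 5\<close>, and the empty
  configuration has positive mass, since a partition function is comparable to a single gap
  weight when \<open>lam < 1\<close>. Deleting the particles from left to right is a canonical path to the
  empty configuration whose congestion is again a partition function over a gap weight, so the
  Poincare inequality holds uniformly in \<open>L\<close>, in the box and in every block of it.

  Mixing, upper bound. Resampling a long block removes its particles and rarely creates new ones.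
  Averaged over all translates of the block, this bounds the mean of \<open>N f\<^sup>2\<close>, where \<open>N\<close> is the
  number of particles, by the Dirichlet form plus the mean of \<open>f\<^sup>2\<close>. As the equilibrium weight of a
  configuration is at least \<open>L\<close> to the power \<open>- D * (N + 1)\<close>, a density with large \<open>L\<^sup>2\<close> norm lives
  where \<open>N\<close> is large. Hence the logarithm of that norm decays at rate of order \<open>1 / ln L\<close> until it is of
  order \<open>ln L\<close>, and then the Poincare inequality takes over: the mixing time is of order at most
  \<open>(ln L)\<^sup>2\<close>.

  Mixing, lower bound. From the full configuration a site keeps its particle at least until its
  clock rings, so up to time \<open>(1 - \<epsilon>) * ln L\<close> some site in the middle of the box is occupied
  with high probability, while in equilibrium the middle is empty with probability close to one.
\<close>

section \<open>Finite reversible chains\<close>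

text \<open>The Poincare inequality alone loses a power of \<open>L\<close>: masses are only bounded
  below by \<open>exp (- D * ln L * L)\<close>, so the logarithm of the initial norm is controlled
  only up to order \<open>L * ln L\<close>, and decay at a constant rate needs a time of that order.
  Large norms must decay faster. With \<open>u\<close> the logarithm of the squared norm, the bound
  on the mean of \<open>N f^2\<close> yields \<open>u' <= - c * u\<close> with \<open>c\<close> of
  order \<open>1 / ln L\<close>, as long as \<open>u\<close> exceeds a multiple of
  \<open>ln L\<close>; the time spent is then only logarithmic in the starting value. Two features
  of \<open>K\<close> carry the estimates: its total mass is one, so that fugacity
  \<open>lam < 1\<close> is subcritical, and it is a power law, so that it changes by a bounded
  factor when its argument does. Together they make a partition function comparable to its one-gap
  term. Configurations are handled as sets of interior particles. The constants come from
  inequalities for such sets that hold for all \<open>L\<close> at once; the chain at fixed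
  \<open>L\<close> only inherits them.\<close>

locale rev_chain =
  fixes X :: "'a set" and p :: "'a \<Rightarrow> real" and m :: "'a \<Rightarrow> 'a \<Rightarrow> real" and c :: real
    and G :: "('a \<Rightarrow> real) \<Rightarrow> 'a \<Rightarrow> real"
  assumes fin: "finite X"
    and p_pos: "x \<in> X \<Longrightarrow> 0 < p x"
    and p_sum: "(\<Sum>x\<in>X. p x) = 1"
    and m_nonneg: "x \<in> X \<Longrightarrow> y \<in> X \<Longrightarrow> 0 \<le> m x y"
    and m_sum: "x \<in> X \<Longrightarrow> (\<Sum>y\<in>X. m x y) = c"
    and rev: "x \<in> X \<Longrightarrow> y \<in> X \<Longrightarrow> p x * m x y = p y * m y x"
    and G: "x \<in> X \<Longrightarrow> G f x = (\<Sum>y\<in>X. m x y * f y) - c * f x"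
begin

section \<open>The semigroup of a finite chain as an exponential series\<close>

definition P :: "real \<Rightarrow> ('a \<Rightarrow> real) \<Rightarrow> 'a \<Rightarrow> real" where
  "P t f x = (\<Sum>k. t ^ k / fact k * (G ^^ k) f x)"

definition ip :: "('a \<Rightarrow> real) \<Rightarrow> ('a \<Rightarrow> real) \<Rightarrow> real" where
  "ip f g = (\<Sum>x\<in>X. p x * f x * g x)"

definition E :: "('a \<Rightarrow> real) \<Rightarrow> real" where
  "E f = - ip f (G f)"

lemma c_nonneg: "x \<in> X \<Longrightarrow> 0 \<le> c"
  using m_sum[of x] by (metis m_nonneg sum_nonneg)

text \<open>\<open>G\<close> is prescribed on \<open>X\<close> only, and its values there depend
  only on values on \<open>X\<close>. Identities valid on \<open>X\<close> are carried through
  powers of \<open>G\<close> in this way.\<close>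

lemma G_cong: "(\<And>y. y \<in> X \<Longrightarrow> f y = g y) \<Longrightarrow> x \<in> X \<Longrightarrow> G f x = G g x"
  by (simp add: G cong: sum.cong)

text \<open>In the sup norm the jump part and the diagonal part of \<open>G\<close> each have norm
  at most \<open>c\<close>, hence the factor \<open>2 * c\<close>. It makes the series converge for
  every \<open>t\<close>.\<close>

lemma Gpow_bound:
  assumes B: "\<And>x. x \<in> X \<Longrightarrow> \<bar>f x\<bar> \<le> B" and x: "x \<in> X"
  shows "\<bar>(G ^^ k) f x\<bar> \<le> (2 * c) ^ k * B"
  using x
proof (induction k arbitrary: x)
  case (Suc k)
  let ?g = "(G ^^ k) f"
  have "\<bar>\<Sum>y\<in>X. m x y * ?g y\<bar> \<le> (\<Sum>y\<in>X. m x y * ((2 * c) ^ k * B))"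
    using Suc m_nonneg
    by (intro order_trans[OF sum_abs] sum_mono) (auto simp: abs_mult intro!: mult_left_mono)
  also have "\<dots> = c * ((2 * c) ^ k * B)"
    using m_sum[OF Suc.prems] by (simp flip: sum_distrib_right)
  finally have 1: "\<bar>\<Sum>y\<in>X. m x y * ?g y\<bar> \<le> c * ((2 * c) ^ k * B)" .
  have 2: "\<bar>c * ?g x\<bar> \<le> c * ((2 * c) ^ k * B)"
    using Suc c_nonneg[OF Suc.prems] by (simp add: abs_mult mult_left_mono)
  show ?case
    using 1 2 by (simp add: G[OF Suc.prems])
qed (use B in simp)

lemma f_bounded: "\<exists>B. \<forall>x\<in>X. \<bar>f x :: real\<bar> \<le> B"
proof -
  have "\<bar>f x\<bar> \<le> (\<Sum>y\<in>X. \<bar>f y\<bar>)" if "x \<in> X" for x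
    using fin that by (meson abs_ge_zero member_le_sum)
  then show ?thesis by blast
qed

lemma P_summable:
  assumes x: "x \<in> X"
  shows "summable (\<lambda>k. t ^ k / fact k * (G ^^ k) f x)"
proof -
  obtain B where B: "\<And>x. x \<in> X \<Longrightarrow> \<bar>f x\<bar> \<le> B"
    using f_bounded by blast
  have s: "summable (\<lambda>k. B * (inverse (fact k) * (\<bar>t\<bar> * (2 * c)) ^ k))"
    by (intro summable_mult summable_exp)
  show ?thesis
  proof (rule summable_comparison_test'[OF s])
    fix n
    have "\<bar>t\<bar> ^ n / fact n * \<bar>(G ^^ n) f x\<bar> \<le> \<bar>t\<bar> ^ n / fact n * ((2 * c) ^ n * B)"
      by (intro mult_left_mono Gpow_bound[OF B x]) auto
    then show "norm (t ^ n / fact n * (G ^^ n) f x) \<le> B * (inverse (fact n) * (\<bar>t\<bar> * (2 * c)) ^ n)"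
      by (simp add: abs_mult power_abs power_mult_distrib field_simps)
  qed
qed

lemma P_0 [simp]: "P 0 f x = f x"
proof -
  have "P 0 f x = (\<Sum>k\<in>{0}. 0 ^ k / fact k * (G ^^ k) f x)"
    unfolding P_def by (rule suminf_finite) auto
  then show ?thesis by simp
qed

lemma P_cong:
  assumes "\<And>y. y \<in> X \<Longrightarrow> f y = g y" "x \<in> X"
  shows "P t f x = P t g x"
proof -
  have "(G ^^ k) f x = (G ^^ k) g x" for k
    using assms(2) by (induction k arbitrary: x) (auto simp: assms(1) intro: G_cong)
  then show ?thesis by (simp add: P_def)
qed

lemma Gpow_add: "x \<in> X \<Longrightarrow> (G ^^ k) (\<lambda>x. a * f x + b * g x) x = a * (G ^^ k) f x + b * (G ^^ k) g x"
proof (induction k arbitrary: x)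
  case (Suc k)
  have "(G ^^ Suc k) (\<lambda>x. a * f x + b * g x) x = G (\<lambda>x. a * (G ^^ k) f x + b * (G ^^ k) g x) x"
    using Suc by (auto intro: G_cong)
  also have "\<dots> = a * (G ^^ Suc k) f x + b * (G ^^ Suc k) g x"
    using Suc.prems by (simp add: G algebra_simps sum.distrib sum_distrib_left)
  finally show ?case .
qed simp

lemma P_lin:
  assumes x: "x \<in> X"
  shows "P t (\<lambda>x. a * f x + b * g x) x = a * P t f x + b * P t g x"
proof -
  have "P t (\<lambda>x. a * f x + b * g x) x
     = (\<Sum>k. a * (t ^ k / fact k * (G ^^ k) f x) + b * (t ^ k / fact k * (G ^^ k) g x))"
    unfolding P_def Gpow_add[OF x] by (simp add: algebra_simps)
  also have "\<dots> = a * P t f x + b * P t g x"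
    unfolding P_def
    by (simp only: suminf_add[symmetric] suminf_mult[OF P_summable[OF x]] summable_mult[OF P_summable[OF x]])
  finally show ?thesis .
qed

lemma P_G:
  assumes x: "x \<in> X"
  shows "P t (G f) x = G (P t f) x"
proof -
  let ?a = "\<lambda>k y. t ^ k / fact k * (G ^^ k) f y"
  have "P t (G f) x = (\<Sum>k. (\<Sum>y\<in>X. m x y * ?a k y) - c * ?a k x)"
    unfolding P_def
  proof (intro suminf_cong)
    fix k
    have "(G ^^ k) (G f) x = G ((G ^^ k) f) x"
      by (metis comp_apply funpow_Suc_right funpow.simps(2))
    then show "t ^ k / fact k * (G ^^ k) (G f) x = (\<Sum>y\<in>X. m x y * ?a k y) - c * ?a k x"
      by (simp add: G[OF x] right_diff_distrib sum_distrib_left mult_ac)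
  qed
  also have "\<dots> = (\<Sum>k. \<Sum>y\<in>X. m x y * ?a k y) - (\<Sum>k. c * ?a k x)"
    by (intro suminf_diff[symmetric] summable_sum summable_mult P_summable x)
  also have "(\<Sum>k. \<Sum>y\<in>X. m x y * ?a k y) = (\<Sum>y\<in>X. \<Sum>k. m x y * ?a k y)"
    by (intro suminf_sum summable_mult P_summable)
  also have "\<dots> = (\<Sum>y\<in>X. m x y * P t f y)"
    unfolding P_def by (intro sum.cong refl suminf_mult P_summable)
  also have "(\<Sum>k. c * ?a k x) = c * P t f x"
    unfolding P_def by (intro suminf_mult P_summable x)
  finally show ?thesis
    by (simp add: G[OF x])
qed

text \<open>Kolmogorov's equation, by termwise differentiation: \<open>diffs\<close> shifts the
  coefficients, which amounts to applying \<open>G\<close> once before the semigroup, and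
  \<open>P_G\<close> moves it outside.\<close>

lemma P_deriv:
  assumes x: "x \<in> X"
  shows "((\<lambda>t. P t f x) has_real_derivative G (P t f) x) (at t)"
proof -
  let ?c = "\<lambda>k. (G ^^ k) f x / fact k"
  have P: "P t f x = (\<Sum>k. ?c k * t ^ k)" for t
    unfolding P_def by (simp add: mult_ac)
  have "((\<lambda>t. \<Sum>k. ?c k * t ^ k) has_real_derivative (\<Sum>k. diffs ?c k * t ^ k)) (at t)"
    using P_summable[OF x, of _ f]
    by (intro termdiffs_strong_converges_everywhere) (simp add: mult_ac)
  also have "diffs ?c = (\<lambda>k. (G ^^ k) (G f) x / fact k)"
    by (auto simp: diffs_def fun_eq_iff funpow_Suc_right simp del: funpow.simps of_nat_Suc)
  finally have "((\<lambda>t. P t f x) has_real_derivative P t (G f) x) (at t)"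
    by (simp add: P P_def mult_ac)
  then show ?thesis by (simp add: P_G[OF x])
qed

section \<open>Self-adjointness and the Dirichlet form\<close>

lemma ip_G_sym: "ip f (G g) = ip g (G f)"
proof -
  have "ip f (G g) = (\<Sum>x\<in>X. \<Sum>y\<in>X. p x * m x y * (f x * g y)) - c * (\<Sum>x\<in>X. p x * f x * g x)" for f g
    unfolding ip_def by (simp add: G right_diff_distrib sum_subtractf sum_distrib_left mult_ac)
  moreover have "(\<Sum>x\<in>X. \<Sum>y\<in>X. p x * m x y * (f x * g y)) = (\<Sum>x\<in>X. \<Sum>y\<in>X. p x * m x y * (g x * f y))"
    by (subst sum.swap) (auto intro!: sum.cong simp: rev)
  ultimately show ?thesis by (simp add: mult_ac)
qed

lemma ip_commute: "ip f g = ip g f"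
  by (simp add: ip_def mult_ac)

lemma ip_Gpow_sym: "ip f ((G ^^ k) g) = ip g ((G ^^ k) f)"
proof (induction k arbitrary: f g)
  case (Suc k)
  have "ip f ((G ^^ Suc k) g) = ip ((G ^^ k) g) (G f)"
    by (simp add: ip_G_sym)
  also have "\<dots> = ip g ((G ^^ k) (G f))"
    using Suc[of "G f" g] by (simp add: ip_commute)
  finally show ?case by (simp add: funpow_Suc_right del: funpow.simps)
qed (simp add: ip_commute)

text \<open>Detailed balance makes \<open>G\<close>, hence every term of the series, self-adjoint
  for \<open>ip\<close>. This is what turns the law started from a point into a density that evolves
  under the same semigroup.\<close>

lemma ip_P_sym: "ip f (P t g) = ip g (P t f)"
proof -
  have "ip f (P t g) = (\<Sum>k. t ^ k / fact k * ip f ((G ^^ k) g))" for f g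
  proof -
    have "ip f (P t g) = (\<Sum>x\<in>X. \<Sum>k. p x * f x * (t ^ k / fact k * (G ^^ k) g x))"
      unfolding ip_def P_def by (intro sum.cong refl suminf_mult[symmetric] P_summable)
    also have "\<dots> = (\<Sum>k. \<Sum>x\<in>X. p x * f x * (t ^ k / fact k * (G ^^ k) g x))"
      by (intro suminf_sum[symmetric] summable_mult P_summable)
    finally show ?thesis
      by (simp add: ip_def sum_distrib_left mult_ac)
  qed
  then show ?thesis by (simp add: ip_Gpow_sym[of f])
qed

lemma ip_deriv:
  "((\<lambda>t. ip (P t f) (P t f)) has_real_derivative - 2 * E (P t f)) (at t)"
  unfolding ip_def E_def
  by (auto intro!: derivative_eq_intros P_deriv simp: sum_distrib_left sum_negf algebra_simps
      cong: sum.cong)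

lemma G_const: "x \<in> X \<Longrightarrow> G (\<lambda>_. a) x = 0"
  by (simp add: G m_sum flip: sum_distrib_right)

lemma P_const:
  assumes "x \<in> X"
  shows "P t (\<lambda>_. a) x = a"
proof -
  have "(G ^^ Suc k) (\<lambda>_. a) x = 0" if "x \<in> X" for k x
    using that
  proof (induction k arbitrary: x)
    case (Suc k)
    have "(G ^^ Suc (Suc k)) (\<lambda>_. a) x = G (\<lambda>_. 0) x"
      using Suc by (auto intro: G_cong)
    then show ?case using G_const[OF Suc.prems] by simp
  qed (simp add: G_const)
  then have "P t (\<lambda>_. a) x = (\<Sum>k\<in>{0}. t ^ k / fact k * (G ^^ k) (\<lambda>_. a) x)"
    unfolding P_def using assms
    by (intro suminf_finite) (auto simp del: funpow.simps dest!: gr0_implies_Suc)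
  then show ?thesis by simp
qed

text \<open>Reversibility lets both squares in the double sum be exchanged, each giving
  \<open>c\<close> times the squared norm. The form as a sum of squares shows nonnegativity.\<close>

lemma E_form: "E f = (\<Sum>x\<in>X. \<Sum>y\<in>X. p x * m x y * (f x - f y)\<^sup>2) / 2"
proof -
  let ?S = "\<lambda>h. \<Sum>x\<in>X. \<Sum>y\<in>X. p x * m x y * h x y"
  have "?S (\<lambda>x y. (f x - f y)\<^sup>2) = ?S (\<lambda>x y. (f x)\<^sup>2) + ?S (\<lambda>x y. (f y)\<^sup>2) - 2 * ?S (\<lambda>x y. f x * f y)"
    by (simp add: power2_diff algebra_simps sum.distrib sum_subtractf sum_distrib_left)
  also have "?S (\<lambda>x y. (f y)\<^sup>2) = ?S (\<lambda>x y. (f x)\<^sup>2)"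
    by (subst sum.swap) (auto intro!: sum.cong simp: rev)
  also have "?S (\<lambda>x y. (f x)\<^sup>2) = c * (\<Sum>x\<in>X. p x * (f x)\<^sup>2)"
  proof -
    have "(\<Sum>y\<in>X. p x * m x y * (f x)\<^sup>2) = c * (p x * (f x)\<^sup>2)" if "x \<in> X" for x
      using m_sum[OF that] by (simp flip: sum_distrib_right sum_distrib_left)
    then show ?thesis by (simp add: sum_distrib_left)
  qed
  finally show ?thesis
    unfolding E_def ip_def
    by (simp add: G right_diff_distrib sum_subtractf sum_distrib_left power2_eq_square mult_ac)
qed

lemma E_nonneg: "0 \<le> E f"
  unfolding E_form by (auto intro!: sum_nonneg mult_nonneg_nonneg m_nonneg less_imp_le[OF p_pos])

lemma min0_sq_deriv: "((\<lambda>x::real. (min x 0)\<^sup>2) has_real_derivative 2 * min x 0) (at x)"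
proof -
  consider "x < 0" | "x = 0" | "x > 0" by linarith
  then show ?thesis
  proof cases
    case 1
    have "((\<lambda>x::real. x\<^sup>2) has_real_derivative 2 * min x 0) (at x)"
      using 1 by (auto intro!: derivative_eq_intros)
    then show ?thesis
      by (rule has_field_derivative_transform_within_open[of _ _ _ "{..<0}"]) (use 1 in auto)
  next
    case 2
    have "(\<lambda>h::real. (min h 0)\<^sup>2 / h) \<midarrow>0\<rightarrow> 0"
    proof (rule Lim_null_comparison)
      show "\<forall>\<^sub>F h::real in at 0. norm ((min h 0)\<^sup>2 / h) \<le> \<bar>h\<bar>"
        by (auto intro!: always_eventually simp: power2_eq_square min_def divide_simps)
      show "(\<lambda>h::real. \<bar>h\<bar>) \<midarrow>0\<rightarrow> 0"
        by (rule tendsto_rabs_zero) (rule tendsto_ident_at)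
    qed
    then show ?thesis
      by (simp add: 2 DERIV_def)
  next
    case 3
    have "((\<lambda>x::real. 0) has_real_derivative 2 * min x 0) (at x)"
      using 3 by (auto intro!: derivative_eq_intros)
    then show ?thesis
      by (rule has_field_derivative_transform_within_open[of _ _ _ "{0<..}"]) (use 3 in auto)
  qed
qed

text \<open>The terms of the series have no fixed sign, so positivity is shown by an energy
  argument: the squared norm \<open>\<phi>\<close> of the negative part of \<open>P s f\<close> is
  nonincreasing and vanishes at time zero. The square is needed for differentiability at
  zero.\<close>

lemma P_nonneg:
  assumes f: "\<And>x. x \<in> X \<Longrightarrow> 0 \<le> f x" and t: "0 \<le> t" and x: "x \<in> X"
  shows "0 \<le> P t f x"
proof -
  define \<phi> where "\<phi> s = (\<Sum>x\<in>X. p x * (min (P s f x) 0)\<^sup>2)" for s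
  have d: "(\<phi> has_real_derivative (\<Sum>x\<in>X. p x * (2 * min (P s f x) 0 * G (P s f) x))) (at s)" for s
    unfolding \<phi>_def
    by (intro DERIV_sum DERIV_cmult DERIV_chain2[OF min0_sq_deriv P_deriv])
  have neg: "(\<Sum>x\<in>X. p x * (2 * min (P s f x) 0 * G (P s f) x)) \<le> 0" for s
  proof -
    define u where "u = P s f"
    define v where "v x = min (u x) 0" for x
    \<comment> \<open>\<open>u - v\<close> is the positive part of \<open>u\<close>: it is
      nonnegative and vanishes wherever \<open>v\<close> does not. Replacing \<open>u\<close> by its
      negative part \<open>v\<close> under \<open>G\<close> can therefore only increase
      \<open>v x * G u x\<close>.\<close>
    have "p x * (v x * G u x) \<le> p x * v x * G v x" if x: "x \<in> X" for x
    proof -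
      have "G u x - G v x = (\<Sum>y\<in>X. m x y * (u y - v y)) - c * (u x - v x)"
        by (simp add: G[OF x] algebra_simps sum_subtractf)
      then have "G u x = G v x + (\<Sum>y\<in>X. m x y * (u y - v y)) - c * (u x - v x)" by simp
      then have "v x * G u x = v x * G v x + v x * (\<Sum>y\<in>X. m x y * (u y - v y)) - c * (v x * (u x - v x))"
        by (simp only: distrib_left right_diff_distrib mult.left_commute[of "v x" c])
      moreover have "v x * (\<Sum>y\<in>X. m x y * (u y - v y)) \<le> 0"
        by (intro mult_nonpos_nonneg sum_nonneg) (auto simp: v_def intro!: mult_nonneg_nonneg m_nonneg x)
      moreover have "v x * (u x - v x) = 0"
        by (auto simp: v_def min_def)
      ultimately have "v x * G u x \<le> v x * G v x" by simp
      then show ?thesis using p_pos[OF x] by (simp add: mult.assoc)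
    qed
    then have "(\<Sum>x\<in>X. p x * (v x * G u x)) \<le> ip v (G v)"
      unfolding ip_def by (intro sum_mono)
    also have "\<dots> \<le> 0" using E_nonneg[of v] by (simp add: E_def)
    finally have "2 * (\<Sum>x\<in>X. p x * (v x * G u x)) \<le> 0" by simp
    then show ?thesis
      unfolding sum_distrib_left by (simp add: u_def v_def mult_ac)
  qed
  have "\<phi> t \<le> \<phi> 0"
    using t by (rule DERIV_nonpos_imp_nonincreasing) (use d neg in blast)
  also have "\<phi> 0 = 0" using f by (simp add: \<phi>_def)
  finally have "\<phi> t \<le> 0" .
  moreover have "p x * (min (P t f x) 0)\<^sup>2 \<le> \<phi> t"
    unfolding \<phi>_def using fin x by (intro member_le_sum) (auto intro!: mult_nonneg_nonneg less_imp_le[OF p_pos])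
  ultimately have "p x * (min (P t f x) 0)\<^sup>2 \<le> 0" by simp
  then have "(min (P t f x) 0)\<^sup>2 \<le> 0"
    using p_pos[OF x] by (simp add: mult_le_0_iff)
  then show ?thesis by (simp add: min_def split: if_splits)
qed

lemma P_mono:
  assumes "\<And>x. x \<in> X \<Longrightarrow> f x \<le> g x" "0 \<le> t" "x \<in> X"
  shows "P t f x \<le> P t g x"
  using P_nonneg[of "\<lambda>x. 1 * g x + (-1) * f x" t x] assms unfolding P_lin[OF assms(3)] by simp

section \<open>Densities and the decay of their norm\<close>

lemma mean_sq_le: "(\<Sum>x\<in>X. p x * f x)\<^sup>2 \<le> (\<Sum>x\<in>X. p x * (f x)\<^sup>2)"
proof -
  define a where "a = (\<Sum>x\<in>X. p x * f x)"
  have "0 \<le> (\<Sum>x\<in>X. p x * (f x - a)\<^sup>2)"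
    by (intro sum_nonneg mult_nonneg_nonneg) (auto intro: less_imp_le[OF p_pos])
  also have "\<dots> = (\<Sum>x\<in>X. p x * (f x)\<^sup>2) - 2 * a * (\<Sum>x\<in>X. p x * f x) + a\<^sup>2 * (\<Sum>x\<in>X. p x)"
    by (simp add: power2_diff algebra_simps sum.distrib sum_subtractf sum_distrib_left sum_distrib_right)
  also have "\<dots> = (\<Sum>x\<in>X. p x * (f x)\<^sup>2) - a\<^sup>2"
    by (simp add: p_sum flip: a_def) (simp add: power2_eq_square)
  finally show ?thesis by (simp add: a_def)
qed

text \<open>The density, with respect to \<open>p\<close>, of the law at time \<open>t\<close>
  started from \<open>\<sigma>\<close>: by self-adjointness it is the semigroup applied to the
  density of the point mass (\<open>dens_law\<close>).\<close>

definition dens :: "'a \<Rightarrow> real \<Rightarrow> 'a \<Rightarrow> real" where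
  "dens \<sigma> t = P t (\<lambda>x. if x = \<sigma> then 1 / p \<sigma> else 0)"

lemma dens_law:
  assumes "\<sigma> \<in> X" "\<eta> \<in> X"
  shows "P t (indicator {\<eta>}) \<sigma> = p \<eta> * dens \<sigma> t \<eta>"
proof -
  have "ip (indicator {\<eta>}) (dens \<sigma> t) = ip (\<lambda>x. if x = \<sigma> then 1 / p \<sigma> else 0) (P t (indicator {\<eta>}))"
    unfolding dens_def by (rule ip_P_sym)
  also have "\<dots> = P t (indicator {\<eta>}) \<sigma>"
    using assms fin p_pos[OF assms(1)]
    by (simp add: ip_def if_distrib[where f = "\<lambda>u. _ * u"] if_distribR
        mult.assoc if_distrib[where f = "\<lambda>u. u * _"] cong: if_cong)
  also have "ip (indicator {\<eta>}) (dens \<sigma> t) = (\<Sum>x\<in>X. if x = \<eta> then p x * dens \<sigma> t x else 0)"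
    unfolding ip_def by (intro sum.cong) auto
  finally show ?thesis using assms fin by simp
qed

lemma dens_nonneg: "\<sigma> \<in> X \<Longrightarrow> 0 \<le> t \<Longrightarrow> x \<in> X \<Longrightarrow> 0 \<le> dens \<sigma> t x"
  unfolding dens_def by (intro P_nonneg) (auto intro: less_imp_le[OF p_pos])

lemma dens_mean:
  assumes "\<sigma> \<in> X"
  shows "(\<Sum>x\<in>X. p x * dens \<sigma> t x) = 1"
proof -
  have "ip (\<lambda>_. 1) (dens \<sigma> t) = ip (\<lambda>x. if x = \<sigma> then 1 / p \<sigma> else 0) (P t (\<lambda>_. 1))"
    unfolding dens_def by (rule ip_P_sym)
  also have "\<dots> = 1"
    using assms fin p_pos[OF assms(1)]
    by (simp add: ip_def P_const if_distrib[where f = "\<lambda>u. _ * u"] if_distribR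
        mult.assoc if_distrib[where f = "\<lambda>u. u * _"] cong: if_cong sum.cong)
  finally show ?thesis by (simp add: ip_def)
qed

lemma dens_le:
  assumes "\<sigma> \<in> X" "0 \<le> t" "x \<in> X"
  shows "p x * dens \<sigma> t x \<le> 1"
  unfolding dens_mean[OF assms(1), of t, symmetric] using fin assms(3)
  by (intro member_le_sum mult_nonneg_nonneg)
    (auto intro: less_imp_le[OF p_pos] dens_nonneg[OF assms(1,2)])

text \<open>
  Since \<open>p\<close> is at least \<open>exp (- \<Lambda> * (N + 1))\<close>, a density with large \<open>L\<^sup>2\<close> norm must carry half
  of that norm on points where \<open>N\<close> is large; there the first inequality provides dissipation
  proportional to the logarithm of the norm.
\<close>

lemma dissipation:
  fixes N :: "'a \<Rightarrow> real" and \<sigma> :: 'a and t :: real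
  defines "h \<equiv> dens \<sigma> t"
  assumes FI: "(\<Sum>x\<in>X. p x * N x * (h x)\<^sup>2) \<le> A * E h + B * ip h h"
    and pl: "\<And>x. x \<in> X \<Longrightarrow> exp (- (\<Lambda> * (N x + 1))) \<le> p x"
    and N: "\<And>x. x \<in> X \<Longrightarrow> 0 \<le> N x"
    and A: "0 < A" and B: "0 \<le> B" and \<Lambda>: "1 \<le> \<Lambda>" and \<sigma>: "\<sigma> \<in> X" and t: "0 \<le> t"
    and u: "(8 * B + 4) * \<Lambda> \<le> ln (ip h h)" and H: "0 < ip h h"
  shows "ln (ip h h) / (8 * A * \<Lambda>) * ip h h \<le> E h"
proof -
  define u where "u = ln (ip h h)"
  \<comment> \<open>Where \<open>N + 1 <= n\<close>, the mass \<open>p\<close> is at least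
    \<open>exp (- u / 2)\<close>. As \<open>p * h <= 1\<close>, this gives
    \<open>h <= exp (u / 2)\<close> there, and since \<open>h\<close> has mean one such points
    contribute at most \<open>exp (u / 2)\<close> to the norm \<open>exp u\<close>.\<close>
  define n where "n = u / (2 * \<Lambda>)"
  have Hu: "ip h h = exp u" using H by (simp add: u_def)
  have u4: "(8 * B + 4) * \<Lambda> \<le> u" using u by (simp add: u_def)
  have "4 * \<Lambda> \<le> (8 * B + 4) * \<Lambda>" using B \<Lambda> by (intro mult_right_mono) auto
  then have u4': "4 * \<Lambda> \<le> u" "4 \<le> u" using u4 \<Lambda> by linarith+
  have n1: "1 \<le> n" using u4' \<Lambda> by (simp add: n_def field_simps)
  let ?Y = "{x\<in>X. N x + 1 \<le> n}" and ?Z = "{x\<in>X. \<not> N x + 1 \<le> n}"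
  have split: "ip h h = (\<Sum>x\<in>?Y. p x * (h x)\<^sup>2) + (\<Sum>x\<in>?Z. p x * (h x)\<^sup>2)"
  proof -
    have "X = ?Y \<union> ?Z" by auto
    then have "ip h h = (\<Sum>x\<in>?Y \<union> ?Z. p x * (h x)\<^sup>2)"
      by (simp add: ip_def power2_eq_square mult.assoc)
    then show ?thesis using fin by (simp add: sum.union_disjoint disjoint_iff)
  qed
  have h0: "0 \<le> h x" if "x \<in> X" for x
    using dens_nonneg[OF \<sigma> t that] by (simp add: h_def)
  have "(\<Sum>x\<in>?Y. p x * (h x)\<^sup>2) \<le> (\<Sum>x\<in>?Y. p x * h x * exp (u / 2))"
  proof (rule sum_mono)
    fix x assume x: "x \<in> ?Y"
    then have xX: "x \<in> X" by simp
    have "exp (- (u / 2)) \<le> exp (- (\<Lambda> * (N x + 1)))"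
      using x \<Lambda> by (simp add: n_def field_simps)
    then have "exp (- (u / 2)) * h x \<le> p x * h x"
      using pl[OF xX] h0[OF xX] by (intro mult_right_mono order_trans[OF _ pl[OF xX]])
    also have "\<dots> \<le> 1" using dens_le[OF \<sigma> t xX] by (simp add: h_def)
    finally have "h x \<le> exp (u / 2)"
      by (simp add: exp_minus field_simps)
    then show "p x * (h x)\<^sup>2 \<le> p x * h x * exp (u / 2)"
      using h0[OF xX] p_pos[OF xX] by (simp add: power2_eq_square mult_left_mono)
  qed
  also have "\<dots> \<le> (\<Sum>x\<in>X. p x * h x * exp (u / 2))"
    using fin h0 by (intro sum_mono2) (auto intro!: mult_nonneg_nonneg intro: less_imp_le[OF p_pos])
  also have "\<dots> = exp (u / 2)"
    using dens_mean[OF \<sigma>, of t] by (simp add: h_def flip: sum_distrib_right)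
  also have "\<dots> \<le> exp u / 2"
  proof -
    have "2 \<le> exp (u / 2)" using exp_ge_add_one_self[of "u / 2"] u4' by linarith
    then have "exp (u / 2) * 2 \<le> exp (u / 2) * exp (u / 2)" by (intro mult_left_mono) auto
    also have "\<dots> = exp u" by (simp flip: exp_add)
    finally show ?thesis by simp
  qed
  finally have Z: "ip h h / 2 \<le> (\<Sum>x\<in>?Z. p x * (h x)\<^sup>2)"
    using split Hu by linarith
  have "(n - 1) * (ip h h / 2) \<le> (n - 1) * (\<Sum>x\<in>?Z. p x * (h x)\<^sup>2)"
    using Z n1 by (intro mult_left_mono) auto
  also have "\<dots> = (\<Sum>x\<in>?Z. (n - 1) * (p x * (h x)\<^sup>2))"
    by (simp add: sum_distrib_left)
  also have "\<dots> \<le> (\<Sum>x\<in>?Z. N x * (p x * (h x)\<^sup>2))"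
    by (intro sum_mono mult_right_mono mult_nonneg_nonneg) (auto intro: less_imp_le[OF p_pos])
  also have "\<dots> \<le> (\<Sum>x\<in>X. N x * (p x * (h x)\<^sup>2))"
    using fin N by (intro sum_mono2) (auto intro!: mult_nonneg_nonneg intro: less_imp_le[OF p_pos])
  also have "\<dots> \<le> A * E h + B * ip h h" using FI by (simp add: mult_ac)
  finally have 1: "((n - 1) / 2 - B) * ip h h \<le> A * E h" by (simp add: algebra_simps)
  \<comment> \<open>This inequality is equivalent to the threshold
    \<open>(8 * B + 4) * \<Lambda> <= u\<close>: beyond it the term with \<open>B\<close> costs at
    most half of \<open>n / 2\<close>.\<close>
  have "u / (8 * \<Lambda>) \<le> (n - 1) / 2 - B"
    using u4 \<Lambda> by (simp add: n_def field_simps)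
  then have "u / (8 * \<Lambda>) * ip h h \<le> A * E h"
    using 1 H by (meson mult_right_mono order_trans less_imp_le)
  then have "u / (8 * \<Lambda>) * ip h h \<le> E h * A" by (simp only: mult.commute)
  then have "u / (8 * \<Lambda>) * ip h h / A \<le> E h" by (simp only: pos_divide_le_eq[OF A])
  then show ?thesis by (simp add: u_def mult_ac)
qed

text \<open>Two differential inequalities for the squared norm \<open>H\<close>, one after the
  other: down to the threshold \<open>exp us\<close> by \<open>dissipation\<close>, then down to one
  by \<open>PO\<close>. The two summands of the lower bound on \<open>t\<close> are the durations of
  these phases.\<close>

theorem mixing:
  fixes N :: "'a \<Rightarrow> real"
  assumes FI: "\<And>f. (\<Sum>x\<in>X. p x * N x * (f x)\<^sup>2) \<le> A * E f + B * ip f f"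
    and PO: "\<And>f. ip f f - (\<Sum>x\<in>X. p x * f x)\<^sup>2 \<le> R * E f"
    and pl: "\<And>x. x \<in> X \<Longrightarrow> exp (- (\<Lambda> * (N x + 1))) \<le> p x"
    and N: "\<And>x. x \<in> X \<Longrightarrow> 0 \<le> N x" "\<And>x. x \<in> X \<Longrightarrow> N x + 1 \<le> Nm"
    and A: "0 < A" and B: "0 \<le> B" and R: "0 < R" and \<Lambda>: "1 \<le> \<Lambda>" and \<sigma>: "\<sigma> \<in> X"
    and t: "4 * A * \<Lambda> * ln (\<Lambda> * Nm) + R * ((8 * B + 4) * \<Lambda> + 2) / 2 \<le> t"
  shows "(\<Sum>\<eta>\<in>X. \<bar>P t (indicator {\<eta>}) \<sigma> - p \<eta>\<bar>) / 2 \<le> 1 / (2 * exp 1)"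
proof -
  define h where "h = dens \<sigma>"
  define H where "H s = ip (h s) (h s)" for s
  define us where "us = (8 * B + 4) * \<Lambda>"
  \<comment> \<open>\<open>ln (H s)\<close> decays at rate \<open>c\<close> and starts at or below
    \<open>\<Lambda> * Nm\<close>; \<open>T\<close> is the time at which \<open>exp (c * T)\<close>
    equals that bound.\<close>
  define T where "T = 4 * A * \<Lambda> * ln (\<Lambda> * Nm)"
  define c where "c = 1 / (4 * A * \<Lambda>)"
  have us4: "4 \<le> us"
  proof -
    have "4 * 1 \<le> (8 * B + 4) * \<Lambda>" using B \<Lambda> by (intro mult_mono) auto
    then show ?thesis by (simp add: us_def)
  qed
  have Nm: "1 \<le> Nm" using N[OF \<sigma>] by linarith
  have LN: "1 \<le> \<Lambda> * Nm" using Nm \<Lambda> by (metis mult_mono mult_1 zero_le_one order_trans)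
  have T0: "0 \<le> T" using LN A \<Lambda> by (auto simp: T_def intro!: mult_nonneg_nonneg)
  have c0: "0 < c" using A \<Lambda> by (simp add: c_def)
  have tT: "T + R * (us + 2) / 2 \<le> t" using t by (simp add: T_def us_def)
  have "0 \<le> R * (us + 2) / 2" using R us4 by simp
  then have t0: "T \<le> t" "0 \<le> t" using tT T0 by linarith+
  have dH: "(H has_real_derivative - 2 * E (h s)) (at s)" for s
    unfolding H_def h_def dens_def by (rule ip_deriv)
  have H1: "1 \<le> H s" for s
    using mean_sq_le[of "h s"] dens_mean[OF \<sigma>, of s]
    by (simp add: H_def h_def ip_def power2_eq_square mult.assoc)
  have Hmono: "H b \<le> H a" if "a \<le> b" for a b
    using that by (rule DERIV_nonpos_imp_nonincreasing) (use dH E_nonneg in \<open>force intro: exI\<close>)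
  \<comment> \<open>If \<open>H\<close> exceeded the threshold at \<open>T\<close>, it would do so
    on all of \<open>[0, T]\<close>; the decay would then bring \<open>ln (H T)\<close> down to at
    most one, although \<open>us\<close> is at least four.\<close>
  have HT: "H T \<le> exp us"
  proof (rule ccontr)
    assume *: "\<not> H T \<le> exp us"
    have big: "us \<le> ln (H s)" if "s \<le> T" for s
    proof -
      have "exp us \<le> H s" using * Hmono[OF that] by linarith
      then show ?thesis by (metis exp_gt_zero ln_exp ln_mono order_less_le_trans)
    qed
    define v where "v s = ln (H s) * exp (c * s)" for s
    have "v T \<le> v 0"
    proof (rule DERIV_nonpos_imp_nonincreasing[OF T0])
      fix s assume s: "0 \<le> s" "s \<le> T"
      have Hs: "0 < H s" using H1[of s] by linarith
      have "(v has_real_derivative (- 2 * E (h s) / H s + c * ln (H s)) * exp (c * s)) (at s)"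
        unfolding v_def using Hs by (auto intro!: derivative_eq_intros dH simp: algebra_simps)
      moreover have "ln (H s) / (8 * A * \<Lambda>) * H s \<le> E (h s)"
        unfolding H_def h_def
      proof (rule dissipation[OF FI pl N(1) A B \<Lambda> \<sigma> s(1)])
        show "(8 * B + 4) * \<Lambda> \<le> ln (ip (dens \<sigma> s) (dens \<sigma> s))"
          using big[OF s(2)] by (simp add: us_def H_def h_def)
        show "0 < ip (dens \<sigma> s) (dens \<sigma> s)" using Hs by (simp add: H_def h_def)
      qed
      then have "c * ln (H s) \<le> 2 * E (h s) / H s"
        using Hs by (simp add: c_def field_simps)
      then have "(- 2 * E (h s) / H s + c * ln (H s)) * exp (c * s) \<le> 0"
        by (intro mult_nonpos_nonneg) auto
      ultimately show "\<exists>y. (v has_real_derivative y) (at s) \<and> y \<le> 0" by blast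
    qed
    moreover have "v 0 \<le> \<Lambda> * Nm"
    proof -
      have "H 0 = 1 / p \<sigma>"
        using fin \<sigma> p_pos[OF \<sigma>] unfolding H_def h_def dens_def ip_def
        by (simp add: if_distrib[where f = "\<lambda>u. _ * u"] if_distribR mult.assoc
            if_distrib[where f = "\<lambda>u. u * _"] cong: if_cong)
      moreover have "- (\<Lambda> * (N \<sigma> + 1)) \<le> ln (p \<sigma>)"
        using pl[OF \<sigma>] p_pos[OF \<sigma>] by (simp add: ln_ge_iff)
      moreover have "\<Lambda> * (N \<sigma> + 1) \<le> \<Lambda> * Nm"
        using N(2)[OF \<sigma>] \<Lambda> by (intro mult_left_mono) auto
      ultimately show ?thesis
        using p_pos[OF \<sigma>] by (simp add: v_def ln_div)
    qed
    moreover have "exp (c * T) = \<Lambda> * Nm"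
    proof -
      have "c * T = ln (\<Lambda> * Nm)" using A \<Lambda> by (simp add: c_def T_def)
      then show ?thesis using LN by simp
    qed
    moreover have "us * (\<Lambda> * Nm) \<le> ln (H T) * (\<Lambda> * Nm)"
      using big[of T] LN by (intro mult_right_mono) auto
    ultimately have "us * (\<Lambda> * Nm) \<le> 1 * (\<Lambda> * Nm)" by (simp add: v_def)
    then have "us \<le> 1" using LN by (subst (asm) mult_le_cancel_right) auto
    then show False using us4 by linarith
  qed
  have Ht: "H t - 1 \<le> exp (- 2)"
  proof -
    \<comment> \<open>\<open>H - 1\<close> is the variance of the density and decays at rate
      \<open>2 / R\<close>. The extra time \<open>R * (us + 2) / 2\<close> turns the factor
      \<open>exp us\<close> into \<open>exp (- 2)\<close>.\<close>
    define W where "W s = (H s - 1) * exp (2 / R * s)" for s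
    have "W t \<le> W T"
    proof (rule DERIV_nonpos_imp_nonincreasing[OF t0(1)])
      fix s
      have "(W has_real_derivative (- 2 * E (h s) + 2 / R * (H s - 1)) * exp (2 / R * s)) (at s)"
        unfolding W_def using R
        by (auto intro!: derivative_eq_intros dH simp: algebra_simps add_divide_distrib diff_divide_distrib)
      moreover have "H s - 1 \<le> R * E (h s)"
        using PO[of "h s"] dens_mean[OF \<sigma>, of s] by (simp add: H_def h_def)
      then have "2 / R * (H s - 1) \<le> 2 * E (h s)"
        using R by (simp add: field_simps)
      then have "(- 2 * E (h s) + 2 / R * (H s - 1)) * exp (2 / R * s) \<le> 0"
        by (intro mult_nonpos_nonneg) auto
      ultimately show "\<exists>y. (W has_real_derivative y) (at s) \<and> y \<le> 0" by blast
    qed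
    also have "\<dots> \<le> exp us * exp (2 / R * T)"
      using HT unfolding W_def by (intro mult_right_mono) auto
    finally have "H t - 1 \<le> exp us * exp (2 / R * T) / exp (2 / R * t)"
      by (simp add: W_def pos_le_divide_eq)
    also have "\<dots> = exp (us + 2 / R * T - 2 / R * t)"
      by (simp add: exp_add exp_diff)
    also have "\<dots> \<le> exp (- 2)"
    proof -
      have "T / R + (us + 2) / 2 \<le> t / R"
        using divide_right_mono[OF tT, of R] R by (simp add: add_divide_distrib)
      moreover have "us + 2 * x - 2 * y \<le> - 2" if "x + (us + 2) / 2 \<le> y" for x y
        using that by (simp add: field_simps)
      ultimately have "us + 2 * (T / R) - 2 * (t / R) \<le> - 2" by blast
      then show ?thesis by simp
    qed
    finally show ?thesis .
  qed
  \<comment> \<open>\<open>S\<close> is twice the total variation distance. By Cauchy-Schwarz it is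
    at most the square root of the variance, so \<open>exp (- 2)\<close> is exactly what the
    threshold \<open>1 / (2 * exp 1)\<close> requires.\<close>
  define S where "S = (\<Sum>x\<in>X. p x * \<bar>h t x - 1\<bar>)"
  have "S\<^sup>2 \<le> (\<Sum>x\<in>X. p x * \<bar>h t x - 1\<bar>\<^sup>2)"
    unfolding S_def by (rule mean_sq_le)
  also have "\<dots> = H t - 2 * (\<Sum>x\<in>X. p x * h t x) + (\<Sum>x\<in>X. p x)"
    by (simp add: H_def ip_def power2_diff power2_eq_square algebra_simps sum.distrib sum_subtractf sum_distrib_left)
  also have "\<dots> = H t - 1"
    using dens_mean[OF \<sigma>, of t] by (simp add: p_sum h_def)
  also have "\<dots> \<le> (exp (- 1))\<^sup>2" using Ht by (simp flip: exp_double)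
  finally have "S \<le> exp (- 1)"
    by (rule power2_le_imp_le) simp
  moreover have "(\<Sum>\<eta>\<in>X. \<bar>P t (indicator {\<eta>}) \<sigma> - p \<eta>\<bar>) = S"
    unfolding S_def
  proof (rule sum.cong[OF refl])
    fix \<eta> assume "\<eta> \<in> X"
    then have "P t (indicator {\<eta>}) \<sigma> - p \<eta> = p \<eta> * (h t \<eta> - 1)"
      by (simp add: dens_law[OF \<sigma>] h_def algebra_simps)
    then show "\<bar>P t (indicator {\<eta>}) \<sigma> - p \<eta>\<bar> = p \<eta> * \<bar>h t \<eta> - 1\<bar>"
      using p_pos[OF \<open>\<eta> \<in> X\<close>] by (simp add: abs_mult)
  qed
  ultimately show ?thesis by (simp add: exp_minus field_simps)
qed

end

section \<open>Renewal weights\<close>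

lemma sum_Pow_split:
  fixes h :: "'a set \<Rightarrow> real"
  assumes "V \<subseteq> X"
  shows "(\<Sum>S\<in>Pow X. h S) = (\<Sum>T\<in>Pow (X - V). \<Sum>U\<in>Pow V. h (T \<union> U))"
proof -
  have "(\<Sum>S\<in>Pow X. h S) = (\<Sum>(T, U)\<in>Pow (X - V) \<times> Pow V. h (T \<union> U))"
    by (rule sum.reindex_bij_witness[where i = "\<lambda>(T, U). T \<union> U" and j = "\<lambda>S. (S - V, S \<inter> V)"])
      (use assms in \<open>auto simp: Un_Diff_Int\<close>)
  then show ?thesis by (simp add: sum.cartesian_product)
qed

lemma sum_Pow_member:
  fixes h :: "'a set \<Rightarrow> real"
  assumes "x \<in> X" "finite X"
  shows "(\<Sum>S\<in>Pow X. if x \<in> S then h S else 0) = (\<Sum>T\<in>Pow (X - {x}). h (insert x T))"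
proof -
  have "(\<Sum>S\<in>Pow X. if x \<in> S then h S else 0)
     = (\<Sum>T\<in>Pow (X - {x}). \<Sum>U\<in>Pow {x}. if x \<in> T \<union> U then h (T \<union> U) else 0)"
    using assms by (intro sum_Pow_split) auto
  also have "\<dots> = (\<Sum>T\<in>Pow (X - {x}). h (insert x T))"
  proof (intro sum.cong refl)
    fix T assume T: "T \<in> Pow (X - {x})"
    have "Pow {x} = {{}, {x}}" by auto
    then show "(\<Sum>U\<in>Pow {x}. if x \<in> T \<union> U then h (T \<union> U) else 0) = h (insert x T)"
      using T by auto
  qed
  finally show ?thesis .
qed

text \<open>The pairs \<open>S\<close>, \<open>S - {x}\<close> are the two states between which the
  heat bath at \<open>x\<close> chooses.\<close>

lemma sum_Pow_pair:
  fixes h :: "'a set \<Rightarrow> real"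
  assumes "x \<in> X" "finite X"
  shows "(\<Sum>S\<in>Pow X. h S) = (\<Sum>S\<in>Pow X. if x \<in> S then h S + h (S - {x}) else 0)"
proof -
  have "(\<Sum>S\<in>Pow X. h S) = (\<Sum>T\<in>Pow (X - {x}). \<Sum>U\<in>Pow {x}. h (T \<union> U))"
    using assms by (intro sum_Pow_split) auto
  also have "\<dots> = (\<Sum>T\<in>Pow (X - {x}). h (insert x T) + h (insert x T - {x}))"
  proof (intro sum.cong refl)
    fix T assume T: "T \<in> Pow (X - {x})"
    have "Pow {x} = {{}, {x}}" "insert x T - {x} = T" using T by auto
    then show "(\<Sum>U\<in>Pow {x}. h (T \<union> U)) = h (insert x T) + h (insert x T - {x})"
      by simp
  qed
  also have "\<dots> = (\<Sum>S\<in>Pow X. if x \<in> S then h S + h (S - {x}) else 0)"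
    by (rule sum_Pow_member[OF assms, symmetric])
  finally show ?thesis .
qed

section \<open>The power-law kernel \<open>K\<close>\<close>

locale renewal =
  fixes \<rho> :: real
  assumes \<rho>: "0 < \<rho>" "\<rho> < 1"
begin

text \<open>\<open>powr\<close> with base zero is zero. Hence gaps of length zero and truncated
  differences of naturals carry no weight, and \<open>K\<close> can be summed from index
  zero.\<close>

lemma K_0 [simp]: "K \<rho> 0 = 0"
  by (simp add: K_def)

lemma K_sums: "K \<rho> sums 1"
  using K_sums_1[OF \<rho>(1)] sums_Suc[of "K \<rho>" 1] by simp

lemma CK_pos: "0 < inverse (\<Sum>i. real (Suc i) powr - (1 + \<rho>))"
proof -
  have "(\<Sum>i. real (Suc i) powr - (1 + \<rho>)) \<ge> 0"
  proof (rule suminf_nonneg)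
    have "summable (\<lambda>i. real i powr - (1 + \<rho>))"
      using \<rho> by (subst summable_real_powr_iff) simp
    then show "summable (\<lambda>i. real (Suc i) powr - (1 + \<rho>))" by (subst summable_Suc_iff)
  qed simp
  moreover have "(\<Sum>i. real (Suc i) powr - (1 + \<rho>)) \<noteq> 0"
  proof
    assume "(\<Sum>i. real (Suc i) powr - (1 + \<rho>)) = 0"
    then have "(\<lambda>i::nat. 0::real) sums 1"
      using K_sums_1[OF \<rho>(1)] by (simp add: K_def)
    then show False using sums_unique2[OF _ sums_zero] by force
  qed
  ultimately show ?thesis by simp
qed

lemma K_pos: "0 < j \<Longrightarrow> 0 < K \<rho> j"
  using CK_pos by (simp add: K_def)

lemma K_nonneg [simp]: "0 \<le> K \<rho> j"
  using K_pos[of j] by (cases "j = 0") auto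

text \<open>The injective \<open>g\<close> allows \<open>K\<close> to be summed over distances to a
  fixed site, on either side of it.\<close>

lemma K_sum_le:
  assumes "finite A" "inj_on g A"
  shows "(\<Sum>z\<in>A. K \<rho> (g z)) \<le> 1"
proof -
  have "(\<Sum>z\<in>A. K \<rho> (g z)) = sum (K \<rho>) (g ` A)"
    using assms by (simp add: sum.reindex)
  also have "\<dots> \<le> suminf (K \<rho>)"
    using assms K_sums by (intro sum_le_suminf) (auto simp: sums_iff)
  finally show ?thesis using K_sums by (simp add: sums_iff)
qed

lemma K_le_1: "K \<rho> j \<le> 1"
  using K_sum_le[of "{0::nat}" "\<lambda>_. j"] by simp

lemma K_tail:
  assumes "0 < \<epsilon>"
  shows "\<exists>J. \<forall>A. finite A \<longrightarrow> A \<subseteq> {J..} \<longrightarrow> sum (K \<rho>) A \<le> \<epsilon>"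
proof -
  have "summable (K \<rho>)" using K_sums by (simp add: sums_iff)
  then have "(\<lambda>n. \<Sum>i. K \<rho> (i + n)) \<longlonglongrightarrow> 0"
    by (rule suminf_exist_split2)
  then obtain J where J: "norm (\<Sum>i. K \<rho> (i + J)) < \<epsilon>"
    using assms by (metis LIMSEQ_D[of _ 0] diff_zero le_refl)
  have "sum (K \<rho>) A \<le> \<epsilon>" if A: "finite A" "A \<subseteq> {J..}" for A
  proof -
    have "sum (K \<rho>) A = (\<Sum>i\<in>(\<lambda>x. x - J) ` A. K \<rho> (i + J))"
      using A by (intro sum.reindex_bij_witness[where i = "\<lambda>i. i + J" and j = "\<lambda>x. x - J"]) auto
    also have "\<dots> \<le> (\<Sum>i. K \<rho> (i + J))"
      using A \<open>summable (K \<rho>)\<close> by (intro sum_le_suminf) (auto simp: summable_iff_shift)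
    finally show ?thesis using J by simp
  qed
  then show ?thesis by blast
qed

text \<open>Shrinking the argument by the factor \<open>r\<close> costs at most
  \<open>r powr - (1 + \<rho>)\<close>, and \<open>1 + \<rho> <= 2\<close>. The integer exponent
  keeps later constants free of \<open>\<rho>\<close>.\<close>

lemma K_scale:
  assumes r: "0 < r" "r \<le> 1" and i: "r * real m \<le> real i" and m: "1 \<le> m"
  shows "K \<rho> i \<le> K \<rho> m / r\<^sup>2"
proof -
  have "real i powr - (1 + \<rho>) \<le> (r * real m) powr - (1 + \<rho>)"
    using assms \<rho> by (intro powr_mono2') auto
  also have "\<dots> = r powr - (1 + \<rho>) * real m powr - (1 + \<rho>)"
    using assms by (simp add: powr_mult)
  also have "r powr - (1 + \<rho>) \<le> r powr - 2"
    using assms \<rho> by (intro powr_mono') auto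
  also have "r powr - 2 = 1 / r\<^sup>2"
    using r by (simp add: powr_minus powr_numeral divide_inverse)
  finally have "real i powr - (1 + \<rho>) \<le> 1 / r\<^sup>2 * real m powr - (1 + \<rho>)"
    by (simp add: mult_right_mono)
  then show ?thesis
    using CK_pos unfolding K_def by (simp add: mult_left_mono mult.commute divide_inverse mult.assoc)
qed

lemma K_lower: "\<exists>c0>0. \<forall>m\<ge>1. c0 / (real m)\<^sup>2 \<le> K \<rho> m"
proof -
  have "K \<rho> 1 / (real m)\<^sup>2 \<le> K \<rho> m" if "m \<ge> 1" for m
    using K_scale[of "1 / real m" m 1] that by (simp add: field_simps)
  then show ?thesis using K_pos[of 1] by auto
qed

text \<open>The longer of the two gaps is at least half of \<open>b - a\<close>, so
  \<open>K_scale\<close> with \<open>r = 1 / 2\<close> bounds its weight by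
  \<open>4 * K \<rho> (b - a)\<close>. The other factor is either kept or bounded by one.\<close>

lemma K_mult_le:
  assumes "a < x" "x < b"
  shows "K \<rho> (x - a) * K \<rho> (b - x) \<le> 4 * K \<rho> (b - a) * (K \<rho> (x - a) + K \<rho> (b - x))" (is ?A)
    and "K \<rho> (x - a) * K \<rho> (b - x) \<le> 4 * K \<rho> (b - a)" (is ?B)
proof -
  have 4: "K \<rho> i \<le> 4 * K \<rho> (b - a)" if "b - a \<le> 2 * i" for i
  proof -
    have "K \<rho> i \<le> K \<rho> (b - a) / (1 / 2)\<^sup>2"
      using assms that by (intro K_scale) auto
    then show ?thesis by (simp add: power2_eq_square)
  qed
  have *: "?A \<and> ?B" if "K \<rho> i \<le> 4 * K \<rho> (b - a)" "K \<rho> (x - a) * K \<rho> (b - x) = K \<rho> i * K \<rho> j"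
      "K \<rho> j \<le> K \<rho> (x - a) + K \<rho> (b - x)" for i j
  proof
    have "K \<rho> i * K \<rho> j \<le> 4 * K \<rho> (b - a) * K \<rho> j"
      using that(1) by (intro mult_right_mono) auto
    also have "\<dots> \<le> 4 * K \<rho> (b - a) * (K \<rho> (x - a) + K \<rho> (b - x))"
      using that(3) by (intro mult_left_mono) auto
    finally show ?A using that(2) by simp
    have "K \<rho> i * K \<rho> j \<le> K \<rho> i * 1"
      using K_le_1[of j] by (intro mult_left_mono) auto
    then show ?B using that by simp
  qed
  consider "b - a \<le> 2 * (x - a)" | "b - a \<le> 2 * (b - x)" by linarith
  then have "?A \<and> ?B"
  proof cases
    case 1
    then show ?thesis using *[OF 4[OF 1], of "b - x"] by simp
  next
    case 2
    then show ?thesis using *[OF 4[OF 2], of "x - a"] by (simp add: mult.commute)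
  qed
  then show ?A ?B by auto
qed

text \<open>The weight of the stretch from \<open>a\<close> to \<open>b\<close>, read off by moving
  from particle to particle; only the particles strictly between \<open>a\<close> and
  \<open>b\<close> matter. The recursion suits inductions and cuts better than an indexed product
  over a sorted list, with which \<open>w_list\<close> identifies it.\<close>

function w :: "real \<Rightarrow> nat \<Rightarrow> nat \<Rightarrow> nat set \<Rightarrow> real" where
  "w l a b S = (if S \<inter> {a<..<b} = {} then K \<rho> (b - a)
     else l * K \<rho> (Min (S \<inter> {a<..<b}) - a) * w l (Min (S \<inter> {a<..<b})) b S)"
  by auto
termination
proof (relation "Wellfounded.measure (\<lambda>(l, a, b, S). b - a)")
  fix a b :: nat and S
  assume "S \<inter> {a<..<b} \<noteq> {}"
  then have "Min (S \<inter> {a<..<b}) \<in> S \<inter> {a<..<b}" by (intro Min_in) auto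
  then show "((l, Min (S \<inter> {a<..<b}), b, S), (l, a, b, S)) \<in> Wellfounded.measure (\<lambda>(l, a, b, S). b - a)" for l
    by auto
qed simp

declare w.simps [simp del]

lemma w_empty: "S \<inter> {a<..<b} = {} \<Longrightarrow> w l a b S = K \<rho> (b - a)"
  by (subst w.simps) simp

lemma w_first:
  assumes "z \<in> S" "a < z" "z < b" "S \<inter> {a<..<z} = {}"
  shows "w l a b S = l * K \<rho> (z - a) * w l z b S"
proof -
  have "Min (S \<inter> {a<..<b}) = z"
    by (rule Min_eqI) (use assms in \<open>auto simp: disjoint_iff not_less\<close>)
  moreover have "S \<inter> {a<..<b} \<noteq> {}" using assms by auto
  ultimately show ?thesis by (subst w.simps) simp
qed

lemma ex_first:
  fixes S :: "nat set"
  assumes "S \<inter> {a<..<b} \<noteq> {}"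
  obtains z where "z \<in> S" "a < z" "z < b" "S \<inter> {a<..<z} = {}"
proof -
  define z where "z = Min (S \<inter> {a<..<b})"
  have "z \<in> S \<inter> {a<..<b}" unfolding z_def using assms by (intro Min_in) auto
  moreover have "z \<le> y" if "y \<in> S \<inter> {a<..<b}" for y
    unfolding z_def using that by (intro Min_le) auto
  ultimately show ?thesis
    by (intro that[of z]) (auto simp: disjoint_iff not_le, meson less_trans not_le)
qed

text \<open>Induction along the particles: the left end jumps to the next particle of
  \<open>S\<close> while \<open>b\<close> stays fixed, as in the recursion for
  \<open>w\<close>.\<close>

lemma w_induct [case_names empty step]:
  fixes S :: "nat set"
  assumes "\<And>a. S \<inter> {a<..<b} = {} \<Longrightarrow> \<Phi> a"
    and "\<And>a z. z \<in> S \<Longrightarrow> a < z \<Longrightarrow> z < b \<Longrightarrow> S \<inter> {a<..<z} = {} \<Longrightarrow> \<Phi> z \<Longrightarrow> \<Phi> a"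
  shows "\<Phi> a"
proof (induction "b - a" arbitrary: a rule: less_induct)
  case less
  show ?case
  proof (cases "S \<inter> {a<..<b} = {}")
    case False
    then obtain z where z: "z \<in> S" "a < z" "z < b" "S \<inter> {a<..<z} = {}" by (rule ex_first)
    then show ?thesis by (intro assms(2)[OF z] less) auto
  qed (rule assms(1))
qed

lemma w_cong:
  assumes "S \<inter> {a<..<b} = S' \<inter> {a<..<b}"
  shows "w l a b S = w l a b S'"
  using assms
proof (induction a rule: w_induct[where S = S and b = b])
  case (empty a)
  then show ?case by (simp add: w_empty)
next
  case (step a z)
  have "y \<in> S' \<longleftrightarrow> y \<in> S" if "a < y" "y < b" for y
    using step.prems that by (auto simp: set_eq_iff)
  then have "z \<in> S'" "S' \<inter> {a<..<z} = {}" "S \<inter> {z<..<b} = S' \<inter> {z<..<b}"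
    using step(1-4) by auto
  then show ?case
    using step by (simp add: w_first[of z])
qed

lemma w_split:
  assumes "z \<in> S" "a < z" "z < b"
  shows "w l a b S = w l a z S * l * w l z b S"
  using assms(2)
proof (induction a rule: w_induct[where S = S and b = z])
  case (empty a)
  then show ?case using assms by (simp add: w_first[of z] w_empty)
next
  case (step a y)
  then show ?case using assms by (simp add: w_first[of y S a])
qed

lemma w_nonneg: "0 \<le> l \<Longrightarrow> 0 \<le> w l a b S"
  by (induction a rule: w_induct[where S = S and b = b]) (simp_all add: w_empty w_first)

lemma w_pos: "0 < l \<Longrightarrow> a < b \<Longrightarrow> 0 < w l a b S"
  by (induction a rule: w_induct[where S = S and b = b]) (simp_all add: w_empty w_first K_pos)

text \<open>A factor per particle is a change of fugacity. This is how the geometric weights of a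
  path are traded for the larger fugacity \<open>l / q\<close>.\<close>

lemma w_scale:
  assumes q: "0 < q"
  shows "w l a b S = q ^ card (S \<inter> {a<..<b}) * w (l / q) a b S"
proof (induction a rule: w_induct[where S = S and b = b])
  case (step a z)
  have "S \<inter> {a<..<b} = insert z (S \<inter> {z<..<b})"
    using step(1-4) by (auto simp: disjoint_iff)
  then have "card (S \<inter> {a<..<b}) = Suc (card (S \<inter> {z<..<b}))" by simp
  then show ?case using step q by (simp add: w_first)
qed (simp add: w_empty)

lemma w_lower:
  assumes l: "0 < l" "l \<le> 1" and k: "0 \<le> k" "\<And>j. 1 \<le> j \<Longrightarrow> j \<le> b \<Longrightarrow> k \<le> K \<rho> j" and "a < b"
  shows "(l * k) ^ Suc (card (S \<inter> {a<..<b})) \<le> w l a b S"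
  using \<open>a < b\<close>
proof (induction a rule: w_induct[where S = S and b = b])
  case (empty a)
  have "l * k \<le> 1 * K \<rho> (b - a)" using l k empty by (intro mult_mono) auto
  then show ?case using empty by (simp add: w_empty)
next
  case (step a z)
  have "S \<inter> {a<..<b} = insert z (S \<inter> {z<..<b})"
    using step(1-4) by (auto simp: disjoint_iff)
  then have c: "card (S \<inter> {a<..<b}) = Suc (card (S \<inter> {z<..<b}))" by simp
  have "(l * k) ^ Suc (card (S \<inter> {a<..<b})) = (l * k) * (l * k) ^ Suc (card (S \<inter> {z<..<b}))"
    by (simp add: c)
  also have "\<dots> \<le> (l * K \<rho> (z - a)) * w l z b S"
    using l k step by (intro mult_mono) auto
  finally show ?case using step by (simp add: w_first)
qed

text \<open>Spatial Markov property: between two consecutive points of \<open>T\<close> the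
  particles \<open>U\<close> decouple from everything outside. It is stated by cross-multiplication,
  where \<open>K \<rho> (b - a)\<close> is the weight of the empty gap that \<open>U\<close>
  fills.\<close>

lemma w_markov:
  assumes T: "a = 0 \<or> a \<in> T" "b = L \<or> b \<in> T" and ab: "a < b" "b \<le> L"
    and TU: "T \<inter> {a<..<b} = {}" "U \<subseteq> {a<..<b}"
  shows "w l 0 L (T \<union> U) * K \<rho> (b - a) = w l 0 L T * w l a b U"
proof -
  have b: "\<exists>R. \<forall>V \<subseteq> {a<..<b}. w l a L (T \<union> V) = w l a b V * R"
  proof (cases "b = L")
    case True
    have "w l a L (T \<union> V) = w l a b V" if "V \<subseteq> {a<..<b}" for V
      using True TU that by (auto intro!: w_cong)
    then show ?thesis by (auto intro!: exI[of _ 1])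
  next
    case False
    have "w l a L (T \<union> V) = w l a b V * (l * w l b L T)" if "V \<subseteq> {a<..<b}" for V
    proof -
      have "w l a L (T \<union> V) = w l a b (T \<union> V) * l * w l b L (T \<union> V)"
        using False T ab by (intro w_split) auto
      also have "w l a b (T \<union> V) = w l a b V" using TU that by (intro w_cong) auto
      also have "w l b L (T \<union> V) = w l b L T" using that by (intro w_cong) auto
      finally show ?thesis by simp
    qed
    then show ?thesis by blast
  qed
  have "\<exists>R. \<forall>V \<subseteq> {a<..<b}. w l 0 L (T \<union> V) = w l a b V * R"
  proof (cases "a = 0")
    case False
    obtain R where R: "\<And>V. V \<subseteq> {a<..<b} \<Longrightarrow> w l a L (T \<union> V) = w l a b V * R" using b by blast
    have "w l 0 L (T \<union> V) = w l a b V * (w l 0 a T * l * R)" if "V \<subseteq> {a<..<b}" for V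
    proof -
      have "w l 0 L (T \<union> V) = w l 0 a (T \<union> V) * l * w l a L (T \<union> V)"
        using False T ab by (intro w_split) auto
      also have "w l 0 a (T \<union> V) = w l 0 a T" using that by (intro w_cong) auto
      finally show ?thesis by (simp add: R[OF that])
    qed
    then show ?thesis by blast
  qed (use b in simp)
  then obtain R where R: "\<And>V. V \<subseteq> {a<..<b} \<Longrightarrow> w l 0 L (T \<union> V) = w l a b V * R" by blast
  show ?thesis
    using R[OF TU(2)] R[of "{}"] by (simp add: w_empty)
qed

section \<open>Partition functions and the renewal equation\<close>

definition part_fun :: "real \<Rightarrow> nat \<Rightarrow> nat \<Rightarrow> real" where
  "part_fun l a b = (\<Sum>S\<in>Pow {a<..<b}. w l a b S)"

lemma part_fun_nonneg: "0 \<le> l \<Longrightarrow> 0 \<le> part_fun l a b"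
  by (simp add: part_fun_def sum_nonneg w_nonneg)

lemma part_fun_rec: "part_fun l a b = K \<rho> (b - a) + (\<Sum>z\<in>{a<..<b}. l * K \<rho> (z - a) * part_fun l z b)"
proof -
  let ?F = "\<lambda>z. (\<lambda>U. insert z U) ` Pow {z<..<b}"
  have eq: "Pow {a<..<b} = {{}} \<union> (\<Union>z\<in>{a<..<b}. ?F z)" (is "?L = ?R")
  proof
    show "?L \<subseteq> ?R"
    proof
      fix S assume S: "S \<in> ?L"
      show "S \<in> ?R"
      proof (cases "S = {}")
        case False
        then have "S \<inter> {a<..<b} \<noteq> {}" using S by auto
        then obtain z where z: "z \<in> S" "a < z" "z < b" "S \<inter> {a<..<z} = {}" by (rule ex_first)
        have "y \<in> {z<..<b}" if "y \<in> S - {z}" for y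
          using that S z by (auto simp: disjoint_iff) (metis greaterThanLessThan_iff linorder_neqE_nat subsetD)
        then have "S = insert z (S - {z})" "S - {z} \<in> Pow {z<..<b}" using z by auto
        then have "S \<in> ?F z" by (rule image_eqI)
        then show ?thesis using z by (intro UnI2 UN_I[of z]) auto
      qed simp
    qed
  qed auto
  have "part_fun l a b = w l a b {} + sum (w l a b) (\<Union>z\<in>{a<..<b}. ?F z)"
    unfolding part_fun_def eq by (subst sum.union_disjoint) auto
  also have "sum (w l a b) (\<Union>z\<in>{a<..<b}. ?F z) = (\<Sum>z\<in>{a<..<b}. sum (w l a b) (?F z))"
  proof (rule sum.UNION_disjoint)
    have "z \<le> z'" if "insert z U = insert z' U'" "U' \<subseteq> {z'<..<b}" "U \<subseteq> {z<..<b}" for z z' :: nat and U U'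
    proof -
      have "z' \<in> insert z U" using that by auto
      then show ?thesis using that(3) by auto
    qed
    then have "z = z'" if "insert z U = insert z' U'" "U' \<subseteq> {z'<..<b}" "U \<subseteq> {z<..<b}" for z z' U U'
      using that by (metis antisym)
    then show "\<forall>i\<in>{a<..<b}. \<forall>j\<in>{a<..<b}. i \<noteq> j \<longrightarrow> ?F i \<inter> ?F j = {}"
      by (auto simp: disjoint_iff)
  qed auto
  also have "\<dots> = (\<Sum>z\<in>{a<..<b}. l * K \<rho> (z - a) * part_fun l z b)"
  proof (rule sum.cong[OF refl])
    fix z assume z: "z \<in> {a<..<b}"
    have "inj_on (insert z) (Pow {z<..<b})"
      by (intro inj_onI) (metis Diff_insert_absorb PowD greaterThanLessThan_iff less_irrefl subsetD)
    then have "sum (w l a b) (?F z) = (\<Sum>U\<in>Pow {z<..<b}. w l a b (insert z U))"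
      by (simp add: sum.reindex)
    also have "\<dots> = (\<Sum>U\<in>Pow {z<..<b}. l * K \<rho> (z - a) * w l z b U)"
    proof (rule sum.cong[OF refl])
      fix U assume U: "U \<in> Pow {z<..<b}"
      have "w l a b (insert z U) = l * K \<rho> (z - a) * w l z b (insert z U)"
        using U z by (intro w_first) auto
      also have "w l z b (insert z U) = w l z b U" by (rule w_cong) auto
      finally show "w l a b (insert z U) = l * K \<rho> (z - a) * w l z b U" .
    qed
    finally show "sum (w l a b) (?F z) = l * K \<rho> (z - a) * part_fun l z b"
      by (simp add: part_fun_def sum_distrib_left)
  qed
  finally show ?thesis by (simp add: w_empty)
qed

text \<open>Summing the renewal equation over the left end, the jumps into a fixed \<open>y\<close>
  have total mass at most one. Hence the sum \<open>?s\<close> satisfies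
  \<open>?s <= 1 + l * ?s\<close>.\<close>

lemma part_fun_sum_le:
  assumes l: "0 < l" "l < 1"
  shows "(\<Sum>z\<in>{a..<b}. part_fun l z b) \<le> 1 / (1 - l)"
proof -
  let ?s = "\<Sum>z\<in>{a..<b}. part_fun l z b"
  have "(\<Sum>z\<in>{a..<b}. \<Sum>y\<in>{z<..<b}. l * K \<rho> (y - z) * part_fun l y b)
      = (\<Sum>z\<in>{a..<b}. \<Sum>y\<in>{a..<b}. if z < y then l * K \<rho> (y - z) * part_fun l y b else 0)"
    by (intro sum.cong refl sum.mono_neutral_cong_left) auto
  also have "\<dots> = (\<Sum>y\<in>{a..<b}. \<Sum>z\<in>{a..<b}. if z < y then l * K \<rho> (y - z) * part_fun l y b else 0)"
    by (rule sum.swap)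
  also have "\<dots> = (\<Sum>y\<in>{a..<b}. (\<Sum>z\<in>{a..<y}. K \<rho> (y - z)) * (l * part_fun l y b))"
    unfolding sum_distrib_right by (intro sum.cong refl sum.mono_neutral_cong_right) auto
  also have "\<dots> \<le> (\<Sum>y\<in>{a..<b}. 1 * (l * part_fun l y b))"
    using l by (intro sum_mono mult_right_mono K_sum_le) (auto simp: inj_on_def part_fun_nonneg)
  finally have "(\<Sum>z\<in>{a..<b}. \<Sum>y\<in>{z<..<b}. l * K \<rho> (y - z) * part_fun l y b) \<le> l * ?s"
    by (simp add: sum_distrib_left)
  moreover have "(\<Sum>z\<in>{a..<b}. K \<rho> (b - z)) \<le> 1"
    by (intro K_sum_le) (auto simp: inj_on_def)
  ultimately have "?s \<le> 1 + l * ?s"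
    by (subst part_fun_rec) (simp add: sum.distrib)
  then show ?thesis using l by (simp add: field_simps)
qed

text \<open>
  In the renewal equation either the first jump or the remaining stretch covers a fixed fraction
  of the interval. For \<open>l < 1\<close> the fraction can be chosen so that the second case is contracting.
\<close>

lemma part_fun_le:
  assumes l: "0 < l" "l < 1"
  shows "\<exists>C\<ge>1. \<forall>a b. a < b \<longrightarrow> part_fun l a b \<le> C * K \<rho> (b - a)"
proof -
  \<comment> \<open>The fourth root of \<open>l\<close> makes \<open>l / r^2 = sqrt l < 1\<close>;
    this is the contraction factor left after \<open>K_scale\<close> has charged
    \<open>1 / r^2\<close>.\<close>
  define r where "r = sqrt (sqrt l)"
  have r: "0 < r" "r < 1" using l by (simp_all add: r_def)
  have r2: "l / r\<^sup>2 = sqrt l" using l by (simp add: r_def real_div_sqrt)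
  define D where "D = 1 / ((1 - r)\<^sup>2 * (1 - l))"
  have D: "0 \<le> D" using l r by (simp add: D_def)
  \<comment> \<open>The solution of \<open>1 + D + sqrt l * C = C\<close>, the equation that closes
    the induction.\<close>
  define C where "C = (1 + D) / (1 - sqrt l)"
  have sl: "0 < sqrt l" "sqrt l < 1" using l by auto
  have C1: "1 \<le> C" using D sl by (simp add: C_def field_simps)
  have "part_fun l a b \<le> C * K \<rho> (b - a)" if "a < b" for a b
    using that
  proof (induction "b - a" arbitrary: a rule: less_induct)
    case less
    let ?k = "K \<rho> (b - a)"
    have jump: "l * K \<rho> (z - a) * part_fun l z b \<le> sqrt l * C * ?k * K \<rho> (z - a) + ?k / (1 - r)\<^sup>2 * part_fun l z b"
      if z: "z \<in> {a<..<b}" for z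
    proof (cases "r * real (b - a) \<le> real (b - z)")
      case True
      have "part_fun l z b \<le> C * K \<rho> (b - z)" using less(1)[of z] z by auto
      also have "\<dots> \<le> C * (?k / r\<^sup>2)"
        using C1 r True z by (intro mult_left_mono K_scale) auto
      finally have "l * K \<rho> (z - a) * part_fun l z b \<le> l * K \<rho> (z - a) * (C * (?k / r\<^sup>2))"
        using l by (intro mult_left_mono) auto
      also have "\<dots> = (l / r\<^sup>2) * C * ?k * K \<rho> (z - a)" by simp
      also have "\<dots> = sqrt l * C * ?k * K \<rho> (z - a)" by (simp only: r2)
      finally show ?thesis using part_fun_nonneg[of l z b] l
        by (smt (verit) K_nonneg divide_nonneg_nonneg mult_nonneg_nonneg zero_le_power2)
    next
      \<comment> \<open>The first jump is long, so its weight is comparable to \<open>?k\<close>.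
        The induction hypothesis stays aside here: the remaining partition functions are summed over
        \<open>z\<close> and controlled by \<open>part_fun_sum_le\<close>.\<close>
      case False
      have "real (b - a) = real (b - z) + real (z - a)" using z by auto
      then have "(1 - r) * real (b - a) \<le> real (z - a)"
        using False unfolding left_diff_distrib mult_1 by linarith
      then have "K \<rho> (z - a) \<le> ?k / (1 - r)\<^sup>2"
        using r less.prems by (intro K_scale) auto
      then have "l * K \<rho> (z - a) * part_fun l z b \<le> 1 * (?k / (1 - r)\<^sup>2) * part_fun l z b"
        using l by (intro mult_right_mono mult_mono part_fun_nonneg) auto
      then show ?thesis using sl C1 by (simp add: add_increasing)
    qed
    have "part_fun l a b \<le> ?k + (\<Sum>z\<in>{a<..<b}. sqrt l * C * ?k * K \<rho> (z - a) + ?k / (1 - r)\<^sup>2 * part_fun l z b)"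
      by (subst part_fun_rec) (intro add_left_mono sum_mono jump)
    also have "\<dots> = ?k + sqrt l * C * ?k * (\<Sum>z\<in>{a<..<b}. K \<rho> (z - a))
        + ?k / (1 - r)\<^sup>2 * (\<Sum>z\<in>{a<..<b}. part_fun l z b)"
      by (simp add: sum.distrib sum_distrib_left)
    also have "\<dots> \<le> ?k + sqrt l * C * ?k * 1 + ?k / (1 - r)\<^sup>2 * (1 / (1 - l))"
    proof (intro add_mono mult_left_mono order_refl)
      show "(\<Sum>z\<in>{a<..<b}. K \<rho> (z - a)) \<le> 1"
        by (intro K_sum_le) (auto simp: inj_on_def)
      show "(\<Sum>z\<in>{a<..<b}. part_fun l z b) \<le> 1 / (1 - l)"
        using part_fun_sum_le[OF l, where a = "Suc a" and b = b]
        by (simp only: atLeastSucLessThan_greaterThanLessThan)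
    qed (use sl C1 in auto)
    also have "\<dots> = (1 + D + sqrt l * C) * ?k"
      by (simp add: D_def algebra_simps)
    also have "1 + D + sqrt l * C = C"
      using sl by (simp add: C_def field_simps)
    finally show ?case .
  qed
  then show ?thesis using C1 by blast
qed

section \<open>Canonical paths and blocks\<close>

lemma ex_left:
  fixes T :: "nat set"
  assumes "0 < x"
  obtains a where "a < x" "a = 0 \<or> a \<in> T" "T \<inter> {a<..<x} = {}"
proof -
  define a where "a = Max (insert 0 (T \<inter> {..<x}))"
  have "a \<in> insert 0 (T \<inter> {..<x})" unfolding a_def by (intro Max_in) auto
  moreover have "y \<le> a" if "y \<in> T" "y < x" for y
    unfolding a_def using that by (intro Max_ge) auto
  ultimately show ?thesis using assms by (intro that[of a]) (auto simp: disjoint_iff not_less)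
qed

lemma ex_right:
  fixes T :: "nat set"
  assumes "x < L"
  obtains b where "x < b" "b \<le> L" "b = L \<or> b \<in> T" "T \<inter> {x<..<b} = {}"
proof (cases "T \<inter> {x<..<L} = {}")
  case True
  then show ?thesis using assms by (intro that[of L]) auto
next
  case False
  then obtain z where "z \<in> T" "x < z" "z < L" "T \<inter> {x<..<z} = {}" by (rule ex_first)
  then show ?thesis by (intro that[of z]) auto
qed

text \<open>Deleting \<open>x\<close> merges its two adjacent gaps, and \<open>K_mult_le\<close>
  compares their product with the merged gap. The factor four is why the heat bath leaves a site
  empty with probability at least \<open>1 / 5\<close>.\<close>

lemma w_remove:
  assumes l: "0 < l" "l \<le> 1" and x: "0 < x" "x < L" "x \<in> S"
  shows "w l 0 L S \<le> 4 * w l 0 L (S - {x})"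
proof -
  define T where "T = S - {x}"
  obtain a where a: "a < x" "a = 0 \<or> a \<in> T" "T \<inter> {a<..<x} = {}" by (rule ex_left[OF x(1)])
  obtain b where b: "x < b" "b \<le> L" "b = L \<or> b \<in> T" "T \<inter> {x<..<b} = {}" by (rule ex_right[OF x(2)])
  have ab: "T \<inter> {a<..<b} = {}"
  proof -
    have "{a<..<b} = {a<..<x} \<union> {x} \<union> {x<..<b}" using a b by auto
    then show ?thesis using a b by (auto simp: T_def)
  qed
  have "w l 0 L (T \<union> {x}) * K \<rho> (b - a) = w l 0 L T * w l a b {x}"
    by (rule w_markov) (use a b ab in auto)
  also have "w l a b {x} = l * (K \<rho> (x - a) * K \<rho> (b - x))"
    using a b by (subst w_first[of x]) (auto simp: w_empty)
  also have "w l 0 L T * (l * (K \<rho> (x - a) * K \<rho> (b - x))) \<le> w l 0 L T * (1 * (4 * K \<rho> (b - a)))"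
    using l a b by (intro mult_left_mono mult_mono K_mult_le w_nonneg) auto
  finally have "w l 0 L (T \<union> {x}) * K \<rho> (b - a) \<le> (4 * w l 0 L T) * K \<rho> (b - a)"
    by (simp add: mult_ac)
  then have "w l 0 L (T \<union> {x}) \<le> 4 * w l 0 L T"
    by (rule mult_right_le_imp_le) (use a b in \<open>simp add: K_pos\<close>)
  also have "T \<union> {x} = S" using x by (auto simp: T_def)
  finally show ?thesis by (simp add: T_def)
qed

text \<open>An interval of interior sites, possibly empty. In this form windows cut off by the ends
  of the box need no case distinction.\<close>

definition convex_in :: "nat \<Rightarrow> nat set \<Rightarrow> bool" where
  "convex_in L B \<longleftrightarrow> B \<subseteq> {0<..<L} \<and> (\<forall>x\<in>B. \<forall>y\<in>B. {x..y} \<subseteq> B)"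

lemma convex_inD:
  assumes "convex_in L B" "x \<in> B" "y \<in> B" "x \<le> z" "z \<le> y"
  shows "z \<in> B"
proof -
  have "z \<in> {x..y}" using assms by simp
  then show ?thesis using assms(1-3) unfolding convex_in_def by blast
qed

text \<open>With \<open>a\<close> the nearest point of \<open>T\<close> (or \<open>0\<close>) to the
  left of \<open>x\<close>, convexity of \<open>B\<close> forces all of \<open>U\<close> into the
  single gap from \<open>a\<close> to \<open>x\<close>, so \<open>w_markov\<close> applies. The
  factors \<open>1 / q ^ card U\<close> become the fugacity \<open>l / q\<close>, and
  \<open>C\<close> compares the resulting partition function with the gap.\<close>

lemma congestion:
  assumes l: "0 < l" and q: "0 < q" and C: "\<And>a b. a < b \<Longrightarrow> part_fun (l / q) a b \<le> C * K \<rho> (b - a)"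
    and B: "convex_in L B" and x: "x \<in> T" "x \<in> B" and T: "T \<inter> (B \<inter> {..<x}) = {}"
  shows "(\<Sum>U\<in>Pow (B \<inter> {..<x}). w l 0 L (T \<union> U) / q ^ card U) \<le> C * w l 0 L T"
proof -
  have x0: "0 < x" "x < L" using x B by (auto simp: convex_in_def)
  obtain a where a: "a < x" "a = 0 \<or> a \<in> T" "T \<inter> {a<..<x} = {}" by (rule ex_left[OF x0(1)])
  have sub: "B \<inter> {..<x} \<subseteq> {a<..<x}"
  proof
    fix y assume y: "y \<in> B \<inter> {..<x}"
    have "\<not> y \<le> a"
    proof
      assume "y \<le> a"
      then have "a \<in> B" using y x a convex_inD[OF B, of y x a] by auto
      moreover have "a \<noteq> 0" using \<open>y \<le> a\<close> y B by (auto simp: convex_in_def)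
      ultimately show False using a T by auto
    qed
    then show "y \<in> {a<..<x}" using y by auto
  qed
  have "w l 0 L (T \<union> U) / q ^ card U * K \<rho> (x - a) = w l 0 L T * w (l / q) a x U"
    if U: "U \<in> Pow (B \<inter> {..<x})" for U
  proof -
    have Ua: "U \<subseteq> {a<..<x}" using U sub by auto
    have "w l 0 L (T \<union> U) * K \<rho> (x - a) = w l 0 L T * w l a x U"
      by (rule w_markov) (use a Ua x x0 in auto)
    also have "w l a x U = q ^ card U * w (l / q) a x U"
      using w_scale[OF q, of l a x U] Ua by (simp add: Int_absorb2)
    finally show ?thesis using q by (simp add: field_simps)
  qed
  then have "(\<Sum>U\<in>Pow (B \<inter> {..<x}). w l 0 L (T \<union> U) / q ^ card U) * K \<rho> (x - a)
      = w l 0 L T * (\<Sum>U\<in>Pow (B \<inter> {..<x}). w (l / q) a x U)"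
    unfolding sum_distrib_right sum_distrib_left by (intro sum.cong refl)
  also have "\<dots> \<le> w l 0 L T * part_fun (l / q) a x"
    unfolding part_fun_def using sub l q
    by (intro mult_left_mono sum_mono2) (auto intro!: w_nonneg)
  also have "\<dots> \<le> w l 0 L T * (C * K \<rho> (x - a))"
    using l a by (intro mult_left_mono C w_nonneg) auto
  also have "\<dots> = C * w l 0 L T * K \<rho> (x - a)" by simp
  finally show ?thesis
    by (rule mult_right_le_imp_le) (use a in \<open>simp add: K_pos\<close>)
qed

text \<open>The deficit is a perfect square. Iterated along a path, it charges
  \<open>1 / ((1 - q) * q ^ k)\<close> to the edge preceded by \<open>k\<close> others, whatever the
  length of the path.\<close>

lemma square_split:
  fixes a b q :: real
  assumes "0 < q" "q < 1"
  shows "(a + b)\<^sup>2 \<le> a\<^sup>2 / (1 - q) + b\<^sup>2 / q"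
proof -
  have "a\<^sup>2 / (1 - q) + b\<^sup>2 / q - (a + b)\<^sup>2 = (q * a - (1 - q) * b)\<^sup>2 / (q * (1 - q))"
    using assms by (simp add: field_simps power2_eq_square)
  also have "\<dots> \<ge> 0" using assms by simp
  finally show ?thesis by simp
qed

text \<open>The leftmost particle \<open>z\<close> of the block is removed by the first edge. For
  the later edges \<open>z\<close> adds one particle to the left, which accounts for the extra
  division by \<open>q\<close> in \<open>square_split\<close>.\<close>

lemma path_pointwise:
  fixes F :: "nat set \<Rightarrow> real"
  assumes q: "0 < q" "q < 1" and B: "finite B"
  shows "(F S - F (S - B))\<^sup>2 \<le> (\<Sum>x\<in>S \<inter> B. (F (S - (B \<inter> {..<x})) - F (S - (B \<inter> {..<x}) - {x}))\<^sup>2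
           / q ^ card (S \<inter> (B \<inter> {..<x}))) / (1 - q)"
proof (induction "card (S \<inter> B)" arbitrary: S)
  case 0
  then have "S \<inter> B = {}" using B by auto
  then have "S - B = S" by auto
  then show ?case using \<open>S \<inter> B = {}\<close> by simp
next
  case (Suc n)
  have ne: "S \<inter> B \<noteq> {}" and fB: "finite (S \<inter> B)" using Suc(2) B by auto
  define z where "z = Min (S \<inter> B)"
  have z: "z \<in> S" "z \<in> B" using Min_in[OF fB ne] by (auto simp: z_def)
  have zmin: "z \<le> y" if "y \<in> S" "y \<in> B" for y using that fB by (simp add: z_def)
  define S' where "S' = S - {z}"
  define d where "d S x = (F (S - (B \<inter> {..<x})) - F (S - (B \<inter> {..<x}) - {x}))\<^sup>2 / q ^ card (S \<inter> (B \<inter> {..<x}))" for S x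
  have S'B: "S' \<inter> B = S \<inter> B - {z}" by (auto simp: S'_def)
  have c: "n = card (S' \<inter> B)" using Suc(2) z fB by (simp add: S'B)
  have "S' - B = S - B" using z by (auto simp: S'_def)
  then have IH: "(F S' - F (S - B))\<^sup>2 \<le> (\<Sum>x\<in>S' \<inter> B. d S' x) / (1 - q)"
    using Suc(1)[OF c] by (simp add: d_def)
  have dz: "d S z = (F S - F S')\<^sup>2"
  proof -
    have e: "S \<inter> (B \<inter> {..<z}) = {}" using zmin by fastforce
    then have "S - (B \<inter> {..<z}) = S" by auto
    then show ?thesis using e by (simp add: d_def S'_def)
  qed
  have d': "d S' x / q = d S x" if x: "x \<in> S' \<inter> B" for x
  proof -
    have zx: "z < x" using x zmin[of x] by (auto simp: S'_def)
    have "S \<inter> (B \<inter> {..<x}) = insert z (S' \<inter> (B \<inter> {..<x}))" using zx z by (auto simp: S'_def)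
    then have "card (S \<inter> (B \<inter> {..<x})) = Suc (card (S' \<inter> (B \<inter> {..<x})))"
      using B by (simp add: S'_def)
    moreover have "S' - (B \<inter> {..<x}) = S - (B \<inter> {..<x})" using zx z by (auto simp: S'_def)
    ultimately show ?thesis by (simp add: d_def)
  qed
  have "(F S - F (S - B))\<^sup>2 = ((F S - F S') + (F S' - F (S - B)))\<^sup>2" by simp
  also have "\<dots> \<le> (F S - F S')\<^sup>2 / (1 - q) + (F S' - F (S - B))\<^sup>2 / q"
    by (rule square_split[OF q])
  also have "\<dots> \<le> d S z / (1 - q) + (\<Sum>x\<in>S' \<inter> B. d S' x) / (1 - q) / q"
    unfolding dz using IH q by (intro add_left_mono divide_right_mono) auto
  also have "(\<Sum>x\<in>S' \<inter> B. d S' x) / (1 - q) / q = (\<Sum>x\<in>S' \<inter> B. d S' x / q) / (1 - q)"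
    by (simp add: mult.commute flip: sum_divide_distrib)
  also have "(\<Sum>x\<in>S' \<inter> B. d S' x / q) = (\<Sum>x\<in>S' \<inter> B. d S x)"
    by (intro sum.cong refl d')
  also have "d S z / (1 - q) + (\<Sum>x\<in>S' \<inter> B. d S x) / (1 - q) = (\<Sum>x\<in>S \<inter> B. d S x) / (1 - q)"
    using z fB by (simp add: S'B sum.remove[of "S \<inter> B" z] add_divide_distrib)
  finally show ?case by (simp add: d_def)
qed

text \<open>The unnormalised Dirichlet form in which each particle of \<open>B\<close> is removed at
  rate one; \<open>E_ge\<close> compares it with the heat-bath form.\<close>

definition removal_form :: "real \<Rightarrow> nat \<Rightarrow> nat set \<Rightarrow> (nat set \<Rightarrow> real) \<Rightarrow> real" where
  "removal_form l L B F = (\<Sum>x\<in>B. \<Sum>S\<in>Pow {0<..<L}. if x \<in> S then w l 0 L S * (F S - F (S - {x}))\<^sup>2 else 0)"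

text \<open>
  Removing the particles of a block from left to right gives a canonical path. A configuration
  that uses a given edge of these paths is determined by its particles to the left of the
  removed one; their total weight is a partition function, hence comparable to one long gap.
  The geometric weights leave room for the length of the path, as \<open>l / q < 1\<close>.
\<close>

lemma path_le:
  assumes l: "0 < l" and q: "0 < q" "q < 1"
    and C: "\<And>a b. a < b \<Longrightarrow> part_fun (l / q) a b \<le> C * K \<rho> (b - a)" and B: "convex_in L B"
  shows "(\<Sum>S\<in>Pow {0<..<L}. w l 0 L S * (F S - F (S - B))\<^sup>2) \<le> C / (1 - q) * removal_form l L B F"
proof -
  let ?I = "{0<..<L}"
  have fB: "finite B" and BI: "B \<subseteq> ?I" using B finite_subset by (auto simp: convex_in_def)
  define V where "V x = B \<inter> {..<x}" for x
  define d where "d S x = (F S - F (S - {x}))\<^sup>2" for S x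
  have "w l 0 L S * (F S - F (S - B))\<^sup>2
      \<le> (\<Sum>x\<in>B. if x \<in> S then w l 0 L S * d (S - V x) x / q ^ card (S \<inter> V x) else 0) / (1 - q)" for S
  proof -
    have "w l 0 L S * (F S - F (S - B))\<^sup>2 \<le> w l 0 L S * ((\<Sum>x\<in>S \<inter> B. d (S - V x) x / q ^ card (S \<inter> V x)) / (1 - q))"
      using path_pointwise[OF q fB, of F S] l
      by (intro mult_left_mono w_nonneg) (auto simp: d_def V_def)
    also have "\<dots> = (\<Sum>x\<in>S \<inter> B. w l 0 L S * d (S - V x) x / q ^ card (S \<inter> V x)) / (1 - q)"
      by (simp add: sum_distrib_left)
    also have "(\<Sum>x\<in>S \<inter> B. w l 0 L S * d (S - V x) x / q ^ card (S \<inter> V x))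
       = (\<Sum>x\<in>B. if x \<in> S then w l 0 L S * d (S - V x) x / q ^ card (S \<inter> V x) else 0)"
      using fB by (intro sum.mono_neutral_cong_left) auto
    finally show ?thesis .
  qed
  then have "(\<Sum>S\<in>Pow ?I. w l 0 L S * (F S - F (S - B))\<^sup>2)
    \<le> (\<Sum>S\<in>Pow ?I. (\<Sum>x\<in>B. if x \<in> S then w l 0 L S * d (S - V x) x / q ^ card (S \<inter> V x) else 0) / (1 - q))"
    by (intro sum_mono)
  also have "\<dots> = (\<Sum>x\<in>B. \<Sum>S\<in>Pow ?I. if x \<in> S then w l 0 L S * d (S - V x) x / q ^ card (S \<inter> V x) else 0) / (1 - q)"
    by (subst sum.swap) (simp add: sum_divide_distrib)
  also have "\<dots> \<le> (\<Sum>x\<in>B. C * (\<Sum>S\<in>Pow ?I. if x \<in> S then w l 0 L S * d S x else 0)) / (1 - q)"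
  proof (intro divide_right_mono sum_mono)
    fix x assume x: "x \<in> B"
    have VI: "V x \<subseteq> ?I" using BI by (auto simp: V_def)
    have "(\<Sum>S\<in>Pow ?I. if x \<in> S then w l 0 L S * d (S - V x) x / q ^ card (S \<inter> V x) else 0)
      = (\<Sum>T\<in>Pow (?I - V x). \<Sum>U\<in>Pow (V x). if x \<in> T \<union> U then
           w l 0 L (T \<union> U) * d (T \<union> U - V x) x / q ^ card ((T \<union> U) \<inter> V x) else 0)"
      by (rule sum_Pow_split[OF VI])
    also have "\<dots> \<le> (\<Sum>T\<in>Pow (?I - V x). C * (if x \<in> T then w l 0 L T * d T x else 0))"
    proof (rule sum_mono)
      fix T assume T: "T \<in> Pow (?I - V x)"
      have "(\<Sum>U\<in>Pow (V x). if x \<in> T \<union> U then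
           w l 0 L (T \<union> U) * d (T \<union> U - V x) x / q ^ card ((T \<union> U) \<inter> V x) else 0)
         = (\<Sum>U\<in>Pow (V x). if x \<in> T then w l 0 L (T \<union> U) / q ^ card U * d T x else 0)"
      proof (rule sum.cong[OF refl])
        fix U assume U: "U \<in> Pow (V x)"
        have "T \<union> U - V x = T" "(T \<union> U) \<inter> V x = U" "x \<notin> U" using T U by (auto simp: V_def)
        then show "(if x \<in> T \<union> U then w l 0 L (T \<union> U) * d (T \<union> U - V x) x / q ^ card ((T \<union> U) \<inter> V x) else 0)
          = (if x \<in> T then w l 0 L (T \<union> U) / q ^ card U * d T x else 0)" by simp
      qed
      also have "\<dots> = (if x \<in> T then (\<Sum>U\<in>Pow (V x). w l 0 L (T \<union> U) / q ^ card U) * d T x else 0)"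
        by (simp add: sum_distrib_right)
      also have "\<dots> \<le> C * (if x \<in> T then w l 0 L T * d T x else 0)"
      proof (cases "x \<in> T")
        case True
        have "(\<Sum>U\<in>Pow (V x). w l 0 L (T \<union> U) / q ^ card U) \<le> C * w l 0 L T"
          unfolding V_def by (rule congestion[OF l q(1) C B True x]) (use T in \<open>auto simp: V_def\<close>)
        then have "(\<Sum>U\<in>Pow (V x). w l 0 L (T \<union> U) / q ^ card U) * d T x \<le> C * w l 0 L T * d T x"
          by (rule mult_right_mono) (simp add: d_def)
        then show ?thesis using True by simp
      qed simp
      finally show "(\<Sum>U\<in>Pow (V x). if x \<in> T \<union> U then
           w l 0 L (T \<union> U) * d (T \<union> U - V x) x / q ^ card ((T \<union> U) \<inter> V x) else 0)
         \<le> C * (if x \<in> T then w l 0 L T * d T x else 0)" .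
    qed
    also have "\<dots> \<le> (\<Sum>T\<in>Pow ?I. C * (if x \<in> T then w l 0 L T * d T x else 0))"
    proof (rule sum_mono2)
      \<comment> \<open>The sign of \<open>C\<close> is read off from its defining inequality on an
        interval of length one; enlarging the index set needs it.\<close>
      have "0 \<le> part_fun (l / q) 0 1" using l q by (intro part_fun_nonneg) auto
      also have "\<dots> \<le> C * K \<rho> (1 - 0)" by (rule C) simp
      finally have "0 \<le> C" using K_pos[of 1] by (simp add: zero_le_mult_iff)
      then show "0 \<le> C * (if x \<in> T then w l 0 L T * d T x else 0)" for T
        using l by (auto simp: d_def w_nonneg)
    qed auto
    finally show "(\<Sum>S\<in>Pow ?I. if x \<in> S then w l 0 L S * d (S - V x) x / q ^ card (S \<inter> V x) else 0)
      \<le> C * (\<Sum>S\<in>Pow ?I. if x \<in> S then w l 0 L S * d S x else 0)"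
      by (simp add: sum_distrib_left)
  qed (use q in auto)
  also have "\<dots> = C / (1 - q) * removal_form l L B F"
    unfolding removal_form_def d_def[symmetric] by (simp flip: sum_distrib_left)
  finally show ?thesis .
qed

text \<open>The choice \<open>q = sqrt l\<close> makes both \<open>q\<close> and
  \<open>l / q\<close> equal to \<open>sqrt l\<close>, hence less than one.\<close>

lemma path_const:
  assumes l: "0 < l" "l < 1"
  shows "\<exists>C>0. \<forall>L B F. convex_in L B \<longrightarrow>
     (\<Sum>S\<in>Pow {0<..<L}. w l 0 L S * (F S - F (S - B))\<^sup>2) \<le> C * removal_form l L B F"
proof -
  define q where "q = sqrt l"
  have q: "0 < q" "q < 1" "l / q = q" using l by (auto simp: q_def real_div_sqrt)
  obtain C where C: "C \<ge> 1" "\<And>a b. a < b \<Longrightarrow> part_fun q a b \<le> C * K \<rho> (b - a)"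
    using part_fun_le[OF q(1,2)] by blast
  show ?thesis
    using path_le[OF l(1) q(1,2), unfolded q(3), OF C(2)] C(1) q
    by (intro exI[of _ "C / (1 - q)"]) auto
qed

section \<open>Blocks: removal against regrowth\<close>

lemma part_fun_through:
  assumes "a < x" "x < b"
  shows "(\<Sum>U\<in>Pow {a<..<b}. if x \<in> U then w l a b U else 0) = part_fun l a x * l * part_fun l x b"
proof -
  have "(\<Sum>U\<in>Pow {a<..<b}. if x \<in> U then w l a b U else 0) = (\<Sum>T\<in>Pow ({a<..<b} - {x}). w l a b (insert x T))"
    using assms by (intro sum_Pow_member) auto
  also have "\<dots> = (\<Sum>T\<in>Pow ({a<..<b} - {x} - {x<..<b}). \<Sum>U\<in>Pow {x<..<b}. w l a b (insert x (T \<union> U)))"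
    using assms by (intro sum_Pow_split) auto
  also have "{a<..<b} - {x} - {x<..<b} = {a<..<x}" using assms by auto
  also have "(\<Sum>T\<in>Pow {a<..<x}. \<Sum>U\<in>Pow {x<..<b}. w l a b (insert x (T \<union> U)))
    = (\<Sum>T\<in>Pow {a<..<x}. \<Sum>U\<in>Pow {x<..<b}. w l a x T * l * w l x b U)"
  proof (intro sum.cong refl)
    fix T U assume TU: "T \<in> Pow {a<..<x}" "U \<in> Pow {x<..<b}"
    have "w l a b (insert x (T \<union> U)) = w l a x (insert x (T \<union> U)) * l * w l x b (insert x (T \<union> U))"
      using assms by (intro w_split) auto
    also have "w l a x (insert x (T \<union> U)) = w l a x T" using TU by (intro w_cong) auto
    also have "w l x b (insert x (T \<union> U)) = w l x b U" using TU by (intro w_cong) auto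
    finally show "w l a b (insert x (T \<union> U)) = w l a x T * l * w l x b U" .
  qed
  also have "\<dots> = part_fun l a x * l * part_fun l x b"
    unfolding part_fun_def sum_distrib_right sum_distrib_left by (rule sum.swap)
  finally show ?thesis .
qed

text \<open>An unnormalised occupation probability. A particle at \<open>x\<close> cuts the
  partition function in two; each part is compared with one gap, and \<open>K_mult_le\<close>
  recombines the gaps while keeping the decay in the distances from \<open>x\<close> to the
  ends.\<close>

lemma part_fun_through_le:
  assumes l: "0 < l" "l < 1" and C: "1 \<le> C" "\<And>a b. a < b \<Longrightarrow> part_fun l a b \<le> C * K \<rho> (b - a)"
    and x: "a < x" "x < b"
  shows "(\<Sum>U\<in>Pow {a<..<b}. if x \<in> U then w l a b U else 0)
      \<le> 4 * C\<^sup>2 * K \<rho> (b - a) * (K \<rho> (x - a) + K \<rho> (b - x))"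
proof -
  have "part_fun l a x * l * part_fun l x b \<le> (C * K \<rho> (x - a)) * 1 * (C * K \<rho> (b - x))"
    using l C(1) x by (intro mult_mono C(2) mult_nonneg_nonneg part_fun_nonneg) auto
  also have "\<dots> = C\<^sup>2 * (K \<rho> (x - a) * K \<rho> (b - x))" by (simp add: power2_eq_square)
  also have "\<dots> \<le> C\<^sup>2 * (4 * K \<rho> (b - a) * (K \<rho> (x - a) + K \<rho> (b - x)))"
    using x by (intro mult_left_mono K_mult_le) auto
  finally show ?thesis by (simp add: part_fun_through[OF x] mult_ac)
qed

text \<open>Distances below \<open>J\<close> contribute at most \<open>J\<close> in total, and the
  mass beyond \<open>J\<close> is small, so the truncated mean is sublinear in the truncation level.
  The full mean is infinite for \<open>\<rho> < 1\<close>; sublinearity is what remains.\<close>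

lemma K_truncated:
  assumes \<delta>: "0 < \<delta>"
  shows "\<exists>ell\<ge>1. \<forall>(A :: nat set) g. finite A \<longrightarrow> inj_on g A \<longrightarrow>
     (\<Sum>z\<in>A. K \<rho> (g z) * real (min ell (g z))) \<le> \<delta> * real ell"
proof -
  obtain J where J: "\<And>A. finite A \<Longrightarrow> A \<subseteq> {J..} \<Longrightarrow> sum (K \<rho>) A \<le> \<delta> / 2"
    using K_tail[of "\<delta> / 2"] \<delta> by auto
  define ell where "ell = nat \<lceil>2 * real J / \<delta>\<rceil> + 1"
  have ell: "real J \<le> \<delta> * real ell / 2"
  proof -
    have "2 * real J / \<delta> \<le> real ell" unfolding ell_def by linarith
    then show ?thesis using \<delta> by (simp add: field_simps)
  qed
  have "(\<Sum>z\<in>A. K \<rho> (g z) * real (min ell (g z))) \<le> \<delta> * real ell"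
    if A: "finite A" "inj_on g A" for A :: "nat set" and g
  proof -
    let ?H = "{z\<in>A. J \<le> g z}"
    have "K \<rho> (g z) * real (min ell (g z)) \<le> real J * K \<rho> (g z) + (if J \<le> g z then real ell * K \<rho> (g z) else 0)" for z
    proof (cases "J \<le> g z")
      case True
      have "K \<rho> (g z) * real (min ell (g z)) \<le> K \<rho> (g z) * real ell"
        by (intro mult_left_mono) auto
      then show ?thesis using True by (simp add: mult.commute add_increasing)
    next
      case False
      have "K \<rho> (g z) * real (min ell (g z)) \<le> K \<rho> (g z) * real J"
        using False by (intro mult_left_mono) auto
      then show ?thesis using False by (simp add: mult.commute)
    qed
    then have "(\<Sum>z\<in>A. K \<rho> (g z) * real (min ell (g z)))
      \<le> (\<Sum>z\<in>A. real J * K \<rho> (g z) + (if J \<le> g z then real ell * K \<rho> (g z) else 0))"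
      by (intro sum_mono)
    also have "\<dots> = real J * (\<Sum>z\<in>A. K \<rho> (g z)) + (\<Sum>z\<in>A. if J \<le> g z then real ell * K \<rho> (g z) else 0)"
      by (simp add: sum.distrib sum_distrib_left)
    also have "(\<Sum>z\<in>A. if J \<le> g z then real ell * K \<rho> (g z) else 0) = real ell * (\<Sum>z\<in>?H. K \<rho> (g z))"
      using A by (simp add: sum_distrib_left flip: sum.inter_filter)
    also have "(\<Sum>z\<in>?H. K \<rho> (g z)) = sum (K \<rho>) (g ` ?H)"
      by (subst sum.reindex) (use A in \<open>auto simp: inj_on_def\<close>)
    also have "real J * (\<Sum>z\<in>A. K \<rho> (g z)) + real ell * sum (K \<rho>) (g ` ?H) \<le> real J * 1 + real ell * (\<delta> / 2)"
      using A by (intro add_mono mult_left_mono K_sum_le J) auto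
    also have "\<dots> \<le> \<delta> * real ell" using ell by (simp add: mult.commute)
    finally show ?thesis .
  qed
  moreover have "1 \<le> ell" by (simp add: ell_def)
  ultimately show ?thesis by blast
qed

text \<open>
  Natural subtraction truncates and \<open>K \<rho> 0 = 0\<close>, so each summand is \<open>K\<close> of the distance
  between \<open>x\<close> and \<open>y\<close>.
\<close>

definition influence :: "nat \<Rightarrow> nat set \<Rightarrow> nat \<Rightarrow> real" where
  "influence L T x = (\<Sum>y\<in>insert 0 (insert L T). K \<rho> (x - y) + K \<rho> (y - x))"

lemma influence_nonneg: "0 \<le> influence L T x"
  by (simp add: influence_def sum_nonneg)

text \<open>Relative to the weight of \<open>T\<close>, this is the mean number of particles that
  appear when the empty block is refilled. The block lies in one gap of \<open>T\<close>, and each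
  of its sites is treated by \<open>part_fun_through_le\<close>.\<close>

lemma block_regrow:
  assumes l: "0 < l" "l < 1" and C: "1 \<le> C" "\<And>a b. a < b \<Longrightarrow> part_fun l a b \<le> C * K \<rho> (b - a)"
    and B: "convex_in L B" and T: "T \<subseteq> {0<..<L}" "T \<inter> B = {}"
  shows "(\<Sum>U\<in>Pow B. w l 0 L (T \<union> U) * real (card U)) \<le> 4 * C\<^sup>2 * w l 0 L T * (\<Sum>x\<in>B. influence L T x)"
proof -
  have BI: "B \<subseteq> {0<..<L}" and fB: "finite B"
    using B finite_subset by (auto simp: convex_in_def)
  have "(\<Sum>U\<in>Pow B. w l 0 L (T \<union> U) * real (card U)) = (\<Sum>U\<in>Pow B. \<Sum>x\<in>B. if x \<in> U then w l 0 L (T \<union> U) else 0)"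
  proof (intro sum.cong refl)
    fix U assume U: "U \<in> Pow B"
    have "(\<Sum>x\<in>B. if x \<in> U then w l 0 L (T \<union> U) else 0) = (\<Sum>x\<in>U. w l 0 L (T \<union> U))"
      using U fB by (intro sum.mono_neutral_cong_right) auto
    then show "w l 0 L (T \<union> U) * real (card U) = (\<Sum>x\<in>B. if x \<in> U then w l 0 L (T \<union> U) else 0)"
      by simp
  qed
  also have "\<dots> = (\<Sum>x\<in>B. \<Sum>U\<in>Pow B. if x \<in> U then w l 0 L (T \<union> U) else 0)"
    by (rule sum.swap)
  also have "\<dots> \<le> (\<Sum>x\<in>B. 4 * C\<^sup>2 * w l 0 L T * influence L T x)"
  proof (rule sum_mono)
    fix x assume x: "x \<in> B"
    then have x0: "0 < x" "x < L" "x \<notin> T" using BI T by auto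
    obtain a where a: "a < x" "a = 0 \<or> a \<in> T" "T \<inter> {a<..<x} = {}" by (rule ex_left[OF x0(1)])
    obtain b where b: "x < b" "b \<le> L" "b = L \<or> b \<in> T" "T \<inter> {x<..<b} = {}" by (rule ex_right[OF x0(2)])
    have ab: "T \<inter> {a<..<b} = {}"
    proof -
      have "{a<..<b} = {a<..<x} \<union> {x} \<union> {x<..<b}" using a b by auto
      then show ?thesis using a b x0 by auto
    qed
    have "a < y \<and> y < b" if y: "y \<in> B" for y
    proof (rule ccontr)
      assume "\<not> (a < y \<and> y < b)"
      then consider "y \<le> a" | "b \<le> y" by linarith
      then show False
      proof cases
        case 1
        then have "a \<in> B" using y x a convex_inD[OF B, of y x a] by auto
        moreover have "a \<noteq> 0" using 1 y BI by auto
        ultimately show False using a T by auto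
      next
        case 2
        then have "b \<in> B" using y x b convex_inD[OF B, of x y b] by auto
        moreover have "b \<noteq> L" using 2 y BI by auto
        ultimately show False using b T by auto
      qed
    qed
    then have Bab: "B \<subseteq> {a<..<b}" by auto
    have "(\<Sum>U\<in>Pow B. if x \<in> U then w l 0 L (T \<union> U) else 0) * K \<rho> (b - a)
      = (\<Sum>U\<in>Pow B. w l 0 L T * (if x \<in> U then w l a b U else 0))"
      unfolding sum_distrib_right
    proof (intro sum.cong refl)
      fix U assume U: "U \<in> Pow B"
      have "w l 0 L (T \<union> U) * K \<rho> (b - a) = w l 0 L T * w l a b U"
        by (rule w_markov) (use a b ab U Bab in auto)
      then show "(if x \<in> U then w l 0 L (T \<union> U) else 0) * K \<rho> (b - a) = w l 0 L T * (if x \<in> U then w l a b U else 0)"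
        by simp
    qed
    also have "\<dots> = w l 0 L T * (\<Sum>U\<in>Pow B. if x \<in> U then w l a b U else 0)"
      by (simp add: sum_distrib_left)
    also have "\<dots> \<le> w l 0 L T * (\<Sum>U\<in>Pow {a<..<b}. if x \<in> U then w l a b U else 0)"
      using Bab l by (intro mult_left_mono sum_mono2) (auto simp: w_nonneg)
    also have "\<dots> \<le> w l 0 L T * (4 * C\<^sup>2 * K \<rho> (b - a) * (K \<rho> (x - a) + K \<rho> (b - x)))"
      using l a b by (intro mult_left_mono part_fun_through_le C w_nonneg) auto
    \<comment> \<open>Passing from the two neighbours \<open>a\<close>, \<open>b\<close> to all
      particles makes the bound additive over \<open>T\<close>, so that it can later be summed over
      blocks particle by particle.\<close>
    also have "\<dots> \<le> w l 0 L T * (4 * C\<^sup>2 * K \<rho> (b - a) * influence L T x)"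
    proof (intro mult_left_mono)
      let ?Y = "insert 0 (insert L T)"
      have fT: "finite ?Y" using T finite_subset by blast
      have "(\<Sum>y\<in>{a, b}. K \<rho> (x - y) + K \<rho> (y - x)) \<le> influence L T x"
        unfolding influence_def using a b fT by (intro sum_mono2) auto
      then show "K \<rho> (x - a) + K \<rho> (b - x) \<le> influence L T x" using a b by simp
    qed (use l in \<open>auto simp: w_nonneg\<close>)
    also have "\<dots> = 4 * C\<^sup>2 * w l 0 L T * influence L T x * K \<rho> (b - a)" by simp
    finally show "(\<Sum>U\<in>Pow B. if x \<in> U then w l 0 L (T \<union> U) else 0) \<le> 4 * C\<^sup>2 * w l 0 L T * influence L T x"
      by (rule mult_right_le_imp_le) (use a b in \<open>simp add: K_pos\<close>)
  qed
  finally show ?thesis by (simp add: sum_distrib_left)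
qed

text \<open>\<open>F S\<close> is replaced by \<open>F (S - B)\<close>. The error is the path bound
  \<open>P\<close>, multiplied by the at most \<open>ell\<close> particles of the block; the main
  term sees only the outside of the block, so the inside can be summed by
  \<open>block_regrow\<close>.\<close>

lemma block_inequality:
  assumes l: "0 < l" "l < 1" and C: "1 \<le> C" "\<And>a b. a < b \<Longrightarrow> part_fun l a b \<le> C * K \<rho> (b - a)"
    and P: "(\<Sum>S\<in>Pow {0<..<L}. w l 0 L S * (F S - F (S - B))\<^sup>2) \<le> P * removal_form l L B F"
    and B: "convex_in L B" "card B \<le> ell"
  shows "(\<Sum>S\<in>Pow {0<..<L}. w l 0 L S * real (card (S \<inter> B)) * (F S)\<^sup>2)
    \<le> 2 * real ell * P * removal_form l L B F
      + 8 * C\<^sup>2 * (\<Sum>T\<in>Pow {0<..<L}. w l 0 L T * (F T)\<^sup>2 * (if T \<inter> B = {} then \<Sum>x\<in>B. influence L T x else 0))"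
proof -
  let ?I = "{0<..<L}"
  have BI: "B \<subseteq> ?I" and fB: "finite B"
    using B finite_subset by (auto simp: convex_in_def)
  have "w l 0 L S * real (card (S \<inter> B)) * (F S)\<^sup>2
      \<le> 2 * real ell * (w l 0 L S * (F S - F (S - B))\<^sup>2) + 2 * (w l 0 L S * real (card (S \<inter> B)) * (F (S - B))\<^sup>2)" for S
  proof -
    have c: "card (S \<inter> B) \<le> ell" using B(2) card_mono[OF fB, of "S \<inter> B"] by auto
    have w0: "0 \<le> w l 0 L S" using l by (simp add: w_nonneg)
    have "0 \<le> (F S - 2 * F (S - B))\<^sup>2" by simp
    then have "(F S)\<^sup>2 \<le> 2 * (F S - F (S - B))\<^sup>2 + 2 * (F (S - B))\<^sup>2"
      by (simp add: power2_eq_square algebra_simps)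
    then have "w l 0 L S * real (card (S \<inter> B)) * (F S)\<^sup>2
      \<le> w l 0 L S * real (card (S \<inter> B)) * (2 * (F S - F (S - B))\<^sup>2 + 2 * (F (S - B))\<^sup>2)"
      using w0 by (intro mult_left_mono) auto
    also have "\<dots> = real (card (S \<inter> B)) * (2 * (w l 0 L S * (F S - F (S - B))\<^sup>2)) + 2 * (w l 0 L S * real (card (S \<inter> B)) * (F (S - B))\<^sup>2)"
      by (simp add: algebra_simps)
    also have "\<dots> \<le> real ell * (2 * (w l 0 L S * (F S - F (S - B))\<^sup>2)) + 2 * (w l 0 L S * real (card (S \<inter> B)) * (F (S - B))\<^sup>2)"
      using c w0 by (intro add_right_mono mult_right_mono) auto
    finally show ?thesis by simp
  qed
  then have "(\<Sum>S\<in>Pow ?I. w l 0 L S * real (card (S \<inter> B)) * (F S)\<^sup>2)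
    \<le> (\<Sum>S\<in>Pow ?I. 2 * real ell * (w l 0 L S * (F S - F (S - B))\<^sup>2) + 2 * (w l 0 L S * real (card (S \<inter> B)) * (F (S - B))\<^sup>2))"
    by (intro sum_mono)
  also have "\<dots> = 2 * real ell * (\<Sum>S\<in>Pow ?I. w l 0 L S * (F S - F (S - B))\<^sup>2)
     + 2 * (\<Sum>S\<in>Pow ?I. w l 0 L S * real (card (S \<inter> B)) * (F (S - B))\<^sup>2)"
    by (simp add: sum.distrib sum_distrib_left)
  also have "\<dots> \<le> 2 * real ell * (P * removal_form l L B F)
     + 2 * (\<Sum>S\<in>Pow ?I. w l 0 L S * real (card (S \<inter> B)) * (F (S - B))\<^sup>2)"
    by (intro add_right_mono mult_left_mono P) auto
  also have "(\<Sum>S\<in>Pow ?I. w l 0 L S * real (card (S \<inter> B)) * (F (S - B))\<^sup>2)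
    = (\<Sum>T\<in>Pow (?I - B). \<Sum>U\<in>Pow B. w l 0 L (T \<union> U) * real (card ((T \<union> U) \<inter> B)) * (F (T \<union> U - B))\<^sup>2)"
    by (rule sum_Pow_split[OF BI])
  also have "\<dots> \<le> (\<Sum>T\<in>Pow (?I - B). 4 * C\<^sup>2 * (w l 0 L T * (F T)\<^sup>2 * (if T \<inter> B = {} then \<Sum>x\<in>B. influence L T x else 0)))"
  proof (rule sum_mono)
    fix T assume T: "T \<in> Pow (?I - B)"
    have TB: "T \<subseteq> ?I" "T \<inter> B = {}" using T by auto
    have "(\<Sum>U\<in>Pow B. w l 0 L (T \<union> U) * real (card ((T \<union> U) \<inter> B)) * (F (T \<union> U - B))\<^sup>2)
      = (\<Sum>U\<in>Pow B. w l 0 L (T \<union> U) * real (card U) * (F T)\<^sup>2)"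
    proof (intro sum.cong refl)
      fix U assume U: "U \<in> Pow B"
      have "(T \<union> U) \<inter> B = U" "T \<union> U - B = T" using TB U by auto
      then show "w l 0 L (T \<union> U) * real (card ((T \<union> U) \<inter> B)) * (F (T \<union> U - B))\<^sup>2 = w l 0 L (T \<union> U) * real (card U) * (F T)\<^sup>2"
        by simp
    qed
    also have "\<dots> = (\<Sum>U\<in>Pow B. w l 0 L (T \<union> U) * real (card U)) * (F T)\<^sup>2"
      by (simp add: sum_distrib_right)
    also have "\<dots> \<le> 4 * C\<^sup>2 * w l 0 L T * (\<Sum>x\<in>B. influence L T x) * (F T)\<^sup>2"
      by (intro mult_right_mono block_regrow[OF l C B(1) TB]) auto
    finally show "(\<Sum>U\<in>Pow B. w l 0 L (T \<union> U) * real (card ((T \<union> U) \<inter> B)) * (F (T \<union> U - B))\<^sup>2)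
      \<le> 4 * C\<^sup>2 * (w l 0 L T * (F T)\<^sup>2 * (if T \<inter> B = {} then \<Sum>x\<in>B. influence L T x else 0))"
      using TB by (simp add: mult_ac)
  qed
  also have "\<dots> \<le> (\<Sum>T\<in>Pow ?I. 4 * C\<^sup>2 * (w l 0 L T * (F T)\<^sup>2 * (if T \<inter> B = {} then \<Sum>x\<in>B. influence L T x else 0)))"
    using l by (intro sum_mono2) (auto intro!: mult_nonneg_nonneg sum_nonneg simp: w_nonneg influence_nonneg)
  finally show ?thesis by (simp flip: sum_distrib_left)
qed

text \<open>The window of the \<open>ell\<close> sites just below \<open>s\<close>, cut to the
  interior and written without natural subtraction. As \<open>s\<close> runs through
  \<open>1..L + ell\<close>, every interior site lies in exactly \<open>ell\<close> windows, which
  is \<open>block_sum\<close>.\<close>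

definition block :: "nat \<Rightarrow> nat \<Rightarrow> nat \<Rightarrow> nat set" where
  "block L ell s = {x\<in>{0<..<L}. x < s \<and> s \<le> x + ell}"

lemma block_convex: "convex_in L (block L ell s)"
  by (auto simp: convex_in_def block_def)

lemma block_card: "card (block L ell s) \<le> ell"
proof -
  have "card (block L ell s) \<le> card {s - ell..<s}"
    by (intro card_mono) (auto simp: block_def)
  then show ?thesis by simp
qed

lemma block_sum:
  fixes h :: "nat \<Rightarrow> real"
  shows "(\<Sum>s\<in>{1..L + ell}. \<Sum>x\<in>block L ell s. h x) = real ell * (\<Sum>x\<in>{0<..<L}. h x)"
proof -
  have "(\<Sum>s\<in>{1..L + ell}. \<Sum>x\<in>block L ell s. h x)
    = (\<Sum>s\<in>{1..L + ell}. \<Sum>x\<in>{0<..<L}. if x < s \<and> s \<le> x + ell then h x else 0)"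
    unfolding block_def by (intro sum.cong refl sum.inter_filter) auto
  also have "\<dots> = (\<Sum>x\<in>{0<..<L}. \<Sum>s\<in>{1..L + ell}. if x < s \<and> s \<le> x + ell then h x else 0)"
    by (rule sum.swap)
  also have "\<dots> = (\<Sum>x\<in>{0<..<L}. \<Sum>s\<in>{x<..x + ell}. h x)"
    by (intro sum.cong refl sum.mono_neutral_cong_right) auto
  also have "\<dots> = real ell * (\<Sum>x\<in>{0<..<L}. h x)"
    by (simp add: sum_distrib_left)
  finally show ?thesis .
qed

text \<open>A particle \<open>y\<close> acts on \<open>x\<close> only through windows that contain
  \<open>x\<close> but not \<open>y\<close>, and their number is at most the smaller of
  \<open>ell\<close> and the distance. This is the truncated mean in \<open>E\<close>, once for each
  side of \<open>y\<close>. The ends of the box contribute the term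
  \<open>2 * real ell\<close>.\<close>

lemma block_influence:
  assumes E: "\<And>(A :: nat set) g. finite A \<Longrightarrow> inj_on g A \<Longrightarrow>
     (\<Sum>z\<in>A. K \<rho> (g z) * real (min ell (g z))) \<le> \<delta> * real ell"
    and T: "T \<subseteq> {0<..<L}"
  shows "(\<Sum>s\<in>{1..L + ell}. if T \<inter> block L ell s = {} then \<Sum>x\<in>block L ell s. influence L T x else 0)
    \<le> 2 * \<delta> * real ell * real (card T) + 2 * real ell"
proof -
  let ?k = "\<lambda>x y. K \<rho> (x - y) + K \<rho> (y - x)"
  let ?I = "{0<..<L}" and ?J = "{1..L + ell}"
  have fT: "finite T" using T finite_subset by blast
  have "(\<Sum>s\<in>?J. if T \<inter> block L ell s = {} then \<Sum>x\<in>block L ell s. influence L T x else 0)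
    \<le> (\<Sum>s\<in>?J. \<Sum>x\<in>block L ell s. (K \<rho> x + K \<rho> (L - x)) + (\<Sum>y\<in>T. if y \<notin> block L ell s then ?k x y else 0))"
  proof (rule sum_mono)
    fix s
    show "(if T \<inter> block L ell s = {} then \<Sum>x\<in>block L ell s. influence L T x else 0)
       \<le> (\<Sum>x\<in>block L ell s. (K \<rho> x + K \<rho> (L - x)) + (\<Sum>y\<in>T. if y \<notin> block L ell s then ?k x y else 0))"
    proof (cases "T \<inter> block L ell s = {}")
      case True
      have "influence L T x \<le> (K \<rho> x + K \<rho> (L - x)) + (\<Sum>y\<in>T. if y \<notin> block L ell s then ?k x y else 0)"
        if x: "x \<in> block L ell s" for x
      proof -
        have "0 \<notin> insert L T" "L \<notin> T" using T x by (auto simp: block_def)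
        then have "influence L T x = (K \<rho> x + K \<rho> (L - x)) + (\<Sum>y\<in>T. ?k x y)"
          using x fT by (simp add: influence_def block_def)
        also have "(\<Sum>y\<in>T. ?k x y) = (\<Sum>y\<in>T. if y \<notin> block L ell s then ?k x y else 0)"
          using True by (intro sum.cong refl) auto
        finally show ?thesis by simp
      qed
      then show ?thesis using True by (simp add: sum_mono)
    next
      case False
      have "0 \<le> (\<Sum>x\<in>block L ell s. (K \<rho> x + K \<rho> (L - x)) + (\<Sum>y\<in>T. if y \<notin> block L ell s then ?k x y else 0))"
        by (intro sum_nonneg add_nonneg_nonneg) auto
      then show ?thesis using False by simp
    qed
  qed
  also have "\<dots> = (\<Sum>s\<in>?J. \<Sum>x\<in>block L ell s. K \<rho> x + K \<rho> (L - x))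
     + (\<Sum>s\<in>?J. \<Sum>x\<in>block L ell s. \<Sum>y\<in>T. if y \<notin> block L ell s then ?k x y else 0)"
    by (simp add: sum.distrib)
  also have "(\<Sum>s\<in>?J. \<Sum>x\<in>block L ell s. K \<rho> x + K \<rho> (L - x)) = real ell * ((\<Sum>x\<in>?I. K \<rho> x) + (\<Sum>x\<in>?I. K \<rho> (L - x)))"
    unfolding block_sum by (simp add: sum.distrib)
  also have "\<dots> \<le> real ell * (1 + 1)"
    by (intro mult_left_mono add_mono K_sum_le) (auto simp: inj_on_def)
  also have "(\<Sum>s\<in>?J. \<Sum>x\<in>block L ell s. \<Sum>y\<in>T. if y \<notin> block L ell s then ?k x y else 0)
    = (\<Sum>s\<in>?J. \<Sum>y\<in>T. \<Sum>x\<in>?I. if x \<in> block L ell s \<and> y \<notin> block L ell s then ?k x y else 0)"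
  proof (rule sum.cong[OF refl])
    fix s
    have "(\<Sum>x\<in>block L ell s. \<Sum>y\<in>T. if y \<notin> block L ell s then ?k x y else 0)
      = (\<Sum>y\<in>T. \<Sum>x\<in>block L ell s. if y \<notin> block L ell s then ?k x y else 0)" by (rule sum.swap)
    also have "\<dots> = (\<Sum>y\<in>T. \<Sum>x\<in>?I. if x \<in> block L ell s \<and> y \<notin> block L ell s then ?k x y else 0)"
      by (intro sum.cong refl sum.mono_neutral_cong_left) (auto simp: block_def)
    finally show "(\<Sum>x\<in>block L ell s. \<Sum>y\<in>T. if y \<notin> block L ell s then ?k x y else 0)
      = (\<Sum>y\<in>T. \<Sum>x\<in>?I. if x \<in> block L ell s \<and> y \<notin> block L ell s then ?k x y else 0)" .
  qed
  also have "\<dots> = (\<Sum>y\<in>T. \<Sum>x\<in>?I. \<Sum>s\<in>?J. if x \<in> block L ell s \<and> y \<notin> block L ell s then ?k x y else 0)"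
    by (subst sum.swap) (intro sum.cong refl sum.swap)
  also have "\<dots> \<le> (\<Sum>y\<in>T. \<Sum>x\<in>?I. K \<rho> (x - y) * real (min ell (x - y)) + K \<rho> (y - x) * real (min ell (y - x)))"
  proof (intro sum_mono)
    fix x y assume x: "x \<in> ?I" and y: "y \<in> T"
    have yI: "y \<in> ?I" using T y by auto
    let ?S = "{s\<in>?J. x \<in> block L ell s \<and> y \<notin> block L ell s}"
    have "(\<Sum>s\<in>?J. if x \<in> block L ell s \<and> y \<notin> block L ell s then ?k x y else 0) = (\<Sum>s\<in>?S. ?k x y)"
      by (rule sum.inter_filter[symmetric]) simp
    also have "\<dots> = real (card ?S) * ?k x y" by simp
    also have "\<dots> \<le> K \<rho> (x - y) * real (min ell (x - y)) + K \<rho> (y - x) * real (min ell (y - x))"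
    proof (cases "y < x")
      case True
      have "card ?S \<le> card {max x (y + ell)<..x + ell}"
        using yI True by (intro card_mono) (auto simp: block_def)
      also have "\<dots> = min ell (x - y)" using True by auto
      finally have "real (card ?S) * K \<rho> (x - y) \<le> real (min ell (x - y)) * K \<rho> (x - y)"
        by (intro mult_right_mono) auto
      then show ?thesis using True by (simp add: mult.commute)
    next
      case False
      have "card ?S \<le> card {x<..min y (x + ell)}"
        using yI False by (intro card_mono) (auto simp: block_def)
      also have "\<dots> = min ell (y - x)" using False by auto
      finally have "real (card ?S) * K \<rho> (y - x) \<le> real (min ell (y - x)) * K \<rho> (y - x)"
        by (intro mult_right_mono) auto
      then show ?thesis using False by (simp add: mult.commute)
    qed
    finally show "(\<Sum>s\<in>?J. if x \<in> block L ell s \<and> y \<notin> block L ell s then ?k x y else 0)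
      \<le> K \<rho> (x - y) * real (min ell (x - y)) + K \<rho> (y - x) * real (min ell (y - x))" .
  qed
  also have "\<dots> \<le> (\<Sum>y\<in>T. \<delta> * real ell + \<delta> * real ell)"
  proof (rule sum_mono)
    fix y
    \<comment> \<open>Natural subtraction is injective only beyond \<open>y\<close>; the sites up to
      \<open>y\<close> give zero and are dropped before \<open>E\<close> is applied.\<close>
    have "(\<Sum>x\<in>?I. K \<rho> (x - y) * real (min ell (x - y))) = (\<Sum>x\<in>?I \<inter> {y<..}. K \<rho> (x - y) * real (min ell (x - y)))"
      by (rule sum.mono_neutral_right) auto
    also have "\<dots> \<le> \<delta> * real ell" by (intro E) (auto simp: inj_on_def)
    finally have 1: "(\<Sum>x\<in>?I. K \<rho> (x - y) * real (min ell (x - y))) \<le> \<delta> * real ell" .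
    have "(\<Sum>x\<in>?I. K \<rho> (y - x) * real (min ell (y - x))) = (\<Sum>x\<in>?I \<inter> {..<y}. K \<rho> (y - x) * real (min ell (y - x)))"
      by (rule sum.mono_neutral_right) auto
    also have "\<dots> \<le> \<delta> * real ell" by (intro E) (auto simp: inj_on_def)
    finally have 2: "(\<Sum>x\<in>?I. K \<rho> (y - x) * real (min ell (y - x))) \<le> \<delta> * real ell" .
    show "(\<Sum>x\<in>?I. K \<rho> (x - y) * real (min ell (x - y)) + K \<rho> (y - x) * real (min ell (y - x))) \<le> \<delta> * real ell + \<delta> * real ell"
      unfolding sum.distrib using 1 2 by (rule add_mono)
  qed
  finally show ?thesis by (simp add: algebra_simps)
qed

text \<open>
  Averaging the block inequality over all translates of a long block: a particle is removed by
  most blocks containing it, but it only triggers births in the few blocks whose boundary is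
  close to it.
\<close>

lemma particle_inequality:
  assumes l: "0 < l" "l < 1"
  shows "\<exists>A>0. \<exists>B>0. \<forall>L F. (\<Sum>S\<in>Pow {0<..<L}. w l 0 L S * real (card S) * (F S)\<^sup>2)
      \<le> A * removal_form l L {0<..<L} F + B * (\<Sum>S\<in>Pow {0<..<L}. w l 0 L S * (F S)\<^sup>2)"
proof -
  obtain C where C: "C \<ge> 1" "\<And>a b. a < b \<Longrightarrow> part_fun l a b \<le> C * K \<rho> (b - a)"
    using part_fun_le[OF l] by blast
  obtain P where P: "P > 0" "\<And>L B F. convex_in L B \<Longrightarrow>
     (\<Sum>S\<in>Pow {0<..<L}. w l 0 L S * (F S - F (S - B))\<^sup>2) \<le> P * removal_form l L B F"
    using path_const[OF l] by blast
  \<comment> \<open>The prefactor of regrowth in \<open>block_inequality\<close>. The level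
    \<open>1 / (4 * M)\<close> chosen next makes regrowth cost \<open>M * 2 / (4 * M)\<close>, one
    half of the removal term.\<close>
  define M where "M = 8 * C\<^sup>2"
  have M: "0 < M" using C by (simp add: M_def)
  obtain ell where ell: "ell \<ge> 1" and E: "\<And>(A :: nat set) g. finite A \<Longrightarrow> inj_on g A \<Longrightarrow>
     (\<Sum>z\<in>A. K \<rho> (g z) * real (min ell (g z))) \<le> 1 / (4 * M) * real ell"
    using K_truncated[of "1 / (4 * M)"] M by auto
  have "(\<Sum>S\<in>Pow {0<..<L}. w l 0 L S * real (card S) * (F S)\<^sup>2)
      \<le> 4 * real ell * P * removal_form l L {0<..<L} F + 4 * M * (\<Sum>S\<in>Pow {0<..<L}. w l 0 L S * (F S)\<^sup>2)" for L F
  proof -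
    let ?I = "{0<..<L}" and ?J = "{1..L + ell}"
    let ?B = "block L ell"
    define N2 where "N2 = (\<Sum>S\<in>Pow ?I. w l 0 L S * real (card S) * (F S)\<^sup>2)"
    define F2 where "F2 = (\<Sum>S\<in>Pow ?I. w l 0 L S * (F S)\<^sup>2)"
    have "real ell * N2 = (\<Sum>s\<in>?J. \<Sum>S\<in>Pow ?I. w l 0 L S * real (card (S \<inter> ?B s)) * (F S)\<^sup>2)"
    proof -
      have "(\<Sum>s\<in>?J. real (card (S \<inter> ?B s))) = real ell * real (card S)" if S: "S \<subseteq> ?I" for S
      proof -
        have "(\<Sum>s\<in>?J. real (card (S \<inter> ?B s))) = (\<Sum>s\<in>?J. \<Sum>x\<in>?B s. if x \<in> S then 1 else 0)"
        proof (intro sum.cong refl)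
          fix s
          have "finite (?B s)" by (simp add: block_def)
          then show "real (card (S \<inter> ?B s)) = (\<Sum>x\<in>?B s. if x \<in> S then 1 else 0)"
            by (simp add: Int_commute flip: sum.inter_restrict)
        qed
        also have "\<dots> = real ell * (\<Sum>x\<in>?I. if x \<in> S then 1 else 0)" by (rule block_sum)
        also have "(\<Sum>x\<in>?I. if x \<in> S then 1 else 0) = real (card S)"
          using S by (simp add: Int_absorb1 flip: sum.inter_restrict)
        finally show ?thesis .
      qed
      then have "(\<Sum>S\<in>Pow ?I. w l 0 L S * (\<Sum>s\<in>?J. real (card (S \<inter> ?B s))) * (F S)\<^sup>2)
          = (\<Sum>S\<in>Pow ?I. w l 0 L S * (real ell * real (card S)) * (F S)\<^sup>2)"
        by (intro sum.cong refl) (simp only: Pow_iff)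
      also have "\<dots> = real ell * N2"
        by (simp add: N2_def sum_distrib_left mult_ac)
      finally have "real ell * N2 = (\<Sum>S\<in>Pow ?I. w l 0 L S * (\<Sum>s\<in>?J. real (card (S \<inter> ?B s))) * (F S)\<^sup>2)" ..
      also have "\<dots> = (\<Sum>S\<in>Pow ?I. \<Sum>s\<in>?J. w l 0 L S * real (card (S \<inter> ?B s)) * (F S)\<^sup>2)"
        by (simp add: sum_distrib_left sum_distrib_right)
      also have "\<dots> = (\<Sum>s\<in>?J. \<Sum>S\<in>Pow ?I. w l 0 L S * real (card (S \<inter> ?B s)) * (F S)\<^sup>2)"
        by (rule sum.swap)
      finally show ?thesis .
    qed
    also have "\<dots> \<le> (\<Sum>s\<in>?J. 2 * real ell * P * removal_form l L (?B s) F
      + M * (\<Sum>T\<in>Pow ?I. w l 0 L T * (F T)\<^sup>2 * (if T \<inter> ?B s = {} then \<Sum>x\<in>?B s. influence L T x else 0)))"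
      unfolding M_def
      by (intro sum_mono block_inequality[OF l C] P block_convex block_card)
    also have "\<dots> = 2 * real ell * P * (\<Sum>s\<in>?J. removal_form l L (?B s) F)
      + M * (\<Sum>s\<in>?J. \<Sum>T\<in>Pow ?I. w l 0 L T * (F T)\<^sup>2 * (if T \<inter> ?B s = {} then \<Sum>x\<in>?B s. influence L T x else 0))"
      by (simp add: sum.distrib sum_distrib_left)
    also have "(\<Sum>s\<in>?J. removal_form l L (?B s) F) = real ell * removal_form l L ?I F"
      unfolding removal_form_def by (rule block_sum)
    also have "(\<Sum>s\<in>?J. \<Sum>T\<in>Pow ?I. w l 0 L T * (F T)\<^sup>2 * (if T \<inter> ?B s = {} then \<Sum>x\<in>?B s. influence L T x else 0))
      = (\<Sum>T\<in>Pow ?I. w l 0 L T * (F T)\<^sup>2 * (\<Sum>s\<in>?J. if T \<inter> ?B s = {} then \<Sum>x\<in>?B s. influence L T x else 0))"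
      by (subst sum.swap) (simp add: sum_distrib_left)
    also have "\<dots> \<le> (\<Sum>T\<in>Pow ?I. w l 0 L T * (F T)\<^sup>2 * (2 * (1 / (4 * M)) * real ell * real (card T) + 2 * real ell))"
      using l by (intro sum_mono mult_left_mono block_influence E) (auto simp: w_nonneg)
    also have "\<dots> = real ell * (1 / (2 * M) * N2 + 2 * F2)"
      by (simp add: N2_def F2_def sum.distrib sum_distrib_left algebra_simps)
    also have "2 * real ell * P * (real ell * removal_form l L ?I F) + M * (real ell * (1 / (2 * M) * N2 + 2 * F2))
      = real ell * (2 * real ell * P * removal_form l L ?I F + N2 / 2 + 2 * M * F2)"
      using M by (simp add: field_simps)
    finally have "real ell * N2 \<le> real ell * (2 * real ell * P * removal_form l L ?I F + N2 / 2 + 2 * M * F2)"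
      using M by (simp add: mult_left_mono)
    \<comment> \<open>Regrowth is only \<open>N2 / 2\<close> and is absorbed on the left, which
      doubles the other coefficients.\<close>
    then have "N2 \<le> 2 * real ell * P * removal_form l L ?I F + N2 / 2 + 2 * M * F2"
      using ell by simp
    then have "N2 \<le> 4 * real ell * P * removal_form l L ?I F + 4 * M * F2" by simp
    then show ?thesis by (simp add: N2_def F2_def)
  qed
  moreover have "0 < 4 * real ell * P" "0 < 4 * M" using ell P M by auto
  ultimately show ?thesis by blast
qed

end

section \<open>The heat-bath chain\<close>

text \<open>Restriction to \<open>{0..L}\<close> fixes the value outside, so this is a bijection
  from sets of interior particles onto the state space.\<close>

definition config :: "nat \<Rightarrow> nat set \<Rightarrow> nat \<Rightarrow> nat" where
  "config L S = (\<lambda>x\<in>{0..L}. if x = 0 \<or> x = L \<or> x \<in> S then 1 else 0)"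

lemma config_eq_1: "S \<subseteq> {0<..<L} \<Longrightarrow> {x\<in>{0<..<L}. config L S x = 1} = S"
  by (auto simp: config_def)

lemma config_surj:
  assumes "\<eta> \<in> Omega L"
  shows "config L {x\<in>{0<..<L}. \<eta> x = 1} = \<eta>"
proof
  fix x
  have "\<eta> x \<in> {0, 1}" if "x \<le> L"
    using assms that by (auto simp: Omega_def PiE_def Pi_def)
  moreover have "\<eta> x = undefined" if "\<not> x \<le> L"
    using assms that by (auto simp: Omega_def PiE_def extensional_def)
  ultimately show "config L {x\<in>{0<..<L}. \<eta> x = 1} x = \<eta> x"
    using assms by (auto simp: config_def Omega_def)
qed

lemma config_Omega: "config L S \<in> Omega L"
  by (auto simp: config_def Omega_def)

lemma config_bij: "bij_betw (config L) (Pow {0<..<L}) (Omega L)"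
  by (rule bij_betw_byWitness[where f' = "\<lambda>\<eta>. {x\<in>{0<..<L}. \<eta> x = 1}"])
    (use config_eq_1 config_surj config_Omega in \<open>simp_all add: image_subset_iff del: One_nat_def\<close>, auto)

lemma sum_Omega: "(\<Sum>\<eta>\<in>Omega L. h \<eta>) = (\<Sum>S\<in>Pow {0<..<L}. h (config L S))"
  by (rule sum.reindex_bij_betw[OF config_bij, symmetric])

lemma finite_Omega [simp]: "finite (Omega L)"
  using config_bij[of L] by (metis bij_betw_finite finite_Pow_iff finite_greaterThanLessThan)

lemma Omega_cases:
  assumes "\<eta> \<in> Omega L"
  obtains S where "S \<subseteq> {0<..<L}" "\<eta> = config L S"
  using config_surj[OF assms] by (metis (no_types, lifting) mem_Collect_eq subsetI)

lemma num_particles_config: "S \<subseteq> {0<..<L} \<Longrightarrow> num_particles L (config L S) = card S"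
  unfolding num_particles_def by (simp only: config_eq_1)

lemma same_off_config:
  assumes S: "S \<subseteq> {0<..<L}" and x: "x \<in> {0<..<L}"
  shows "same_off L x (config L S) = {config L (insert x S), config L (S - {x})}"
proof
  show "same_off L x (config L S) \<subseteq> {config L (insert x S), config L (S - {x})}"
  proof
    fix \<xi> assume \<xi>: "\<xi> \<in> same_off L x (config L S)"
    then obtain T where T: "T \<subseteq> {0<..<L}" "\<xi> = config L T" by (auto simp: same_off_def elim: Omega_cases)
    have off: "y \<in> T \<longleftrightarrow> y \<in> S" if "y \<noteq> x" for y
    proof (cases "y \<in> {0<..<L}")
      case True
      then have "config L T y = config L S y" using \<xi> T that by (auto simp: same_off_def)
      then show ?thesis using True by (auto simp: config_def split: if_splits)
    qed (use S T in auto)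
    have "y \<in> T \<longleftrightarrow> y \<in> (if x \<in> T then insert x S else S - {x})" for y
      using off[of y] by (cases "y = x") auto
    then have "T = (if x \<in> T then insert x S else S - {x})" by blast
    then have "T = insert x S \<or> T = S - {x}" by presburger
    then show "\<xi> \<in> {config L (insert x S), config L (S - {x})}" using T by auto
  qed
qed (auto simp: same_off_def config_Omega, auto simp: config_def split: if_splits)

lemma same_off_sym:
  assumes "\<eta> \<in> Omega L" "\<xi> \<in> same_off L x \<eta>"
  shows "\<eta> \<in> same_off L x \<xi>" "same_off L x \<xi> = same_off L x \<eta>"
  using assms by (auto simp: same_off_def)

lemma same_off_refl: "\<eta> \<in> Omega L \<Longrightarrow> \<eta> \<in> same_off L x \<eta>"
  by (simp add: same_off_def)

lemma same_off_subset: "same_off L x \<eta> \<subseteq> Omega L"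
  by (auto simp: same_off_def)

lemma finite_same_off [simp]: "finite (same_off L x \<eta>)"
  using same_off_subset finite_Omega by (rule finite_subset)

context renewal
begin

text \<open>The sorted list of particles starts with \<open>a\<close>, and its tail is the list that
  starts with the next particle, so one step of the recursion for \<open>w\<close> shifts the index
  of the product by one.\<close>

lemma w_list:
  fixes S :: "nat set"
  assumes "a < b"
  shows "l ^ card (S \<inter> {a<..<b}) * (\<Prod>j = 0..card (S \<inter> {a<..<b}).
      K \<rho> (sorted_list_of_set (insert a (insert b (S \<inter> {a<..<b}))) ! (j + 1)
        - sorted_list_of_set (insert a (insert b (S \<inter> {a<..<b}))) ! j)) = w l a b S"
  using assms
proof (induction a rule: w_induct[where S = S and b = b])
  case (empty a)
  then have "sorted_list_of_set {a, b} = [a, b]" by simp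
  then show ?case using empty by (simp add: w_empty)
next
  case (step a z)
  let ?Sa = "S \<inter> {a<..<b}" and ?Sz = "S \<inter> {z<..<b}"
  have Sa: "?Sa = insert z ?Sz"
    using step(1-4) by (auto simp: disjoint_iff)
  then have c: "card ?Sa = Suc (card ?Sz)" by simp
  let ?A = "insert a (insert b ?Sa)"
  have "Min ?A = a" using step by (intro Min_eqI) auto
  moreover have "?A - {a} = insert z (insert b ?Sz)" using Sa step by auto
  ultimately have xs: "sorted_list_of_set ?A = a # sorted_list_of_set (insert z (insert b ?Sz))"
    by (subst sorted_list_of_set_nonempty) auto
  have "Min (insert z (insert b ?Sz)) = z" using step by (intro Min_eqI) auto
  then have hd: "sorted_list_of_set (insert z (insert b ?Sz)) ! 0 = z"
    by (subst sorted_list_of_set_nonempty) auto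
  show ?case
    unfolding xs c prod.atLeast0_atMost_Suc_shift
    using step.IH step(1-4) hd by (simp add: w_first[of z] o_def mult_ac)
qed

lemma weight_config:
  assumes S: "S \<subseteq> {0<..<L}" and L: "0 < L"
  shows "weight \<rho> l L (config L S) = w l 0 L S"
proof -
  have "{x \<in> {0..L}. config L S x = 1} = insert 0 (insert L S)"
    using S by (auto simp: config_def)
  moreover have "S \<inter> {0<..<L} = S" using S by auto
  ultimately show ?thesis
    using w_list[OF L, of l S] S by (simp add: weight_def num_particles_config particle_def)
qed

end

section \<open>The chain at fixed parameters\<close>

locale polymer = renewal +
  fixes lam :: real and L :: nat
  assumes lam: "0 < lam" "lam < 1" and L: "2 \<le> L"
begin

abbreviation "I \<equiv> {0<..<L}"

definition Zp :: real where "Zp = part_fun lam 0 L"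

lemma Zp_eq: "Zp = (\<Sum>S\<in>Pow I. w lam 0 L S)"
  by (simp add: Zp_def part_fun_def)

lemma K_le_Zp: "K \<rho> L \<le> Zp"
proof -
  have "w lam 0 L {} \<le> Zp" unfolding Zp_eq
    using lam by (intro member_le_sum) (auto simp: w_nonneg)
  then show ?thesis by (simp add: w_empty)
qed

lemma Zp_pos: "0 < Zp"
  using K_le_Zp K_pos[of L] L by linarith

lemma partition_fun_eq: "partition_fun \<rho> lam L = Zp"
  unfolding partition_fun_def sum_Omega Zp_eq using L
  by (intro sum.cong refl) (simp add: weight_config)

lemma equil_config: "S \<subseteq> I \<Longrightarrow> equil \<rho> lam L (config L S) = w lam 0 L S / Zp"
  using L by (simp add: equil_def partition_fun_eq weight_config)

lemma equil_pos: "\<eta> \<in> Omega L \<Longrightarrow> 0 < equil \<rho> lam L \<eta>"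
  using lam L Zp_pos by (elim Omega_cases) (simp add: equil_config w_pos)

lemma equil_sum: "(\<Sum>\<eta>\<in>Omega L. equil \<rho> lam L \<eta>) = 1"
proof -
  have "(\<Sum>\<eta>\<in>Omega L. equil \<rho> lam L \<eta>) = (\<Sum>S\<in>Pow I. w lam 0 L S / Zp)"
    unfolding sum_Omega by (intro sum.cong refl) (simp add: equil_config)
  also have "\<dots> = 1" using Zp_pos by (simp add: Zp_eq flip: sum_divide_distrib)
  finally show ?thesis .
qed

definition off_mass :: "nat \<Rightarrow> (nat \<Rightarrow> nat) \<Rightarrow> real" where
  "off_mass x \<eta> = (\<Sum>\<xi>\<in>same_off L x \<eta>. equil \<rho> lam L \<xi>)"

lemma off_mass_pos: "\<eta> \<in> Omega L \<Longrightarrow> 0 < off_mass x \<eta>"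
  unfolding off_mass_def using same_off_refl[of \<eta> L x] same_off_subset[of L x \<eta>]
  by (intro sum_pos) (auto intro!: equil_pos)

text \<open>The case \<open>\<xi> = \<eta>\<close> is included, since resampling may leave the
  configuration unchanged. With these self-jumps the total rate is \<open>L - 1\<close> at every
  state.\<close>

definition rate :: "(nat \<Rightarrow> nat) \<Rightarrow> (nat \<Rightarrow> nat) \<Rightarrow> real" where
  "rate \<eta> \<xi> = (\<Sum>x\<in>{1..<L}. if \<xi> \<in> same_off L x \<eta> then equil \<rho> lam L \<xi> / off_mass x \<eta> else 0)"

lemma rate_sum:
  "(\<Sum>\<xi>\<in>Omega L. rate \<eta> \<xi> * f \<xi>) = (\<Sum>x\<in>{1..<L}. Q \<rho> lam L x f \<eta>)"
proof -
  have "(\<Sum>\<xi>\<in>Omega L. rate \<eta> \<xi> * f \<xi>)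
    = (\<Sum>\<xi>\<in>Omega L. \<Sum>x\<in>{1..<L}. if \<xi> \<in> same_off L x \<eta> then equil \<rho> lam L \<xi> / off_mass x \<eta> * f \<xi> else 0)"
    unfolding rate_def sum_distrib_right by (intro sum.cong refl) simp
  also have "\<dots> = (\<Sum>x\<in>{1..<L}. \<Sum>\<xi>\<in>Omega L. if \<xi> \<in> same_off L x \<eta> then equil \<rho> lam L \<xi> / off_mass x \<eta> * f \<xi> else 0)"
    by (rule sum.swap)
  also have "\<dots> = (\<Sum>x\<in>{1..<L}. Q \<rho> lam L x f \<eta>)"
  proof (rule sum.cong[OF refl])
    fix x
    have "(\<Sum>\<xi>\<in>Omega L. if \<xi> \<in> same_off L x \<eta> then equil \<rho> lam L \<xi> / off_mass x \<eta> * f \<xi> else 0)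
      = (\<Sum>\<xi>\<in>same_off L x \<eta>. equil \<rho> lam L \<xi> / off_mass x \<eta> * f \<xi>)"
      using same_off_subset[of L x \<eta>] by (intro sum.mono_neutral_cong_right) auto
    then show "(\<Sum>\<xi>\<in>Omega L. if \<xi> \<in> same_off L x \<eta> then equil \<rho> lam L \<xi> / off_mass x \<eta> * f \<xi> else 0)
      = Q \<rho> lam L x f \<eta>"
      by (simp add: Q_def off_mass_def sum_divide_distrib)
  qed
  finally show ?thesis .
qed

lemma Q_eq_const:
  assumes "\<eta> \<in> Omega L" "\<And>\<xi>. \<xi> \<in> same_off L x \<eta> \<Longrightarrow> f \<xi> = v"
  shows "Q \<rho> lam L x f \<eta> = v"
proof -
  have "(\<Sum>\<xi>\<in>same_off L x \<eta>. equil \<rho> lam L \<xi> * f \<xi>) = off_mass x \<eta> * v"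
    using assms by (simp add: off_mass_def sum_distrib_right)
  then show ?thesis
    using off_mass_pos[OF assms(1), of x] by (simp add: Q_def flip: off_mass_def)
qed

lemma Q_mono:
  assumes "\<eta> \<in> Omega L" "\<And>\<xi>. \<xi> \<in> same_off L x \<eta> \<Longrightarrow> f \<xi> \<le> g \<xi>"
  shows "Q \<rho> lam L x f \<eta> \<le> Q \<rho> lam L x g \<eta>"
  unfolding Q_def off_mass_def[symmetric]
  using off_mass_pos[OF assms(1), of x] same_off_subset[of L x \<eta>] assms(2)
  by (intro divide_right_mono sum_mono mult_left_mono) (auto intro!: less_imp_le[OF equil_pos])

sublocale rev_chain "Omega L" "equil \<rho> lam L" rate "real (L - 1)" "gen \<rho> lam L"
proof
  show "0 \<le> rate \<eta> \<xi>" if "\<eta> \<in> Omega L" "\<xi> \<in> Omega L" for \<eta> \<xi>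
    unfolding rate_def using that
    by (auto intro!: sum_nonneg divide_nonneg_nonneg intro: less_imp_le[OF equil_pos] less_imp_le[OF off_mass_pos])
  show "(\<Sum>\<xi>\<in>Omega L. rate \<eta> \<xi>) = real (L - 1)" if "\<eta> \<in> Omega L" for \<eta>
  proof -
    have "(\<Sum>\<xi>\<in>Omega L. rate \<eta> \<xi>) = (\<Sum>x\<in>{1..<L}. Q \<rho> lam L x (\<lambda>_. 1) \<eta>)"
      using rate_sum[of \<eta> "\<lambda>_. 1"] by simp
    also have "\<dots> = (\<Sum>x\<in>{1..<L}. 1)"
      by (intro sum.cong refl Q_eq_const that)
    finally show ?thesis by simp
  qed
  show "equil \<rho> lam L \<eta> * rate \<eta> \<xi> = equil \<rho> lam L \<xi> * rate \<xi> \<eta>" if "\<eta> \<in> Omega L" "\<xi> \<in> Omega L" for \<eta> \<xi>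
    unfolding rate_def sum_distrib_left
  proof (rule sum.cong[OF refl])
    fix x
    have "off_mass x \<eta> = off_mass x \<xi>" if "\<xi> \<in> same_off L x \<eta>"
      using same_off_sym(2)[OF \<open>\<eta> \<in> Omega L\<close> that] by (simp add: off_mass_def)
    moreover have "\<eta> \<in> same_off L x \<xi> \<longleftrightarrow> \<xi> \<in> same_off L x \<eta>"
      using same_off_sym(1) that by blast
    ultimately show "equil \<rho> lam L \<eta> * (if \<xi> \<in> same_off L x \<eta> then equil \<rho> lam L \<xi> / off_mass x \<eta> else 0)
      = equil \<rho> lam L \<xi> * (if \<eta> \<in> same_off L x \<xi> then equil \<rho> lam L \<eta> / off_mass x \<xi> else 0)" by simp
  qed
  show "gen \<rho> lam L f \<eta> = (\<Sum>\<xi>\<in>Omega L. rate \<eta> \<xi> * f \<xi>) - real (L - 1) * f \<eta>" for f \<eta>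
    unfolding rate_sum by (simp add: gen_def sum_subtractf)
qed (auto intro: equil_pos equil_sum)

lemma P_eq_semigroup: "P t f \<sigma> = semigroup \<rho> lam L t f \<sigma>"
  by (simp add: P_def semigroup_def)

lemma E_eq_dirichlet: "E f = dirichlet \<rho> lam L f"
  by (simp add: E_def ip_def dirichlet_def expect_def mult_ac)

lemma Q_config:
  assumes S: "S \<subseteq> I" and x: "x \<in> I"
  shows "Q \<rho> lam L x f (config L S)
    = (w lam 0 L (insert x S) * f (config L (insert x S)) + w lam 0 L (S - {x}) * f (config L (S - {x})))
      / (w lam 0 L (insert x S) + w lam 0 L (S - {x}))"
proof -
  have sub: "insert x S \<subseteq> I" "S - {x} \<subseteq> I" using S x by auto
  have "config L (insert x S) x \<noteq> config L (S - {x}) x" using x by (auto simp: config_def)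
  then have ne: "config L (insert x S) \<noteq> config L (S - {x})" by auto
  show ?thesis
    using ne Zp_pos unfolding Q_def same_off_config[OF S x]
    by (simp add: equil_config[OF sub(1)] equil_config[OF sub(2)] flip: add_divide_distrib)
qed

text \<open>The right-hand side is the variance of a two-point law multiplied by its mass, that is,
  \<open>w0 / (w1 + w0) * (w1 * (F1 - F0)^2)\<close>, and \<open>w1 <= 4 * w0\<close> bounds the
  first factor below by \<open>1 / 5\<close>.\<close>

lemma heat_bath_variance:
  fixes w1 w0 F1 F0 :: real
  assumes "0 < w1" "0 < w0" "w1 \<le> 4 * w0"
  defines "q \<equiv> (w1 * F1 + w0 * F0) / (w1 + w0)"
  shows "w1 * (F1 - F0)\<^sup>2 / 5 \<le> w1 * (F1 * (F1 - q)) + w0 * (F0 * (F0 - q))"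
proof -
  have "F1 - q = w0 * (F1 - F0) / (w1 + w0)" "F0 - q = - (w1 * (F1 - F0) / (w1 + w0))"
    using assms(1,2) unfolding q_def by (simp_all add: field_simps)
  then have "w1 * (F1 * (F1 - q)) + w0 * (F0 * (F0 - q))
      = (w1 * F1 * w0 * (F1 - F0) - w0 * F0 * w1 * (F1 - F0)) / (w1 + w0)"
    by (simp add: diff_divide_distrib mult.assoc)
  also have "\<dots> = w0 / (w1 + w0) * (w1 * (F1 - F0)\<^sup>2)"
    by (simp add: power2_eq_square algebra_simps add_divide_distrib diff_divide_distrib)
  finally have "w1 * (F1 * (F1 - q)) + w0 * (F0 * (F0 - q)) = w0 / (w1 + w0) * (w1 * (F1 - F0)\<^sup>2)" .
  moreover have "1 / 5 \<le> w0 / (w1 + w0)" using assms by (simp add: field_simps)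
  then have "1 / 5 * (w1 * (F1 - F0)\<^sup>2) \<le> w0 / (w1 + w0) * (w1 * (F1 - F0)\<^sup>2)"
    using assms(1) by (intro mult_right_mono) auto
  ultimately show ?thesis by simp
qed

text \<open>For each \<open>x\<close> the Dirichlet form splits into pairs \<open>S\<close>,
  \<open>S - {x}\<close>, on each of which it is the two-point variance above. \<open>Zp\<close>
  restores the normalisation that \<open>removal_form\<close> leaves out.\<close>

lemma E_ge: "removal_form lam L I (\<lambda>S. f (config L S)) \<le> 5 * Zp * E f"
proof -
  let ?F = "\<lambda>S. f (config L S)"
  define h where "h x S = w lam 0 L S * (?F S * (?F S - Q \<rho> lam L x f (config L S)))" for x S
  have "Zp * E f = (\<Sum>\<eta>\<in>Omega L. Zp * equil \<rho> lam L \<eta> * (f \<eta> * (\<Sum>x\<in>{1..<L}. f \<eta> - Q \<rho> lam L x f \<eta>)))"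
    unfolding E_def ip_def gen_def
    by (simp add: sum_subtractf sum_distrib_left algebra_simps flip: sum_negf)
  also have "\<dots> = (\<Sum>S\<in>Pow I. \<Sum>x\<in>{1..<L}. h x S)"
    unfolding sum_Omega
  proof (rule sum.cong[OF refl])
    fix S assume "S \<in> Pow I"
    then have "Zp * equil \<rho> lam L (config L S) = w lam 0 L S"
      using Zp_pos by (simp add: equil_config)
    then show "Zp * equil \<rho> lam L (config L S) * (?F S * (\<Sum>x\<in>{1..<L}. ?F S - Q \<rho> lam L x f (config L S))) = (\<Sum>x\<in>{1..<L}. h x S)"
      by (simp only: h_def sum_distrib_left)
  qed
  also have "\<dots> = (\<Sum>x\<in>I. \<Sum>S\<in>Pow I. h x S)"
    by (subst sum.swap) (simp add: atLeastSucLessThan_greaterThanLessThan)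
  also have "\<dots> \<ge> (\<Sum>x\<in>I. \<Sum>S\<in>Pow I. if x \<in> S then w lam 0 L S * (?F S - ?F (S - {x}))\<^sup>2 / 5 else 0)"
  proof (rule sum_mono)
    fix x assume x: "x \<in> I"
    have "(if x \<in> S then w lam 0 L S * (?F S - ?F (S - {x}))\<^sup>2 / 5 else 0)
      \<le> (if x \<in> S then h x S + h x (S - {x}) else 0)" if S: "S \<in> Pow I" for S
    proof (cases "x \<in> S")
      case True
      have "Q \<rho> lam L x f (config L S) = (w lam 0 L S * ?F S + w lam 0 L (S - {x}) * ?F (S - {x}))
          / (w lam 0 L S + w lam 0 L (S - {x}))"
        using Q_config[of S x f] S x True by (simp add: insert_absorb)
      moreover have "Q \<rho> lam L x f (config L (S - {x})) = (w lam 0 L S * ?F S + w lam 0 L (S - {x}) * ?F (S - {x}))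
          / (w lam 0 L S + w lam 0 L (S - {x}))"
        using Q_config[of "S - {x}" x f] S x True by (auto simp: insert_absorb)
      moreover have "w lam 0 L S \<le> 4 * w lam 0 L (S - {x})"
        using w_remove[of lam x L S] lam x True by simp
      ultimately show ?thesis
        using True heat_bath_variance[of "w lam 0 L S" "w lam 0 L (S - {x})" "?F S" "?F (S - {x})"] lam L
        by (simp add: h_def w_pos)
    qed simp
    then have "(\<Sum>S\<in>Pow I. if x \<in> S then w lam 0 L S * (?F S - ?F (S - {x}))\<^sup>2 / 5 else 0)
      \<le> (\<Sum>S\<in>Pow I. if x \<in> S then h x S + h x (S - {x}) else 0)"
      by (intro sum_mono)
    also have "\<dots> = (\<Sum>S\<in>Pow I. h x S)"
      using x by (intro sum_Pow_pair[symmetric]) auto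
    finally show "(\<Sum>S\<in>Pow I. if x \<in> S then w lam 0 L S * (?F S - ?F (S - {x}))\<^sup>2 / 5 else 0) \<le> (\<Sum>S\<in>Pow I. h x S)" .
  qed
  also have "(\<Sum>x\<in>I. \<Sum>S\<in>Pow I. if x \<in> S then w lam 0 L S * (?F S - ?F (S - {x}))\<^sup>2 / 5 else 0)
    = removal_form lam L I ?F / 5"
    unfolding removal_form_def sum_divide_distrib by (intro sum.cong refl) simp
  finally show ?thesis by simp
qed

lemma sum_equil: "(\<Sum>\<eta>\<in>Omega L. equil \<rho> lam L \<eta> * h \<eta>) = (\<Sum>S\<in>Pow I. w lam 0 L S * h (config L S)) / Zp"
  unfolding sum_Omega sum_divide_distrib by (intro sum.cong refl) (simp add: equil_config)

lemma second_moment: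
  "(\<Sum>\<eta>\<in>Omega L. equil \<rho> lam L \<eta> * (f \<eta> - a)\<^sup>2)
    = ip f f - 2 * a * (\<Sum>\<eta>\<in>Omega L. equil \<rho> lam L \<eta> * f \<eta>) + a\<^sup>2"
proof -
  have "(\<Sum>\<eta>\<in>Omega L. equil \<rho> lam L \<eta> * (f \<eta> - a)\<^sup>2)
    = ip f f - 2 * a * (\<Sum>\<eta>\<in>Omega L. equil \<rho> lam L \<eta> * f \<eta>) + a\<^sup>2 * (\<Sum>\<eta>\<in>Omega L. equil \<rho> lam L \<eta>)"
    unfolding ip_def
    by (simp add: power2_diff power2_eq_square algebra_simps sum.distrib sum_subtractf sum_distrib_left)
  then show ?thesis by (simp add: equil_sum)
qed

text \<open>The variance is at most the second moment about the value \<open>a\<close> at the empty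
  configuration, and emptying the whole interior is the path bound for the block
  \<open>I\<close>.\<close>

lemma poincare:
  assumes R: "0 < R" "\<And>F. (\<Sum>S\<in>Pow I. w lam 0 L S * (F S - F (S - I))\<^sup>2) \<le> R * removal_form lam L I F"
  shows "ip f f - (\<Sum>\<eta>\<in>Omega L. equil \<rho> lam L \<eta> * f \<eta>)\<^sup>2 \<le> 5 * R * E f"
proof -
  define a where "a = f (config L {})"
  define \<mu> where "\<mu> = (\<Sum>\<eta>\<in>Omega L. equil \<rho> lam L \<eta> * f \<eta>)"
  have "(\<Sum>\<eta>\<in>Omega L. equil \<rho> lam L \<eta> * (f \<eta> - a)\<^sup>2) = ip f f - \<mu>\<^sup>2 + (\<mu> - a)\<^sup>2"
    unfolding second_moment \<mu>_def[symmetric] by (simp add: power2_eq_square algebra_simps)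
  then have "ip f f - \<mu>\<^sup>2 \<le> (\<Sum>\<eta>\<in>Omega L. equil \<rho> lam L \<eta> * (f \<eta> - a)\<^sup>2)" by simp
  also have "\<dots> = (\<Sum>S\<in>Pow I. w lam 0 L S * (f (config L S) - f (config L (S - I)))\<^sup>2) / Zp"
    unfolding sum_equil a_def
  proof (intro arg_cong[where f = "\<lambda>u. u / Zp"] sum.cong refl)
    fix S assume "S \<in> Pow I"
    then have "S - I = {}" by auto
    then show "w lam 0 L S * (f (config L S) - f (config L {}))\<^sup>2 = w lam 0 L S * (f (config L S) - f (config L (S - I)))\<^sup>2"
      by (simp only:)
  qed
  also have "\<dots> \<le> R * removal_form lam L I (\<lambda>S. f (config L S)) / Zp"
    using Zp_pos R(2)[of "\<lambda>S. f (config L S)"] by (simp add: divide_right_mono)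
  also have "\<dots> \<le> R * (5 * Zp * E f) / Zp"
    using Zp_pos R(1) E_ge[of f] by (intro divide_right_mono mult_left_mono) auto
  also have "\<dots> = 5 * R * E f" using Zp_pos by simp
  finally show ?thesis by (simp add: \<mu>_def)
qed

lemma particle_form:
  assumes A: "0 < A" and FI: "\<And>F. (\<Sum>S\<in>Pow I. w lam 0 L S * real (card S) * (F S)\<^sup>2)
      \<le> A * removal_form lam L I F + B * (\<Sum>S\<in>Pow I. w lam 0 L S * (F S)\<^sup>2)"
  shows "(\<Sum>\<eta>\<in>Omega L. equil \<rho> lam L \<eta> * real (num_particles L \<eta>) * (f \<eta>)\<^sup>2) \<le> 5 * A * E f + B * ip f f"
proof -
  let ?F = "\<lambda>S. f (config L S)"
  have "(\<Sum>\<eta>\<in>Omega L. equil \<rho> lam L \<eta> * real (num_particles L \<eta>) * (f \<eta>)\<^sup>2)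
    = (\<Sum>\<eta>\<in>Omega L. equil \<rho> lam L \<eta> * (real (num_particles L \<eta>) * (f \<eta>)\<^sup>2))"
    by (simp add: mult.assoc)
  also have "\<dots> = (\<Sum>S\<in>Pow I. w lam 0 L S * real (card S) * (?F S)\<^sup>2) / Zp"
    unfolding sum_equil
    by (intro arg_cong[where f = "\<lambda>u. u / Zp"] sum.cong refl) (simp add: num_particles_config)
  also have "\<dots> \<le> (A * removal_form lam L I ?F + B * (\<Sum>S\<in>Pow I. w lam 0 L S * (?F S)\<^sup>2)) / Zp"
    using Zp_pos by (intro divide_right_mono FI) auto
  also have "\<dots> \<le> (A * (5 * Zp * E f) + B * (\<Sum>S\<in>Pow I. w lam 0 L S * (?F S)\<^sup>2)) / Zp"
    using Zp_pos A E_ge[of f] by (intro divide_right_mono add_right_mono mult_left_mono) auto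
  also have "\<dots> = 5 * A * E f + B * ((\<Sum>S\<in>Pow I. w lam 0 L S * (?F S)\<^sup>2) / Zp)"
    using Zp_pos by (simp add: field_simps)
  also have "(\<Sum>S\<in>Pow I. w lam 0 L S * (?F S)\<^sup>2) / Zp = ip f f"
    using sum_equil[of "\<lambda>\<eta>. (f \<eta>)\<^sup>2"] by (simp add: ip_def power2_eq_square mult.assoc)
  finally show ?thesis .
qed

lemma variance_eq:
  "variance \<rho> lam L f = ip f f - (\<Sum>\<eta>\<in>Omega L. equil \<rho> lam L \<eta> * f \<eta>)\<^sup>2"
proof -
  define \<mu> where "\<mu> = (\<Sum>\<eta>\<in>Omega L. equil \<rho> lam L \<eta> * f \<eta>)"
  have "variance \<rho> lam L f = (\<Sum>\<eta>\<in>Omega L. equil \<rho> lam L \<eta> * (f \<eta> - \<mu>)\<^sup>2)"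
    by (simp add: variance_def expect_def \<mu>_def)
  then show ?thesis
    unfolding second_moment \<mu>_def[symmetric] by (simp add: power2_eq_square)
qed

lemma variance_pos:
  fixes f :: "(nat \<Rightarrow> nat) \<Rightarrow> real"
  assumes "\<not> f constant_on Omega L"
  shows "0 < variance \<rho> lam L f"
proof (rule ccontr)
  define \<mu> where "\<mu> = expect \<rho> lam L f"
  assume "\<not> 0 < variance \<rho> lam L f"
  then have "(\<Sum>\<eta>\<in>Omega L. equil \<rho> lam L \<eta> * (f \<eta> - \<mu>)\<^sup>2) \<le> 0"
    by (simp add: variance_def expect_def \<mu>_def)
  moreover have nn: "0 \<le> equil \<rho> lam L \<eta> * (f \<eta> - \<mu>)\<^sup>2" if "\<eta> \<in> Omega L" for \<eta>
    using equil_pos[OF that] by simp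
  ultimately have "(\<Sum>\<eta>\<in>Omega L. equil \<rho> lam L \<eta> * (f \<eta> - \<mu>)\<^sup>2) = 0"
    by (intro antisym sum_nonneg)
  then have "equil \<rho> lam L \<eta> * (f \<eta> - \<mu>)\<^sup>2 = 0" if "\<eta> \<in> Omega L" for \<eta>
    using nn that by (simp add: sum_nonneg_eq_0_iff)
  then have "f \<eta> = \<mu>" if "\<eta> \<in> Omega L" for \<eta>
    using equil_pos[OF that] that by fastforce
  then show False using assms by (auto simp: constant_on_def)
qed

lemma T_rel_le:
  assumes R: "0 < R" "\<And>f. ip f f - (\<Sum>\<eta>\<in>Omega L. equil \<rho> lam L \<eta> * f \<eta>)\<^sup>2 \<le> R * E f"
  shows "T_rel \<rho> lam L \<le> ereal R"
proof -
  have "ereal (1 / R) \<le> gap \<rho> lam L"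
    unfolding gap_def
  proof (rule INF_greatest)
    fix f :: "(nat \<Rightarrow> nat) \<Rightarrow> real"
    assume "f \<in> {f. \<not> f constant_on Omega L}"
    then have v: "0 < variance \<rho> lam L f" by (simp add: variance_pos)
    have "variance \<rho> lam L f \<le> R * dirichlet \<rho> lam L f"
      using R(2)[of f] by (simp add: variance_eq E_eq_dirichlet)
    then show "ereal (1 / R) \<le> ereal (dirichlet \<rho> lam L f / variance \<rho> lam L f)"
      using v R(1) by (simp add: field_simps)
  qed
  note le = this
  have R': "0 < ereal (1 / R)" using R(1) by simp
  then have "0 < gap \<rho> lam L" using le by (rule less_le_trans)
  \<comment> \<open>Monotonicity of division on extended reals asks for a positive product of the
    denominators.\<close>
  then have "0 < gap \<rho> lam L * ereal (1 / R)" unfolding ereal_zero_less_0_iff using R' by blast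
  then have "1 / gap \<rho> lam L \<le> 1 / ereal (1 / R)"
    using le by (intro ereal_divide_left_mono) auto
  then show ?thesis using R(1) by (simp add: T_rel_def one_ereal_def)
qed

end

section \<open>Bounds on the relaxation and mixing times\<close>

lemma (in rev_chain) P_sum:
  assumes "finite A" "x \<in> X"
  shows "P t (\<lambda>x. \<Sum>i\<in>A. f i x) x = (\<Sum>i\<in>A. P t (f i) x)"
  using assms(1)
proof (induction A rule: finite_induct)
  case empty
  then show ?case using P_const[OF assms(2), of t 0] by simp
next
  case (insert j A)
  have "P t (\<lambda>x. 1 * f j x + 1 * (\<Sum>i\<in>A. f i x)) x = P t (f j) x + (\<Sum>i\<in>A. P t (f i) x)"
    unfolding P_lin[OF assms(2)] insert.IH by simp
  then show ?case using insert.hyps by simp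
qed

section \<open>Emptiness of a set as an observable, and bounds on the mixing time\<close>

context polymer
begin

definition avoid :: "nat set \<Rightarrow> (nat \<Rightarrow> nat) \<Rightarrow> real" where
  "avoid A \<eta> = (if \<forall>x\<in>A. \<eta> x = 0 then 1 else 0)"

text \<open>A ring outside \<open>A\<close> does not change the indicator. A ring at
  \<open>x\<close> in \<open>A\<close> at best empties \<open>x\<close>, which replaces
  \<open>avoid A\<close> by at most \<open>avoid (A - {x})\<close>.\<close>

lemma gen_avoid:
  assumes A: "A \<subseteq> I" and \<eta>: "\<eta> \<in> Omega L"
  shows "gen \<rho> lam L (avoid A) \<eta> \<le> (\<Sum>x\<in>A. avoid (A - {x}) \<eta>) - real (card A) * avoid A \<eta>"
proof -
  have off: "\<xi> y = \<eta> y" if "\<xi> \<in> same_off L x \<eta>" "y \<noteq> x" "y \<in> A" for \<xi> x y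
    using that A by (auto simp: same_off_def)
  have fA: "finite A" using A finite_subset by blast
  have "gen \<rho> lam L (avoid A) \<eta> \<le> (\<Sum>x\<in>{1..<L}. if x \<in> A then avoid (A - {x}) \<eta> - avoid A \<eta> else 0)"
    unfolding gen_def
  proof (rule sum_mono)
    fix x
    show "Q \<rho> lam L x (avoid A) \<eta> - avoid A \<eta> \<le> (if x \<in> A then avoid (A - {x}) \<eta> - avoid A \<eta> else 0)"
    proof (cases "x \<in> A")
      case True
      have "Q \<rho> lam L x (avoid A) \<eta> \<le> Q \<rho> lam L x (avoid (A - {x})) \<eta>"
        by (intro Q_mono \<eta>) (auto simp: avoid_def)
      also have "\<dots> = avoid (A - {x}) \<eta>"
        by (intro Q_eq_const \<eta>) (auto simp: avoid_def off)
      finally show ?thesis using True by simp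
    next
      case False
      have "Q \<rho> lam L x (avoid A) \<eta> = avoid A \<eta>"
      proof (intro Q_eq_const \<eta>)
        fix \<xi> assume \<xi>: "\<xi> \<in> same_off L x \<eta>"
        have "\<xi> y = \<eta> y" if "y \<in> A" for y using off[OF \<xi>, of y] that False by blast
        then show "avoid A \<xi> = avoid A \<eta>" by (simp add: avoid_def)
      qed
      then show ?thesis using False by simp
    qed
  qed
  also have "\<dots> = (\<Sum>x\<in>A. avoid (A - {x}) \<eta> - avoid A \<eta>)"
    using A fA by (intro sum.mono_neutral_cong_right) auto
  finally show ?thesis using fA by (simp add: sum_subtractf)
qed

text \<open>The bound is attained when particles are only ever removed, each at rate one.\<close>

lemma avoid_le:
  assumes A: "A \<subseteq> I" and t: "0 \<le> t"
  shows "P t (avoid A) (config L I) \<le> (1 - exp (- t)) ^ card A"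
  using A t
proof (induction "card A" arbitrary: A t)
  case 0
  then have "A = {}" using finite_subset by fastforce
  then have "avoid A = (\<lambda>_. 1)" by (auto simp: avoid_def)
  then show ?case using \<open>A = {}\<close> by (simp add: P_const config_Omega)
next
  case (Suc n)
  let ?\<sigma> = "config L I"
  have fA: "finite A" using Suc finite_subset by blast
  have c: "card A = Suc n" using Suc by simp
  define u where "u s = P s (avoid A) ?\<sigma>" for s
  define v where "v s = (1 - exp (- s)) ^ card A" for s :: real
  \<comment> \<open>\<open>v\<close> solves with equality the equation for which \<open>ineq\<close>
    gives an inequality for \<open>u\<close>; the exponential is the integrating factor for the
    difference.\<close>
  define D where "D s = (u s - v s) * exp (real (card A) * s)" for s
  have ineq: "gen \<rho> lam L (P s (avoid A)) ?\<sigma> \<le> real (card A) * ((1 - exp (- s)) ^ n - u s)" if s: "0 \<le> s" for s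
  proof -
    have "gen \<rho> lam L (P s (avoid A)) ?\<sigma> = P s (gen \<rho> lam L (avoid A)) ?\<sigma>"
      by (rule P_G[symmetric]) (rule config_Omega)
    also have "\<dots> \<le> P s (\<lambda>\<eta>. 1 * (\<Sum>x\<in>A. avoid (A - {x}) \<eta>) + (- real (card A)) * avoid A \<eta>) ?\<sigma>"
      using gen_avoid[OF Suc.prems(1)] s by (intro P_mono config_Omega) simp_all
    also have "\<dots> = (\<Sum>x\<in>A. P s (avoid (A - {x})) ?\<sigma>) - real (card A) * u s"
      unfolding P_lin[OF config_Omega] P_sum[OF fA config_Omega] u_def by simp
    also have "(\<Sum>x\<in>A. P s (avoid (A - {x})) ?\<sigma>) \<le> (\<Sum>x\<in>A. (1 - exp (- s)) ^ n)"
    proof (rule sum_mono)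
      fix x assume "x \<in> A"
      then have cx: "card (A - {x}) = n" using c fA by simp
      show "P s (avoid (A - {x})) ?\<sigma> \<le> (1 - exp (- s)) ^ n"
        using Suc.hyps(1)[of "A - {x}" s] cx Suc.prems(1) s by auto
    qed
    finally show ?thesis by (simp add: algebra_simps)
  qed
  have "D t \<le> D 0"
  proof (rule DERIV_nonpos_imp_nonincreasing[OF Suc.prems(2)])
    fix s :: real assume s: "0 \<le> s"
    have u': "(u has_real_derivative gen \<rho> lam L (P s (avoid A)) ?\<sigma>) (at s)"
      unfolding u_def by (intro P_deriv config_Omega)
    have v': "(v has_real_derivative real (card A) * ((1 - exp (- s)) ^ n - v s)) (at s)"
    proof -
      have "((\<lambda>s. 1 - exp (- s)) has_real_derivative exp (- s)) (at s)"
        by (auto intro!: derivative_eq_intros)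
      then have "(v has_real_derivative (1 + real n) * (exp (- s) * (1 - exp (- s)) ^ n)) (at s)"
        unfolding v_def c by (rule DERIV_power_Suc)
      also have "(1 + real n) * (exp (- s) * (1 - exp (- s)) ^ n) = real (card A) * ((1 - exp (- s)) ^ n - v s)"
        by (simp add: v_def c algebra_simps)
      finally show ?thesis .
    qed
    have "(D has_real_derivative (gen \<rho> lam L (P s (avoid A)) ?\<sigma> - real (card A) * ((1 - exp (- s)) ^ n - u s))
        * exp (real (card A) * s)) (at s)"
      unfolding D_def by (auto intro!: derivative_eq_intros u' v' simp: algebra_simps)
    moreover have "(gen \<rho> lam L (P s (avoid A)) ?\<sigma> - real (card A) * ((1 - exp (- s)) ^ n - u s))
        * exp (real (card A) * s) \<le> 0"
      using ineq[OF s] by (intro mult_nonpos_nonneg) auto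
    ultimately show "\<exists>y. (D has_real_derivative y) (at s) \<and> y \<le> 0" by blast
  qed
  also have "D 0 = 0"
  proof -
    obtain x where x: "x \<in> A" using c by fastforce
    then have "?\<sigma> x = 1" using Suc.prems(1) by (auto simp: config_def)
    then have "\<not> (\<forall>x\<in>A. ?\<sigma> x = 0)" using x by (metis zero_neq_one)
    then have "avoid A ?\<sigma> = 0" unfolding avoid_def by (rule if_not_P)
    then show ?thesis by (simp add: D_def u_def v_def c)
  qed
  finally have "u t \<le> v t" by (simp add: D_def mult_le_0_iff)
  then show ?case by (simp add: u_def v_def)
qed

text \<open>A union bound over the sites of \<open>A\<close>, each occupied with the probability
  from \<open>part_fun_through_le\<close> on the whole box; \<open>K \<rho> L <= Zp\<close>
  normalises it.\<close>

lemma equil_avoid_ge: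
  assumes C: "C \<ge> 1" "\<And>a b. a < b \<Longrightarrow> part_fun lam a b \<le> C * K \<rho> (b - a)" and A: "A \<subseteq> I"
  shows "1 - 4 * C\<^sup>2 * (\<Sum>x\<in>A. K \<rho> x + K \<rho> (L - x)) \<le> (\<Sum>\<eta>\<in>Omega L. equil \<rho> lam L \<eta> * avoid A \<eta>)"
proof -
  have fA: "finite A" using A finite_subset by blast
  have "(\<Sum>\<eta>\<in>Omega L. equil \<rho> lam L \<eta> * (1 - avoid A \<eta>))
    = (\<Sum>S\<in>Pow I. w lam 0 L S * (1 - avoid A (config L S))) / Zp" by (rule sum_equil)
  also have "\<dots> \<le> (\<Sum>S\<in>Pow I. \<Sum>x\<in>A. if x \<in> S then w lam 0 L S else 0) / Zp"
  proof (intro divide_right_mono sum_mono)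
    fix S assume "S \<in> Pow I"
    show "w lam 0 L S * (1 - avoid A (config L S)) \<le> (\<Sum>x\<in>A. if x \<in> S then w lam 0 L S else 0)"
    proof (cases "\<forall>x\<in>A. config L S x = 0")
      case True
      then show ?thesis using lam by (simp add: avoid_def sum_nonneg w_nonneg)
    next
      case False
      then obtain x where x: "x \<in> A" "x \<in> S" using A by (auto simp: config_def split: if_splits)
      have "(if x \<in> S then w lam 0 L S else 0) \<le> (\<Sum>x\<in>A. if x \<in> S then w lam 0 L S else 0)"
        using fA x lam by (intro member_le_sum) (auto simp: w_nonneg)
      moreover have "avoid A (config L S) = 0" using False by (auto simp: avoid_def)
      ultimately show ?thesis using x by simp
    qed
  qed (use Zp_pos in simp)
  also have "\<dots> = (\<Sum>x\<in>A. \<Sum>S\<in>Pow I. if x \<in> S then w lam 0 L S else 0) / Zp"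
    by (subst sum.swap) (rule refl)
  also have "\<dots> \<le> (\<Sum>x\<in>A. 4 * C\<^sup>2 * Zp * (K \<rho> x + K \<rho> (L - x))) / Zp"
  proof (intro divide_right_mono sum_mono)
    fix x assume x: "x \<in> A"
    have "(\<Sum>S\<in>Pow I. if x \<in> S then w lam 0 L S else 0)
       \<le> 4 * C\<^sup>2 * K \<rho> (L - 0) * (K \<rho> (x - 0) + K \<rho> (L - x))"
      using x A by (intro part_fun_through_le lam C) auto
    also have "\<dots> \<le> 4 * C\<^sup>2 * Zp * (K \<rho> x + K \<rho> (L - x))"
      using K_le_Zp by (auto intro!: mult_right_mono mult_left_mono)
    finally show "(\<Sum>S\<in>Pow I. if x \<in> S then w lam 0 L S else 0) \<le> 4 * C\<^sup>2 * Zp * (K \<rho> x + K \<rho> (L - x))" .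
  qed (use Zp_pos in simp)
  also have "\<dots> = 4 * C\<^sup>2 * (\<Sum>x\<in>A. K \<rho> x + K \<rho> (L - x))"
    using Zp_pos by (simp add: sum_distrib_left sum_divide_distrib mult.assoc)
  finally show ?thesis
    by (simp add: right_diff_distrib sum_subtractf equil_sum)
qed

text \<open>The indicator is bounded by one in absolute value without being centred, which costs a
  factor two against the usual bound by events. The later margin of \<open>2 / 5\<close> allows for
  this.\<close>

lemma tv_ge:
  assumes \<sigma>: "\<sigma> \<in> Omega L"
  shows "((\<Sum>\<eta>\<in>Omega L. equil \<rho> lam L \<eta> * avoid A \<eta>) - P t (avoid A) \<sigma>) / 2
    \<le> tv_dist L (law \<rho> lam L t \<sigma>) (equil \<rho> lam L)"
proof -
  have "P t (avoid A) \<sigma> = P t (\<lambda>\<xi>. \<Sum>\<eta>\<in>Omega L. avoid A \<eta> * indicator {\<eta>} \<xi>) \<sigma>"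
  proof (intro P_cong \<sigma>)
    fix \<xi> assume "\<xi> \<in> Omega L"
    then have "(\<Sum>\<eta>\<in>Omega L. avoid A \<eta> * indicator {\<eta>} \<xi>) = (\<Sum>\<eta>\<in>Omega L. if \<eta> = \<xi> then avoid A \<eta> else 0)"
      by (intro sum.cong refl) auto
    then show "avoid A \<xi> = (\<Sum>\<eta>\<in>Omega L. avoid A \<eta> * indicator {\<eta>} \<xi>)"
      using \<open>\<xi> \<in> Omega L\<close> by simp
  qed
  also have "\<dots> = (\<Sum>\<eta>\<in>Omega L. P t (\<lambda>\<xi>. avoid A \<eta> * indicator {\<eta>} \<xi>) \<sigma>)"
    by (intro P_sum \<sigma> finite_Omega)
  also have "\<dots> = (\<Sum>\<eta>\<in>Omega L. law \<rho> lam L t \<sigma> \<eta> * avoid A \<eta>)"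
  proof (intro sum.cong refl)
    fix \<eta>
    have "P t (\<lambda>\<xi>. avoid A \<eta> * indicator {\<eta>} \<xi> + 0 * indicator {\<eta>} \<xi>) \<sigma> = avoid A \<eta> * P t (indicator {\<eta>}) \<sigma>"
      unfolding P_lin[OF \<sigma>] by simp
    then show "P t (\<lambda>\<xi>. avoid A \<eta> * indicator {\<eta>} \<xi>) \<sigma> = law \<rho> lam L t \<sigma> \<eta> * avoid A \<eta>"
      by (simp add: law_def P_eq_semigroup)
  qed
  finally have "(\<Sum>\<eta>\<in>Omega L. equil \<rho> lam L \<eta> * avoid A \<eta>) - P t (avoid A) \<sigma>
    = (\<Sum>\<eta>\<in>Omega L. (equil \<rho> lam L \<eta> - law \<rho> lam L t \<sigma> \<eta>) * avoid A \<eta>)"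
    by (simp add: left_diff_distrib sum_subtractf)
  also have "\<dots> \<le> (\<Sum>\<eta>\<in>Omega L. \<bar>law \<rho> lam L t \<sigma> \<eta> - equil \<rho> lam L \<eta>\<bar>)"
    by (intro sum_mono) (auto simp: avoid_def)
  finally show ?thesis by (simp add: tv_dist_def)
qed

lemma T_mix_le:
  assumes "0 \<le> t" "\<And>\<sigma>. \<sigma> \<in> Omega L \<Longrightarrow> tv_dist L (law \<rho> lam L t \<sigma>) (equil \<rho> lam L) \<le> 1 / (2 * exp 1)"
  shows "T_mix \<rho> lam L \<le> ereal t"
proof -
  have "(SUP \<sigma>\<in>Omega L. tv_dist L (law \<rho> lam L t \<sigma>) (equil \<rho> lam L)) \<le> 1 / (2 * exp 1)"
    using assms(2) config_Omega by (intro cSUP_least) auto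
  then show ?thesis
    unfolding T_mix_def using assms(1) by (intro INF_lower) auto
qed

lemma T_mix_ge:
  assumes "\<And>t. 0 \<le> t \<Longrightarrow> t < r \<Longrightarrow> \<exists>\<sigma>\<in>Omega L. 1 / (2 * exp 1) < tv_dist L (law \<rho> lam L t \<sigma>) (equil \<rho> lam L)"
  shows "ereal r \<le> T_mix \<rho> lam L"
  unfolding T_mix_def
proof (rule INF_greatest)
  fix t assume "t \<in> {t. 0 \<le> t \<and> (SUP \<sigma>\<in>Omega L. tv_dist L (law \<rho> lam L t \<sigma>) (equil \<rho> lam L)) \<le> 1 / (2 * exp 1)}"
  then have t: "0 \<le> t" "(SUP \<sigma>\<in>Omega L. tv_dist L (law \<rho> lam L t \<sigma>) (equil \<rho> lam L)) \<le> 1 / (2 * exp 1)" by auto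
  have "tv_dist L (law \<rho> lam L t \<sigma>) (equil \<rho> lam L) \<le> 1 / (2 * exp 1)" if "\<sigma> \<in> Omega L" for \<sigma>
  proof -
    \<comment> \<open>On the reals a supremum bounds its members only for a bounded family; here the
      family is finite.\<close>
    have "bdd_above ((\<lambda>\<sigma>. tv_dist L (law \<rho> lam L t \<sigma>) (equil \<rho> lam L)) ` Omega L)"
      by (intro bdd_above_finite finite_imageI finite_Omega)
    then show ?thesis by (rule order_trans[OF cSUP_upper[OF that] t(2)])
  qed
  then have "\<not> t < r" using assms[OF t(1)] by force
  then show "ereal r \<le> ereal t" by simp
qed

text \<open>Each of the \<open>N + 1\<close> gaps has weight at least of order
  \<open>1 / L^2\<close> by the lower bound on \<open>K\<close>, and \<open>Zp <= C\<close>. Since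
  \<open>L >= 2\<close>, a constant is at most itself over \<open>ln 2\<close> times
  \<open>ln L\<close>, which explains the form of \<open>D\<close>.\<close>

lemma equil_lower:
  assumes c0: "0 < c0" "\<And>m. 1 \<le> m \<Longrightarrow> c0 / (real m)\<^sup>2 \<le> K \<rho> m"
    and C: "C \<ge> 1" "\<And>a b. a < b \<Longrightarrow> part_fun lam a b \<le> C * K \<rho> (b - a)"
    and D: "D = 2 + \<bar>ln (lam * c0 / C)\<bar> / ln 2"
    and \<eta>: "\<eta> \<in> Omega L"
  shows "exp (- (D * ln (real L) * (real (num_particles L \<eta>) + 1))) \<le> equil \<rho> lam L \<eta>"
proof -
  obtain S where S: "S \<subseteq> I" "\<eta> = config L S" using \<eta> by (rule Omega_cases)
  let ?n = "card S"
  define e where "e = lam * c0 / C"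
  have e: "0 < e" using lam c0 C by (simp add: e_def)
  have SI: "S \<inter> I = S" using S by auto
  have L0: "0 < real L" "0 < ln (real L)" "ln 2 \<le> ln (real L)" using L by auto
  have "\<bar>ln e\<bar> * ln 2 \<le> \<bar>ln e\<bar> * ln (real L)"
    using L0 by (intro mult_left_mono) auto
  then have "\<bar>ln e\<bar> \<le> \<bar>ln e\<bar> / ln 2 * ln (real L)"
    by (simp add: field_simps)
  then have "- (D * ln (real L)) \<le> ln e - 2 * ln (real L)"
    unfolding D e_def[symmetric] by (simp add: algebra_simps)
  then have "exp (- (D * ln (real L))) \<le> exp (ln e - 2 * ln (real L))" by simp
  also have "\<dots> = e / (real L)\<^sup>2"
    using e L0 by (simp add: exp_diff exp_double)
  finally have "exp (- (D * ln (real L))) ^ Suc ?n \<le> (e / (real L)\<^sup>2) ^ Suc ?n"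
    by (intro power_mono) auto
  also have "\<dots> = (lam * (c0 / (real L)\<^sup>2)) ^ Suc ?n / C ^ Suc ?n"
    by (simp add: e_def power_divide power_mult_distrib field_simps)
  also have "\<dots> \<le> (lam * (c0 / (real L)\<^sup>2)) ^ Suc ?n / C"
    using C lam c0 self_le_power[of C "Suc ?n"] by (intro divide_left_mono) auto
  also have "\<dots> \<le> w lam 0 L S / C"
  proof (intro divide_right_mono)
    have "(lam * (c0 / (real L)\<^sup>2)) ^ Suc (card (S \<inter> I)) \<le> w lam 0 L S"
    proof (rule w_lower)
      fix j assume j: "1 \<le> j" "j \<le> L"
      have "c0 / (real L)\<^sup>2 \<le> c0 / (real j)\<^sup>2"
        using c0 j by (intro divide_left_mono power_mono) auto
      also have "\<dots> \<le> K \<rho> j" using c0(2) j by simp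
      finally show "c0 / (real L)\<^sup>2 \<le> K \<rho> j" .
    qed (use lam c0 L in auto)
    then show "(lam * (c0 / (real L)\<^sup>2)) ^ Suc ?n \<le> w lam 0 L S" by (simp add: SI)
  qed (use C in auto)
  also have "\<dots> \<le> w lam 0 L S / Zp"
  proof -
    have "Zp \<le> C * K \<rho> (L - 0)" unfolding Zp_def using L by (intro C) auto
    also have "\<dots> \<le> C * 1" using C by (intro mult_left_mono K_le_1) auto
    finally show ?thesis using Zp_pos C lam by (intro divide_left_mono) (auto simp: w_nonneg)
  qed
  also have "\<dots> = equil \<rho> lam L \<eta>" using S by (simp add: equil_config)
  also have "exp (- (D * ln (real L))) ^ Suc ?n = exp (- (D * ln (real L) * (real (num_particles L \<eta>) + 1)))"
    unfolding exp_of_nat_mult[symmetric] using S by (simp add: num_particles_config algebra_simps)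
  finally show ?thesis .
qed

end

section \<open>Constants uniform in the length of the box\<close>

context renewal
begin

lemma relaxation_bound:
  assumes lam: "0 < lam" "lam < 1"
  shows "\<exists>R>0. \<forall>L\<ge>2. T_rel \<rho> lam L \<le> ereal R"
proof -
  obtain R where R: "R > 0" "\<And>L B F. convex_in L B \<Longrightarrow>
     (\<Sum>S\<in>Pow {0<..<L}. w lam 0 L S * (F S - F (S - B))\<^sup>2) \<le> R * removal_form lam L B F"
    using path_const[OF lam] by blast
  have "T_rel \<rho> lam L \<le> ereal (5 * R)" if L: "2 \<le> L" for L
  proof -
    interpret polymer \<rho> lam L by unfold_locales (use lam L in auto)
    show ?thesis
    proof (rule T_rel_le)
      have "convex_in L I" by (auto simp: convex_in_def)
      then show "ip f f - (\<Sum>\<eta>\<in>Omega L. equil \<rho> lam L \<eta> * f \<eta>)\<^sup>2 \<le> 5 * R * E f" for f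
        by (intro poincare R)
    qed (use R in simp)
  qed
  then show ?thesis using R(1) by (intro exI[of _ "5 * R"]) auto
qed

lemma mixing_upper:
  assumes lam: "0 < lam" "lam < 1"
  shows "\<exists>M\<ge>1. \<forall>L\<ge>2. 1 \<le> ln (real L) \<longrightarrow> T_mix \<rho> lam L \<le> ereal (M * (ln (real L))\<^sup>2)"
proof -
  obtain R where R: "R > 0" "\<And>L B F. convex_in L B \<Longrightarrow>
     (\<Sum>S\<in>Pow {0<..<L}. w lam 0 L S * (F S - F (S - B))\<^sup>2) \<le> R * removal_form lam L B F"
    using path_const[OF lam] by blast
  obtain A B where A: "A > 0" and B: "B > 0" and FI: "\<And>L F. (\<Sum>S\<in>Pow {0<..<L}. w lam 0 L S * real (card S) * (F S)\<^sup>2)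
      \<le> A * removal_form lam L {0<..<L} F + B * (\<Sum>S\<in>Pow {0<..<L}. w lam 0 L S * (F S)\<^sup>2)"
    using particle_inequality[OF lam] by blast
  obtain c0 where c0: "c0 > 0" "\<And>m. 1 \<le> m \<Longrightarrow> c0 / (real m)\<^sup>2 \<le> K \<rho> m" using K_lower by blast
  obtain C where C: "C \<ge> 1" "\<And>a b. a < b \<Longrightarrow> part_fun lam a b \<le> C * K \<rho> (b - a)"
    using part_fun_le[OF lam] by blast
  define D where "D = 2 + \<bar>ln (lam * c0 / C)\<bar> / ln 2"
  have D: "2 \<le> D" by (simp add: D_def)
  \<comment> \<open>The terms in \<open>A\<close> and in \<open>R\<close> are the durations of the
    two phases in \<open>mixing\<close> with \<open>\<Lambda> = D * ln L\<close> and
    \<open>Nm = L\<close>, where the inner logarithm is at most \<open>(D + 2) * ln L\<close>. The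
    final summand one secures \<open>1 <= M\<close>.\<close>
  define M where "M = 4 * (5 * A) * D * (D + 2) + (5 * R) * ((8 * B + 4) * D + 2) / 2 + 1"
  have M1: "1 \<le> M" using A B R D by (simp add: M_def add_nonneg_nonneg)
  have "T_mix \<rho> lam L \<le> ereal (M * (ln (real L))\<^sup>2)" if hL: "2 \<le> L" and y1: "1 \<le> ln (real L)" for L
  proof -
    interpret polymer \<rho> lam L by unfold_locales (use lam hL in auto)
    define y where "y = ln (real L)"
    have y: "1 \<le> y" using y1 by (simp add: y_def)
    have Dy: "1 \<le> D * y" using D y by (metis mult_mono mult_1 order_trans zero_le_one one_le_numeral)
    have "ln (D * y * real L) = ln D + ln y + y"
      using D y L by (simp add: ln_mult y_def)
    also have "\<dots> \<le> D + y + y" using ln_bound[of D] ln_bound[of y] D y by (intro add_mono) auto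
    also have "\<dots> \<le> D * y + 2 * y" using D y mult_left_mono[of 1 y D] by simp
    finally have lnb: "ln (D * y * real L) \<le> (D + 2) * y" by (simp add: algebra_simps)
    have time: "4 * (5 * A) * (D * y) * ln (D * y * real L) + 5 * R * ((8 * B + 4) * (D * y) + 2) / 2 \<le> M * y\<^sup>2"
    proof -
      have "4 * (5 * A) * (D * y) * ln (D * y * real L) \<le> 4 * (5 * A) * (D * y) * ((D + 2) * y)"
        using lnb A D y by (intro mult_left_mono) auto
      moreover have "(8 * B + 4) * (D * y) + 2 \<le> ((8 * B + 4) * D + 2) * y\<^sup>2"
      proof -
        have yy: "y \<le> y\<^sup>2" "1 \<le> y\<^sup>2" using y by (simp_all add: self_le_power one_le_power)
        have "(8 * B + 4) * D * y \<le> (8 * B + 4) * D * y\<^sup>2" using yy B D by (intro mult_left_mono) auto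
        then show ?thesis using yy by (simp add: algebra_simps)
      qed
      then have "5 * R * ((8 * B + 4) * (D * y) + 2) / 2 \<le> 5 * R * (((8 * B + 4) * D + 2) * y\<^sup>2) / 2"
        using R by (intro divide_right_mono mult_left_mono) auto
      moreover have "M * y\<^sup>2 = 4 * (5 * A) * (D * y) * ((D + 2) * y) + 5 * R * (((8 * B + 4) * D + 2) * y\<^sup>2) / 2 + y\<^sup>2"
        unfolding M_def power2_eq_square by (simp add: algebra_simps add_divide_distrib)
      moreover have "0 \<le> y\<^sup>2" by simp
      ultimately show ?thesis by linarith
    qed
    have "tv_dist L (law \<rho> lam L (M * y\<^sup>2) \<sigma>) (equil \<rho> lam L) \<le> 1 / (2 * exp 1)" if \<sigma>: "\<sigma> \<in> Omega L" for \<sigma>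
    proof -
      have "(\<Sum>\<eta>\<in>Omega L. \<bar>P (M * y\<^sup>2) (indicator {\<eta>}) \<sigma> - equil \<rho> lam L \<eta>\<bar>) / 2 \<le> 1 / (2 * exp 1)"
      proof (rule mixing[where N = "\<lambda>\<eta>. real (num_particles L \<eta>)" and Nm = "real L" and A = "5 * A"
            and B = B and R = "5 * R" and \<Lambda> = "D * y"])
        show "(\<Sum>x\<in>Omega L. equil \<rho> lam L x * real (num_particles L x) * (f x)\<^sup>2) \<le> 5 * A * E f + B * ip f f" for f
          by (intro particle_form A FI)
        have "convex_in L I" by (auto simp: convex_in_def)
        then show "ip f f - (\<Sum>x\<in>Omega L. equil \<rho> lam L x * f x)\<^sup>2 \<le> 5 * R * E f" for f
          by (intro poincare R)
        show "exp (- (D * y * (real (num_particles L \<eta>) + 1))) \<le> equil \<rho> lam L \<eta>" if "\<eta> \<in> Omega L" for \<eta>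
          unfolding y_def by (rule equil_lower[OF c0 C D_def that])
        show "real (num_particles L \<eta>) + 1 \<le> real L" for \<eta>
        proof -
          have "num_particles L \<eta> \<le> card {0<..<L}"
            unfolding num_particles_def by (intro card_mono) auto
          then show ?thesis using L by simp
        qed
      qed (use A B R Dy time \<sigma> in auto)
      then show ?thesis by (simp add: tv_dist_def law_def P_eq_semigroup)
    qed
    then show ?thesis
      using M1 unfolding y_def by (intro T_mix_le) auto
  qed
  then show ?thesis using M1 by blast
qed

lemma mixing_lower:
  assumes lam: "0 < lam" "lam < 1" and \<epsilon>: "0 < \<epsilon>"
  shows "\<exists>L0>0. \<forall>L\<ge>2. L0 \<le> real L \<longrightarrow> ereal ((1 - \<epsilon>) * ln (real L)) \<le> T_mix \<rho> lam L"
proof -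
  obtain C where C: "C \<ge> 1" "\<And>a b. a < b \<Longrightarrow> part_fun lam a b \<le> C * K \<rho> (b - a)"
    using part_fun_le[OF lam] by blast
  \<comment> \<open>The union bound has prefactor \<open>4 * C^2\<close> and two such tails, one for
    each end of the box; together they amount to \<open>1 / 10\<close>.\<close>
  obtain J where J: "\<And>A. finite A \<Longrightarrow> A \<subseteq> {J..} \<Longrightarrow> sum (K \<rho>) A \<le> 1 / (80 * C\<^sup>2)"
    using K_tail[of "1 / (80 * C\<^sup>2)"] C(1) by auto
  \<comment> \<open>\<open>4 * J + 4\<close> keeps the middle set \<open>A\<close> farther than
    \<open>J\<close> from both ends and leaves it at least \<open>L / 4\<close> sites. The last term
    makes \<open>L powr \<epsilon>\<close> at least \<open>36\<close>, so that at least nine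
    particles are expected to have escaped every ring.\<close>
  define L0 where "L0 = 4 * real J + 4 + 36 powr (1 / \<epsilon>)"
  have "ereal ((1 - \<epsilon>) * ln (real L)) \<le> T_mix \<rho> lam L" if hL: "2 \<le> L" "L0 \<le> real L" for L
  proof -
    interpret polymer \<rho> lam L by unfold_locales (use lam hL in auto)
    define A where "A = {L div 4<..<L - L div 4}"
    have "4 * real J + 4 \<le> real L"
      using hL(2) powr_ge_zero[of 36 "1 / \<epsilon>"] unfolding L0_def by linarith
    then have LJ: "4 * J + 4 \<le> L" by linarith
    have A: "A \<subseteq> I" and fA: "finite A" by (auto simp: A_def)
    have cA: "real L / 4 \<le> real (card A)"
    proof -
      have "L \<le> 4 * card A" using LJ by (simp add: A_def)
      then show ?thesis by linarith
    qed
    have "sum (K \<rho>) A \<le> 1 / (80 * C\<^sup>2)"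
      using LJ by (intro J) (auto simp: A_def)
    moreover have "(\<Sum>x\<in>A. K \<rho> (L - x)) \<le> 1 / (80 * C\<^sup>2)"
    proof -
      have "(\<Sum>x\<in>A. K \<rho> (L - x)) = sum (K \<rho>) ((\<lambda>x. L - x) ` A)"
        by (subst sum.reindex) (auto simp: A_def inj_on_def)
      also have "\<dots> \<le> 1 / (80 * C\<^sup>2)" using LJ by (intro J) (auto simp: A_def)
      finally show ?thesis .
    qed
    ultimately have "(\<Sum>x\<in>A. K \<rho> x + K \<rho> (L - x)) \<le> 1 / (80 * C\<^sup>2) + 1 / (80 * C\<^sup>2)"
      unfolding sum.distrib by (rule add_mono)
    then have "4 * C\<^sup>2 * (\<Sum>x\<in>A. K \<rho> x + K \<rho> (L - x)) \<le> 4 * C\<^sup>2 * (1 / (80 * C\<^sup>2) + 1 / (80 * C\<^sup>2))"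
      by (intro mult_left_mono) auto
    also have "\<dots> = 1 / 10" using C(1) by (simp add: field_simps)
    finally have eq: "9 / 10 \<le> (\<Sum>\<eta>\<in>Omega L. equil \<rho> lam L \<eta> * avoid A \<eta>)"
      using equil_avoid_ge[OF C A] by simp
    show ?thesis
    proof (rule T_mix_ge, rule bexI)
      fix t assume t: "0 \<le> t" "t < (1 - \<epsilon>) * ln (real L)"
      have "36 = (36 powr (1 / \<epsilon>)) powr \<epsilon>" using \<epsilon> by (simp add: powr_powr)
      also have "\<dots> \<le> real L powr \<epsilon>"
        using hL(2) \<epsilon> unfolding L0_def by (intro powr_mono2) auto
      finally have "9 \<le> real L powr \<epsilon> / 4" by simp
      also have "\<dots> = real L / 4 * exp (- ((1 - \<epsilon>) * ln (real L)))"
        using L by (simp add: powr_def exp_diff algebra_simps exp_minus field_simps)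
      also have "\<dots> \<le> real (card A) * exp (- t)"
        using t cA by (intro mult_mono) auto
      finally have 9: "9 \<le> real (card A) * exp (- t)" .
      have "P t (avoid A) (config L I) \<le> (1 - exp (- t)) ^ card A"
        by (rule avoid_le[OF A t(1)])
      also have "\<dots> \<le> exp (- exp (- t)) ^ card A"
        using exp_ge_add_one_self[of "- exp (- t)"] t by (intro power_mono) auto
      also have "\<dots> = exp (- (real (card A) * exp (- t)))"
        by (simp flip: exp_of_nat_mult)
      also have "\<dots> \<le> exp (- 9)" using 9 by simp
      also have "\<dots> \<le> 1 / 10"
        using exp_ge_add_one_self[of "9::real"] by (simp add: exp_minus field_simps)
      finally have "(9 / 10 - 1 / 10) / 2 \<le> ((\<Sum>\<eta>\<in>Omega L. equil \<rho> lam L \<eta> * avoid A \<eta>) - P t (avoid A) (config L I)) / 2"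
        using eq by simp
      also have "\<dots> \<le> tv_dist L (law \<rho> lam L t (config L I)) (equil \<rho> lam L)"
        by (rule tv_ge[OF config_Omega])
      finally have "2 / 5 \<le> tv_dist L (law \<rho> lam L t (config L I)) (equil \<rho> lam L)" by simp
      moreover have "1 / (2 * exp (1::real)) \<le> 1 / 4"
        using exp_ge_add_one_self[of "1::real"] by (simp add: field_simps)
      ultimately show "1 / (2 * exp 1) < tv_dist L (law \<rho> lam L t (config L I)) (equil \<rho> lam L)"
        by linarith
    qed (rule config_Omega)
  qed
  moreover have "0 < L0" using powr_ge_zero[of 36 "1 / \<epsilon>"] unfolding L0_def by linarith
  ultimately show ?thesis by blast
qed

end

theorem theorem3:
  fixes \<rho> :: real
  assumes "0 < \<rho>" and "\<rho> < 1"
  shows "\<exists>C3::real. \<forall>lam::real. 0 < lam \<and> lam < 1 \<longrightarrow>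
    (\<forall>\<epsilon>::real. \<epsilon> > 0 \<longrightarrow> (\<exists>L0::real. L0 > 0 \<and>
       (\<forall>L::nat. 2 \<le> L \<and> L0 \<le> real L \<longrightarrow>
          ereal ((1 - \<epsilon>) * ln (real L)) \<le> T_mix \<rho> lam L \<and>
          T_mix \<rho> lam L \<le> ereal (ln (real L) powr C3)))) \<and>
    (\<exists>C4::real. C4 > 0 \<and> (\<forall>L::nat. 2 \<le> L \<longrightarrow> T_rel \<rho> lam L \<le> ereal C4))"
\<comment> \<open>The mixing time is at most \<open>M * (ln L)^2\<close>, where \<open>M\<close>
  depends on \<open>lam\<close>. One further power of \<open>ln L\<close> swallows \<open>M\<close>
  for large \<open>L\<close>, so the exponent three serves every \<open>lam\<close>.\<close>
proof (rule exI[of _ "3::real"], intro allI impI conjI; elim conjE)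
  interpret renewal \<rho> by unfold_locales (use assms in auto)
  fix lam :: real assume lam: "0 < lam" "lam < 1"
  show "\<exists>C4>0. \<forall>L\<ge>2. T_rel \<rho> lam L \<le> ereal C4"
    using relaxation_bound[OF lam] .
  fix \<epsilon> :: real assume \<epsilon>: "0 < \<epsilon>"
  obtain L1 where L1: "L1 > 0" "\<And>L. 2 \<le> L \<Longrightarrow> L1 \<le> real L \<Longrightarrow> ereal ((1 - \<epsilon>) * ln (real L)) \<le> T_mix \<rho> lam L"
    using mixing_lower[OF lam \<epsilon>] by blast
  obtain M where M: "M \<ge> 1" "\<And>L. 2 \<le> L \<Longrightarrow> 1 \<le> ln (real L) \<Longrightarrow> T_mix \<rho> lam L \<le> ereal (M * (ln (real L))\<^sup>2)"
    using mixing_upper[OF lam] by blast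
  show "\<exists>L0>0. \<forall>L. 2 \<le> L \<and> L0 \<le> real L \<longrightarrow>
      ereal ((1 - \<epsilon>) * ln (real L)) \<le> T_mix \<rho> lam L \<and> T_mix \<rho> lam L \<le> ereal (ln (real L) powr 3)"
  \<comment> \<open>\<open>exp M <= L\<close> means \<open>M <= ln L\<close>, which is the
    absorption of \<open>M\<close>; as \<open>M >= 1\<close>, it also supplies
    \<open>1 <= ln L\<close>.\<close>
  proof (rule exI[of _ "max L1 (exp M)"], intro conjI allI impI; (elim conjE)?)
    show "0 < max L1 (exp M)" by (simp add: less_max_iff_disj)
    fix L :: nat assume L: "2 \<le> L" "max L1 (exp M) \<le> real L"
    show "ereal ((1 - \<epsilon>) * ln (real L)) \<le> T_mix \<rho> lam L" using L by (intro L1) auto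
    have lnL: "M \<le> ln (real L)" using L by (simp add: ln_ge_iff)
    have "T_mix \<rho> lam L \<le> ereal (M * (ln (real L))\<^sup>2)" using M L lnL by (intro M) auto
    also have "M * (ln (real L))\<^sup>2 \<le> ln (real L) * (ln (real L))\<^sup>2"
      using lnL by (intro mult_right_mono) auto
    also have "\<dots> = ln (real L) powr 3"
      using lnL M(1) by (simp add: powr_numeral power2_eq_square power3_eq_cube)
    finally show "T_mix \<rho> lam L \<le> ereal (ln (real L) powr 3)" by simp
  qed
qed

end
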